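(* The map $f \mapsto \big(\widetilde{M}f\big)'$ is continuous from $W^{1,1}(\mathbb{R})$ to $L^1(\mathbb{R})$. That is, if $f \in W^{1,1}(\mathbb{R})$ and $\{f_j\}_{j\ge 1} \subset W^{1,1}(\mathbb{R})$ satisfy $\|f_j - f\|_{W^{1,1}(\mathbb{R})} \to 0$ as $j \to \infty$, then $\big\|\big(\widetilde{M}f_j\big)' - \big(\widetilde{M}f\big)'\big\|_{L^1(\mathbb{R})} \to 0$ as $j \to \infty$.
   Context: Functions are real-valued. For $f \in L^1_{loc}(\mathbb{R})$, the uncentered Hardy-Littlewood maximal function is $$\widetilde{M}f(x) = \sup_{I \ni x} \frac{1}{m(I)} \int_I |f(y)|\,dy,$$ the supremum being over all bounded open intervals $I$ containing $x$, with $m(I)$ the length of $I$. $W^{1,1}(\mathbb{R})$ is the Sobolev space with norm $\|f\|_{W^{1,1}(\mathbb{R})} = \|f\|_{L^1(\mathbb{R})} + \|f'\|_{L^1(\mathbb{R})}$; each $f\in W^{1,1}(\mathbb{R})$ is identified with its absolutely continuous representative. It is known (Tanaka; Aldaz and P\'erez L\'azaro) that if $f \in W^{1,1}(\mathbb{R})$ then $\widetilde{M}f$ is absolutely continuous and $\|(\widetilde{M}f)'\|_{L^1(\mathbb{R})} \le \|f'\|_{L^1(\mathbb{R})}$, so the map is well defined. *)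

theory Defs
  imports "HOL-Analysis.Analysis"
begin

text \<open>
  Functions are arbitrary representatives of their almost-everywhere classes. Nothing below
  depends on the representative of \<open>f\<close>: weak derivatives, norms and the maximal function only
  see \<open>f\<close> through Lebesgue integrals. In particular the absolutely continuous representative of
  a Sobolev function is included.
\<close>

definition test_function :: "(real \<Rightarrow> real) \<Rightarrow> bool" where
  "test_function \<phi> \<longleftrightarrow>
     (\<forall>n x. (deriv ^^ n) \<phi> differentiable (at x)) \<and> compact (closure {x. \<phi> x \<noteq> 0})"

definition locally_integrable :: "(real \<Rightarrow> real) \<Rightarrow> bool" where
  "locally_integrable f \<longleftrightarrow> (\<forall>K. compact K \<longrightarrow> f absolutely_integrable_on K)"

definition has_weak_derivative :: "(real \<Rightarrow> real) \<Rightarrow> (real \<Rightarrow> real) \<Rightarrow> bool" where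
  "has_weak_derivative f g \<longleftrightarrow>
     locally_integrable f \<and> locally_integrable g \<and>
     (\<forall>\<phi>. test_function \<phi> \<longrightarrow>
        (LINT x|lebesgue. f x * deriv \<phi> x) = - (LINT x|lebesgue. g x * \<phi> x))"

text \<open>
  A weak derivative is unique up to null sets, so the choice is immaterial for \<open>L1_norm\<close> below.
  For a (locally) absolutely continuous function it is the pointwise derivative almost everywhere.
\<close>

definition weak_derivative :: "(real \<Rightarrow> real) \<Rightarrow> real \<Rightarrow> real" where
  "weak_derivative f = (SOME g. has_weak_derivative f g)"

text \<open>
  The norms take values in \<open>[0, \<infinity>]\<close>, so a function that is not integrable has
  norm \<open>\<infinity>\<close> rather than the default value 0 of the Bochner integral.
\<close>

definition L1_norm :: "(real \<Rightarrow> real) \<Rightarrow> ennreal" where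
  "L1_norm f = (\<integral>\<^sup>+ x. ennreal \<bar>f x\<bar> \<partial>lebesgue)"

definition W11 :: "(real \<Rightarrow> real) set" where
  "W11 = {f. integrable lebesgue f \<and> (\<exists>g. has_weak_derivative f g \<and> integrable lebesgue g)}"

definition W11_norm :: "(real \<Rightarrow> real) \<Rightarrow> ennreal" where
  "W11_norm f = L1_norm f + L1_norm (weak_derivative f)"

text \<open>
  The supremum is taken in \<open>[0, \<infinity>]\<close>. It is finite for \<open>f\<close> in \<open>W11\<close>, which is essentially
  bounded, so \<open>enn2real\<close> (which sends \<open>\<infinity>\<close> to 0) loses nothing there.
\<close>

definition uncentered_maximal :: "(real \<Rightarrow> real) \<Rightarrow> real \<Rightarrow> real" where
  "uncentered_maximal f x =
     enn2real (SUP (a, b) \<in> {(a, b). a < x \<and> x < b}.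
       (\<integral>\<^sup>+ y \<in> {a<..<b}. ennreal \<bar>f y\<bar> \<partial>lebesgue) / ennreal (b - a))"

end

theory Submission
  imports Defs
begin

text \<open>
  Replacing \<open>f\<close> by \<open>\<bar>f\<bar>\<close>, the maximal function is the maximum of its right and left one-sided
  versions, and both \<open>\<bar>\<sqdot>\<bar>\<close> and \<open>max\<close> are continuous for the \<open>L\<^sup>1\<close> norm of derivatives. It remains
  to treat the right maximal function \<open>u\<close> of some \<open>f \<ge> 0\<close>.

  On the open set \<open>E = {u > f}\<close> one has \<open>u' = (u - f) / r \<ge> 0\<close>, where \<open>r(x)\<close> is the largest optimal
  length at \<open>x\<close>; off \<open>E\<close> one has \<open>u' = f'\<close>, and \<open>f' \<le> 0\<close> almost everywhere. On each component of
  \<open>E\<close> the functions \<open>u\<close> and \<open>f\<close> have the same increment, so \<open>u\<close> is absolutely continuous.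

  For the continuity, let \<open>u\<^sub>j\<close> belong to \<open>f\<^sub>j\<close>. As \<open>u\<close> and \<open>u\<^sub>j\<close> vanish at infinity, the integral of
  \<open>u\<^sub>j' - u'\<close> is 0 and \<open>\<parallel>u\<^sub>j' - u'\<parallel>\<^sub>1\<close> is twice the integral of the positive part of \<open>u' - u\<^sub>j'\<close>; hence
  only a lower bound for \<open>u\<^sub>j'\<close> is needed. Off \<open>E\<close> that positive part is at most \<open>\<bar>f\<^sub>j' - f'\<bar>\<close>, because
  \<open>u' = f' \<le> 0 \<le> u\<^sub>j'\<close> on \<open>{u\<^sub>j > f\<^sub>j}\<close>. On \<open>E\<close> limits of optimal lengths of \<open>f\<^sub>j\<close> are optimal for
  \<open>f\<close>, so they are at most \<open>r\<close> and \<open>liminf u\<^sub>j' \<ge> u'\<close>; dominated convergence concludes.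
\<close>

subsection \<open>Absolutely continuous functions\<close>

text \<open>One-sidedness is what gives \<open>u'\<close> a sign: cutting an initial piece off an
  optimal interval cannot lower its average, so \<open>u\<close> increases along each component of
  \<open>E\<close>. The two-sided maximal function has no such monotonicity. The obstacle is that
  the optimal length is neither unique nor continuous, in the point or in the function. Taking the
  largest one makes it upper semicontinuous, and since it stands in the denominator of
  \<open>u'\<close>, this is just what a lower bound for \<open>u_j'\<close> requires. The formula
  \<open>(u - f) / r\<close> comes from moving the left end of an optimal interval while its right
  end stays fixed. Integrability of \<open>u'\<close> on \<open>E\<close> is an issue because
  \<open>E\<close> may have infinitely many components: on each of them the increment of
  \<open>u\<close> is at most the variation of \<open>f\<close> there, and these variations add up
  to at most the \<open>L1\<close> norm of \<open>f'\<close>. Convergence in \<open>W11\<close>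
  enters through one number, the \<open>L1\<close> distance of the derivatives; it bounds the
  distance of the functions uniformly, hence also that of all averages. The relation
  \<open>primitive f g\<close> carries the derivative along as an explicit function; weak
  derivatives are connected with it only at the end.\<close>

definition primitive :: "(real \<Rightarrow> real) \<Rightarrow> (real \<Rightarrow> real) \<Rightarrow> bool" where
  "primitive f g \<longleftrightarrow> integrable lebesgue g \<and> (\<forall>a b. a \<le> b \<longrightarrow> (g has_integral f b - f a) {a..b})"

lemma primitive_integrable: "primitive f g \<Longrightarrow> integrable lebesgue g"
  and primitive_has_integral: "primitive f g \<Longrightarrow> a \<le> b \<Longrightarrow> (g has_integral f b - f a) {a..b}"
  by (auto simp: primitive_def)

lemma integrable_lebesgue_abs_int: "integrable lebesgue (g::real \<Rightarrow> real) \<longleftrightarrow> g absolutely_integrable_on UNIV"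
  by (simp add: set_integrable_def)

lemma integrable_lebesgue_Icc:
  fixes g :: "real \<Rightarrow> real"
  assumes "integrable lebesgue g"
  shows "g absolutely_integrable_on {a..b}" "g integrable_on {a..b}"
proof -
  show "g absolutely_integrable_on {a..b}"
    using assms by (auto simp: integrable_lebesgue_abs_int intro: set_integrable_subset)
  then show "g integrable_on {a..b}"
    by (rule absolutely_integrable_on_def[THEN iffD1, THEN conjunct1])
qed

lemma primitive_add:
  assumes "primitive f g" "primitive f' g'"
  shows "primitive (\<lambda>x. f x + f' x) (\<lambda>x. g x + g' x)"
  unfolding primitive_def
proof (intro conjI allI impI)
  fix a b :: real assume "a \<le> b"
  then have "((\<lambda>x. g x + g' x) has_integral (f b - f a) + (f' b - f' a)) {a..b}"
    using assms by (intro has_integral_add primitive_has_integral)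
  then show "((\<lambda>x. g x + g' x) has_integral (f b + f' b) - (f a + f' a)) {a..b}"
    by (simp add: algebra_simps)
qed (use assms in \<open>auto dest: primitive_integrable\<close>)

lemma primitive_cmult:
  assumes "primitive f g"
  shows "primitive (\<lambda>x. c * f x) (\<lambda>x. c * g x)"
  unfolding primitive_def
proof (intro conjI allI impI)
  fix a b :: real assume "a \<le> b"
  then have "((\<lambda>x. c * g x) has_integral c * (f b - f a)) {a..b}"
    using assms by (intro has_integral_mult_right primitive_has_integral)
  then show "((\<lambda>x. c * g x) has_integral c * f b - c * f a) {a..b}"
    by (simp add: algebra_simps)
qed (use assms in \<open>auto dest: primitive_integrable\<close>)

lemma primitive_diff:
  assumes "primitive f g" "primitive f' g'"
  shows "primitive (\<lambda>x. f x - f' x) (\<lambda>x. g x - g' x)"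
  using primitive_add[OF assms(1) primitive_cmult[OF assms(2), of "-1"]] by simp

lemma primitive_reflect:
  assumes "primitive f g"
  shows "primitive (\<lambda>x. f (- x)) (\<lambda>x. - g (- x))"
  unfolding primitive_def
proof (intro conjI allI impI)
  fix a b :: real assume "a \<le> b"
  then have "(g has_integral f (-a) - f (-b)) {-b..-a}"
    using assms by (intro primitive_has_integral) auto
  then have "((\<lambda>x. g (- x)) has_integral f (-a) - f (-b)) {a..b}"
    using has_integral_reflect_real[of g "f (-a) - f (-b)" "-a" "-b"] by simp
  then have "((\<lambda>x. - g (- x)) has_integral - (f (-a) - f (-b))) {a..b}"
    by (rule has_integral_neg)
  then show "((\<lambda>x. - g (- x)) has_integral f (-b) - f (-a)) {a..b}"
    by simp
next
  show "integrable lebesgue (\<lambda>x. - g (- x))"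
    using primitive_integrable[OF assms] lebesgue_integrable_real_affine[of g "-1" 0]
    by simp
qed

lemma primitive_isCont:
  assumes "primitive f g"
  shows "isCont f x"
proof -
  have "continuous_on {x-1..x+1} (\<lambda>y. integral {x-1..y} g)"
    by (rule indefinite_integral_continuous_1[OF integrable_lebesgue_Icc(2)[OF primitive_integrable[OF assms]]])
  then have "continuous_on {x-1..x+1} (\<lambda>y. f (x-1) + integral {x-1..y} g)"
    by (intro continuous_intros)
  moreover have "f (x-1) + integral {x-1..y} g = f y" if "y \<in> {x-1..x+1}" for y
    using primitive_has_integral[OF assms, of "x-1" y] that by (auto simp: integral_unique)
  ultimately have "continuous_on {x-1..x+1} f"
    using continuous_on_eq by blast
  then show ?thesis
    by (rule continuous_on_interior) auto
qed

lemma primitive_continuous_on: "primitive f g \<Longrightarrow> continuous_on S f"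
  by (simp add: continuous_at_imp_continuous_on primitive_isCont)

section \<open>Lebesgue differentiation and uniqueness of derivatives\<close>

lemma right_derivative_AE:
  fixes g :: "real \<Rightarrow> real"
  assumes "\<And>a b. g integrable_on {a..b}"
  shows "AE x in lebesgue. \<forall>e>0. \<exists>d>0. \<forall>h. 0 < h \<and> h < d \<longrightarrow> \<bar>integral {x..x+h} g / h - g x\<bar> < e"
proof -
  obtain N where N: "negligible N"
       "\<And>x e. \<lbrakk>x \<notin> N; 0 < e\<rbrakk> \<Longrightarrow> \<exists>d>0. \<forall>h. 0 < h \<and> h < d \<longrightarrow>
                         norm(integral (cbox x (x + h *\<^sub>R One)) g /\<^sub>R h ^ DIM(real) - g x) < e"
    using integrable_ccontinuous_explicit[of g] assms by (auto simp: cbox_interval)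
  have "\<forall>e>0. \<exists>d>0. \<forall>h. 0 < h \<and> h < d \<longrightarrow> \<bar>integral {x..x+h} g / h - g x\<bar> < e"
    if "x \<notin> N" for x
    using N(2)[OF that] by (simp add: cbox_interval divide_inverse_commute)
  note * = this
  show ?thesis
  proof (rule AE_I')
    show "N \<in> null_sets lebesgue" using N(1) by (simp add: negligible_iff_null_sets)
    show "{x \<in> space lebesgue. \<not> (\<forall>e>0. \<exists>d>0. \<forall>h. 0 < h \<and> h < d \<longrightarrow> \<bar>integral {x..x+h} g / h - g x\<bar> < e)} \<subseteq> N"
      using * by blast
  qed
qed

lemma integral_0_imp_AE_0:
  fixes g :: "real \<Rightarrow> real"
  assumes "\<And>a b. a \<le> b \<Longrightarrow> (g has_integral 0) {a..b}"
  shows "AE x in lebesgue. g x = 0"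
proof -
  have int: "g integrable_on {a..b}" for a b
    using assms[of a b] by (cases "a \<le> b") auto
  from right_derivative_AE[OF int] show ?thesis
  proof eventually_elim
    case (elim x)
    show "g x = 0"
    proof (rule ccontr)
      assume "g x \<noteq> 0"
      then obtain d where d: "d > 0" "\<forall>h. 0 < h \<and> h < d \<longrightarrow> \<bar>integral {x..x+h} g / h - g x\<bar> < \<bar>g x\<bar>"
        using elim by (meson zero_less_abs_iff)
      moreover have "integral {x..x+d/2} g = 0"
        using assms[of x "x+d/2"] d(1) by (auto intro!: integral_unique)
      ultimately show False
        by (auto dest!: spec[of _ "d/2"])
    qed
  qed
qed

lemma primitive_AE_unique:
  assumes "primitive f g" "primitive f g'"
  shows "AE x in lebesgue. g x = g' x"
proof -
  have "AE x in lebesgue. g x - g' x = 0"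
    using has_integral_diff[OF primitive_has_integral[OF assms(1)] primitive_has_integral[OF assms(2)]]
    by (intro integral_0_imp_AE_0) force
  then show ?thesis by simp
qed

section \<open>Gluing increments along the components of an open set\<close>

lemma open_components_enum:
  fixes U :: "real set"
  assumes "open U"
  obtains A :: "nat \<Rightarrow> real set" where "disjoint_family A" "(\<Union>n. A n) = U"
    "\<And>n. A n = {} \<or> A n \<in> components U"
proof -
  let ?K = "components U"
  have c: "countable ?K"
    using countable_disjoint_open_subsets[of ?K] open_components[OF assms] pairwise_disjoint_components[of U]
    by (auto simp: disjoint_def pairwise_def disjnt_def)
  \<comment> \<open>Indices that code no component get the empty set, so that there is a sequence
    over \<open>nat\<close> even when the components are finite in number.\<close>
  define A where "A n = (if n \<in> to_nat_on ?K ` ?K then from_nat_into ?K n else {})" for n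
  have A: "A (to_nat_on ?K C) = C" if "C \<in> ?K" for C
    using that c by (auto simp: A_def)
  have A': "A n = {} \<or> (A n \<in> ?K \<and> n = to_nat_on ?K (A n))" for n
    using c by (auto simp: A_def)
  show ?thesis
  proof (rule that[of A])
    show "disjoint_family A"
      unfolding disjoint_family_on_def
    proof (intro ballI impI)
      fix m n :: nat assume "m \<noteq> n"
      then show "A m \<inter> A n = {}"
        using A'[of m] A'[of n] components_eq[of "A m" U "A n"] by (metis Int_empty_left Int_empty_right)
    qed
    show "(\<Union>n. A n) = U"
    proof -
      have "(\<Union>n. A n) = \<Union>?K" proof (intro equalityI subsetI)
        fix x assume "x \<in> (\<Union>n. A n)"
        then show "x \<in> \<Union>?K" using A' by blast
      next
        fix x assume "x \<in> \<Union>?K"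
        then show "x \<in> (\<Union>n. A n)" using A by blast
      qed
      then show ?thesis by (simp add: Union_components[symmetric])
    qed
    show "A n = {} \<or> A n \<in> components U" for n using A' by auto
  qed
qed

text \<open>An endpoint in \<open>U\<close> could be added to the component, against its maximality.
  This will locate zeros of a function at both ends of a component of its nonzero set.\<close>

lemma component_interval:
  fixes U :: "real set"
  assumes "open U" "bounded U" "C \<in> components U"
  obtains a b where "a < b" "C = {a<..<b}" "a \<notin> U" "b \<notin> U"
proof -
  have C: "open C" "C \<noteq> {}" "connected C" "C \<subseteq> U" "bounded C"
    using open_components[OF assms(1,3)] in_components_nonempty[OF assms(3)]
      in_components_connected[OF assms(3)] in_components_subset[OF assms(3)]
      bounded_subset[OF assms(2)] by auto
  define a b where "a = Inf C" and "b = Sup C"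
  have bd: "bdd_below C" "bdd_above C"
    using C(5) bounded_imp_bdd_below bounded_imp_bdd_above by auto
  have nin: "a \<notin> C"
    unfolding a_def by (rule Inf_notin_open[OF C(1), of "Inf C - 1"]) (use bd cInf_lower in force)
  have nin2: "b \<notin> C"
    unfolding b_def by (rule Sup_notin_open[OF C(1), of "Sup C + 1"]) (use bd cSup_upper in force)
  have eq: "C = {a<..<b}"
  proof (intro equalityI subsetI)
    fix x assume "x \<in> C"
    then show "x \<in> {a<..<b}"
      using nin nin2 bd cInf_lower[of x C] cSup_upper[of x C] by (auto simp: a_def b_def less_le)
  next
    fix x assume x: "x \<in> {a<..<b}"
    obtain y where "y \<in> C" "y < x" using x C(2) bd by (auto simp: a_def cInf_less_iff)
    moreover obtain z where "z \<in> C" "x < z" using x C(2) bd by (auto simp: b_def less_cSup_iff)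
    ultimately show "x \<in> C" using C(3) connectedD_interval[of C y z x] by simp
  qed
  have ab: "a < b" using C(2) eq by auto
  have mid: "(a + b) / 2 \<in> C" using ab by (simp add: eq)
  have max: "T \<subseteq> C" if "connected T" "T \<subseteq> U" "(a + b) / 2 \<in> T" for T
    using components_maximal[OF assms(3)] that mid by blast
  have "a \<notin> U"
  proof
    assume "a \<in> U"
    then have "{a..<b} \<subseteq> C" using C(4) eq ab
      by (intro max) (auto simp: less_eq_real_def field_simps)
    then show False using nin nin2 ab by auto
  qed
  moreover have "b \<notin> U"
  proof
    assume "b \<in> U"
    then have "{a<..b} \<subseteq> C" using C(4) eq ab
      by (intro max) (auto simp: less_eq_real_def field_simps)
    then show False using nin nin2 ab by auto
  qed
  ultimately show ?thesis using that eq ab by blast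
qed

text \<open>The increment formula passes from compact subintervals to the closed interval because
  \<open>h\<close> and the indefinite integral of \<open>q\<close> are continuous up to the ends,
  while their difference \<open>D\<close> is constant inside.\<close>

lemma interval_integral_of_interior:
  fixes h q :: "real \<Rightarrow> real"
  assumes ab: "a \<le> b" and cont: "continuous_on {a..b} h"
    and q: "q absolutely_integrable_on {a<..<b}"
    and h: "\<And>c d. a < c \<Longrightarrow> c \<le> d \<Longrightarrow> d < b \<Longrightarrow> (q has_integral h d - h c) {c..d}"
  shows "(q has_integral h b - h a) {a..b}"
proof (cases "a = b")
  case False
  with ab have ab: "a < b" by simp
  have qi: "q integrable_on {a..b}"
    using integrable_on_Icc_iff_Ioo set_lebesgue_integral_eq_integral(1) q by blast
  define D where "D x = h x - integral {a..x} q" for x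
  have cD: "continuous_on {a..b} D"
    unfolding D_def by (intro continuous_intros cont indefinite_integral_continuous_1 qi)
  have "D b = D a"
  proof (rule DERIV_isconst_end[OF ab cD])
    fix x assume x: "a < x" "x < b"
    have "D y = D x" if "y \<in> {a<..<b}" for y
    proof -
      have *: "D d = D c" if "a < c" "c \<le> d" "d < b" for c d
      proof -
        have "q integrable_on {a..d}"
          by (rule integrable_on_subinterval[OF qi]) (use that in auto)
        then have "integral {a..c} q + integral {c..d} q = integral {a..d} q"
          using that by (intro Henstock_Kurzweil_Integration.integral_combine) auto
        moreover have "integral {c..d} q = h d - h c"
          using h[OF that] by (rule integral_unique)
        ultimately show ?thesis by (simp add: D_def)
      qed
      show ?thesis using *[of x y] *[of y x] that x by (cases "x \<le> y") auto
    qed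
    then show "(D has_real_derivative 0) (at x)"
      using has_field_derivative_transform_within_open[of "\<lambda>_. D x" 0 x "{a<..<b}" D] x
      by (metis DERIV_const greaterThanLessThan_iff open_real_greaterThanLessThan)
  qed
  then have "integral {a..b} q = h b - h a"
    by (simp add: D_def)
  then show ?thesis using qi by (simp add: has_integral_integral)
qed (use has_integral_refl in auto)

lemma set_integral_components_eq_0:
  fixes q :: "real \<Rightarrow> real"
  assumes "open U" and q: "q absolutely_integrable_on U"
    and C: "\<And>C. C \<in> components U \<Longrightarrow> (LINT x:C|lebesgue. q x) = 0"
  shows "(LINT x:U|lebesgue. q x) = 0"
proof -
  obtain A :: "nat \<Rightarrow> real set" where A: "disjoint_family A" "(\<Union>n. A n) = U"
    "\<And>n. A n = {} \<or> A n \<in> components U"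
    using open_components_enum[OF assms(1)] by blast
  have "open (A n)" for n
    using A(3)[of n] open_components[OF assms(1)] by auto
  then have "(LINT x:(\<Union>n. A n)|lebesgue. q x) = (\<Sum>n. (LINT x:(A n)|lebesgue. q x))"
    using A q by (intro lebesgue_integral_countable_add) (auto simp: disjoint_family_on_def)
  also have "(LINT x:A n|lebesgue. q x) = 0" for n
    using A(3)[of n] C[of "A n"] by (auto simp: set_lebesgue_integral_def)
  then have "(\<Sum>n. (LINT x:(A n)|lebesgue. q x)) = 0" by simp
  finally show ?thesis using A(2) by simp
qed

text \<open>Between two zeros of \<open>h\<close>, every component of the nonzero set has zeros of
  \<open>h\<close> at both ends, so \<open>q\<close> integrates to 0 over it and, by countable
  additivity, over their union. Only the stretches before the first zero and after the last one
  contribute to the increment. Absolute integrability of \<open>q\<close> on the whole nonzero set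
  is what allows infinitely many components to be summed.\<close>

lemma has_integral_glue:
  fixes h q :: "real \<Rightarrow> real"
  assumes cont: "\<And>x. isCont h x" and q: "q absolutely_integrable_on {x. h x \<noteq> 0}"
    and h: "\<And>a b. a \<le> b \<Longrightarrow> {a..b} \<subseteq> {x. h x \<noteq> 0} \<Longrightarrow> (q has_integral h b - h a) {a..b}"
    and ab: "a \<le> b"
  shows "((\<lambda>x. if h x \<noteq> 0 then q x else 0) has_integral h b - h a) {a..b}"
proof -
  let ?E = "{x. h x \<noteq> 0}"
  let ?k = "\<lambda>x. if h x \<noteq> 0 then q x else 0"
  have ch: "continuous_on S h" for S by (simp add: cont continuous_at_imp_continuous_on)
  have oE: "open ?E"
    by (intro open_Collect_neq ch continuous_on_const)
  have k: "?k absolutely_integrable_on UNIV"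
    using q absolutely_integrable_restrict_UNIV[of ?E q] by simp
  have k': "?k absolutely_integrable_on S" if "S \<in> sets lebesgue" for S
    using set_integrable_subset[OF k] that by auto
  have *: "(?k has_integral h d - h c) {c..d}" if "c \<le> d" "{c<..<d} \<subseteq> ?E" for c d
  proof (rule interval_integral_of_interior[OF that(1) ch k'])
    fix c' d' assume "c < c'" "c' \<le> d'" "d' < d"
    then have sub: "{c'..d'} \<subseteq> ?E" using that(2) by (force simp: subset_iff)
    have "(q has_integral h d' - h c') {c'..d'}"
      by (rule h[OF \<open>c' \<le> d'\<close> sub])
    then show "(?k has_integral h d' - h c') {c'..d'}"
      by (rule has_integral_eq[rotated]) (use sub in auto)
  qed auto
  have **: "(?k has_integral 0) {c..d}" if cd: "c \<le> d" "h c = 0" "h d = 0" for c d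
  proof -
    let ?U = "?E \<inter> {c<..<d}"
    have "(LINT x:?U|lebesgue. ?k x) = 0"
    proof (rule set_integral_components_eq_0)
      show oU: "open ?U" using oE by auto
      show "?k absolutely_integrable_on ?U" using oU by (intro k') auto
      have bU: "bounded ?U" by (rule bounded_subset[of "{c..d}"]) auto
      fix C assume C: "C \<in> components ?U"
      obtain a b where C: "a < b" "C = {a<..<b}" "a \<notin> ?U" "b \<notin> ?U" "C \<subseteq> ?U"
        using component_interval[OF oU bU C] in_components_subset[OF C] by metis
      then have sub: "c \<le> a" "b \<le> d"
        by (auto simp: greaterThanLessThan_subseteq_greaterThanLessThan)
      \<comment> \<open>An end of the component that lies strictly between \<open>c\<close> and
        \<open>d\<close> is outside \<open>?E\<close>; any other end is \<open>c\<close> or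
        \<open>d\<close> itself.\<close>
      then have "h a = 0" "h b = 0"
        using C cd by (auto simp: less_le)
      moreover have "(?k has_integral h b - h a) {a..b}"
        using C by (intro *) auto
      ultimately have "(?k has_integral 0) {a<..<b}"
        by (simp add: has_integral_Icc_iff_Ioo)
      then show "(LINT x:C|lebesgue. ?k x) = 0"
        using C(2) set_lebesgue_integral_eq_integral(2)[OF k'] by (simp add: integral_unique)
    qed
    then have "integral ?U ?k = 0"
      using set_lebesgue_integral_eq_integral(2)[OF k', of ?U] oE by simp
    moreover have "?k integrable_on ?U"
      using k'[of ?U] oE by (simp add: absolutely_integrable_on_def)
    ultimately have "(?k has_integral 0) ?U"
      using has_integral_integral by metis
    then have "(?k has_integral 0) {c<..<d}"
      by (smt (verit, ccfv_SIG) has_integral_eq has_integral_restrict_Int mem_Collect_eq)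
    then show ?thesis by (simp add: has_integral_Icc_iff_Ioo)
  qed
  show ?thesis
  proof (cases "{a..b} \<subseteq> ?E")
    case True
    moreover have "{a<..<b} \<subseteq> {a..b}" by auto
    ultimately show ?thesis by (intro * ab) blast
  next
    case False
    let ?Z = "{a..b} \<inter> {x. h x = 0}"
    have Z: "compact ?Z"
      by (intro compact_Int_closed closed_Collect_eq ch continuous_on_const) auto
    have ne: "?Z \<noteq> {}" using False by auto
    obtain s where s: "s \<in> ?Z" "\<And>x. x \<in> ?Z \<Longrightarrow> s \<le> x"
      using compact_attains_inf[OF Z ne] by blast
    obtain t where t: "t \<in> ?Z" "\<And>x. x \<in> ?Z \<Longrightarrow> x \<le> t"
      using compact_attains_sup[OF Z ne] by blast
    have "h x \<noteq> 0" if "a < x" "x < s" for x using s(1) s(2)[of x] that by auto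
    then have "(?k has_integral h s - h a) {a..s}"
      using s(1) by (intro *) auto
    moreover have "(?k has_integral 0) {s..t}"
      using s t by (intro **) auto
    ultimately have "(?k has_integral h s - h a + 0) {a..t}"
      using s t by (intro has_integral_combine[where c=s and a=a and b=t]) auto
    moreover have "h x \<noteq> 0" if "t < x" "x < b" for x using t(1) t(2)[of x] that by auto
    then have "(?k has_integral h b - h t) {t..b}"
      using t(1) by (intro *) auto
    ultimately have "(?k has_integral (h s - h a + 0) + (h b - h t)) {a..b}"
      using t by (intro has_integral_combine[where c=t]) auto
    then show ?thesis using s t by simp
  qed
qed

text \<open>Absolute continuity of \<open>h\<close> is read off from its nonzero set, however
  complicated the zero set may be. The two uses are \<open>\<bar>w\<bar> - w\<close> and
  \<open>u - f\<close>.\<close>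

lemma primitive_glue:
  fixes h q :: "real \<Rightarrow> real"
  assumes cont: "\<And>x. isCont h x" and q: "q absolutely_integrable_on {x. h x \<noteq> 0}"
    and h: "\<And>a b. a \<le> b \<Longrightarrow> {a..b} \<subseteq> {x. h x \<noteq> 0} \<Longrightarrow> (q has_integral h b - h a) {a..b}"
  shows "primitive h (\<lambda>x. if h x \<noteq> 0 then q x else 0)"
  unfolding primitive_def integrable_lebesgue_abs_int
  using has_integral_glue[OF assms] absolutely_integrable_restrict_UNIV[of "{x. h x \<noteq> 0}" q] q by simp

section \<open>Absolute values and maxima\<close>

lemma primitive_measurable [measurable_dest]:
  assumes "primitive f g"
  shows "f \<in> borel_measurable lebesgue"
  using borel_measurable_continuous_onI[OF primitive_continuous_on[OF assms]]
  by (simp add: measurable_completion)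

text \<open>The gluing applies to \<open>\<bar>w\<bar> - w\<close>, which is \<open>- 2 * w\<close>
  where \<open>w\<close> is negative and 0 elsewhere.\<close>

lemma primitive_abs:
  assumes w: "primitive w g"
  shows "primitive (\<lambda>x. \<bar>w x\<bar>) (\<lambda>x. if w x < 0 then - g x else g x)"
proof -
  let ?h = "\<lambda>x. \<bar>w x\<bar> - w x"
  have E: "{x. ?h x \<noteq> 0} = {x. w x < 0}" by auto
  have "open {x. w x < 0}"
    by (intro open_Collect_less primitive_continuous_on[OF w] continuous_on_const)
  then have g: "g absolutely_integrable_on {x. w x < 0}"
    using set_integrable_subset[of lebesgue UNIV g "{x. w x < 0}"] primitive_integrable[OF w]
    by (auto simp: integrable_lebesgue_abs_int)
  have "primitive ?h (\<lambda>x. if ?h x \<noteq> 0 then - 2 * g x else 0)"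
  proof (rule primitive_glue)
    show "isCont ?h x" for x
      using primitive_isCont[OF w] by (intro continuous_intros) auto
    show "(\<lambda>x. - 2 * g x) absolutely_integrable_on {x. ?h x \<noteq> 0}"
      unfolding E using g by (intro set_integrable_mult_right) auto
    fix a b :: real assume ab: "a \<le> b" "{a..b} \<subseteq> {x. ?h x \<noteq> 0}"
    have "((\<lambda>x. - 2 * g x) has_integral - 2 * (w b - w a)) {a..b}"
      by (intro has_integral_mult_right primitive_has_integral[OF w ab(1)])
    moreover have "w a < 0" "w b < 0" using ab by (auto simp: E)
    ultimately show "((\<lambda>x. - 2 * g x) has_integral ?h b - ?h a) {a..b}"
      by (simp add: algebra_simps)
  qed
  from primitive_add[OF this w]
  have "primitive (\<lambda>x. ?h x + w x) (\<lambda>x. (if ?h x \<noteq> 0 then - 2 * g x else 0) + g x)" .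
  moreover have "(\<lambda>x. (if ?h x \<noteq> 0 then - 2 * g x else 0) + g x) = (\<lambda>x. if w x < 0 then - g x else g x)"
    by (auto simp: fun_eq_iff)
  ultimately show ?thesis by simp
qed

text \<open>The functions \<open>\<bar>w\<bar>\<close> and \<open>\<bar>- w\<bar>\<close> coincide,
  but \<open>primitive_abs\<close> gives them the derivatives \<open>g\<close> and
  \<open>- g\<close> on the zero set of \<open>w\<close>; uniqueness makes these equal almost
  everywhere.\<close>

lemma primitive_AE_0_on_zeros:
  assumes w: "primitive w g"
  shows "AE x in lebesgue. w x = 0 \<longrightarrow> g x = 0"
proof -
  have "primitive (\<lambda>x. - w x) (\<lambda>x. - g x)"
    using primitive_cmult[OF w, of "-1"] by simp
  from primitive_abs[OF this]
  have "primitive (\<lambda>x. \<bar>w x\<bar>) (\<lambda>x. if w x > 0 then g x else - g x)"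
    by (simp only: abs_minus_cancel minus_minus neg_less_0_iff_less)
  from primitive_AE_unique[OF primitive_abs[OF w] this] show ?thesis
    by eventually_elim (auto split: if_splits)
qed

lemma L1_limit_squeeze:
  fixes d :: "nat \<Rightarrow> 'a \<Rightarrow> real"
  assumes "\<And>j. integrable M (d j)" "\<And>j. integrable M (a j)" "\<And>j. integrable M (b j)"
    and le: "\<And>j. AE x in M. \<bar>d j x\<bar> \<le> a j x + b j x"
    and lim: "(\<lambda>j. LINT x|M. a j x) \<longlonglongrightarrow> 0" "(\<lambda>j. LINT x|M. b j x) \<longlonglongrightarrow> 0"
  shows "(\<lambda>j. LINT x|M. \<bar>d j x\<bar>) \<longlonglongrightarrow> 0"
proof (rule tendsto_sandwich[OF _ _ tendsto_const tendsto_add_zero[OF lim]])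
  have "(LINT x|M. \<bar>d j x\<bar>) \<le> (LINT x|M. a j x + b j x)" for j
    using assms by (intro integral_mono_AE) auto
  then show "\<forall>\<^sub>F j in sequentially. (LINT x|M. \<bar>d j x\<bar>) \<le> (LINT x|M. a j x) + (LINT x|M. b j x)"
    using assms by (intro always_eventually) simp
qed auto

text \<open>Where \<open>W j\<close> and \<open>w\<close> agree in sign, the error is
  \<open>\<bar>K j x - g x\<bar>\<close>. A disagreement costs at most
  \<open>2 * \<bar>g x\<bar>\<close> more; at a point with \<open>w x\<close> nonzero it ends for
  large \<open>j\<close>, and on the zero set of \<open>w\<close> the function \<open>g\<close>
  vanishes almost everywhere. Dominated convergence removes this second error.\<close>

lemma abs_L1_limit:
  assumes w: "primitive w g" and W: "\<And>j. primitive (W j) (K j)"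
    and lim: "\<And>x. (\<lambda>j. W j x) \<longlonglongrightarrow> w x"
    and L1: "(\<lambda>j. LINT x|lebesgue. \<bar>K j x - g x\<bar>) \<longlonglongrightarrow> 0"
  shows "(\<lambda>j. LINT x|lebesgue. \<bar>(if W j x < 0 then - K j x else K j x) - (if w x < 0 then - g x else g x)\<bar>) \<longlonglongrightarrow> 0"
proof -
  note [measurable] = primitive_measurable[OF w] primitive_measurable[OF W]
    borel_measurable_integrable[OF primitive_integrable[OF w]]
    borel_measurable_integrable[OF primitive_integrable[OF W]]
  note int = primitive_integrable[OF w] primitive_integrable[OF W]
  let ?d = "\<lambda>j x. if (W j x < 0) = (w x < 0) \<or> w x = 0 then 0 else 2 * \<bar>g x\<bar>"
  have dint: "integrable lebesgue (?d j)" for j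
    by (rule Bochner_Integration.integrable_bound[where f = "\<lambda>x. 2 * g x"]) (use int in auto)
  have d0: "(\<lambda>j. LINT x|lebesgue. ?d j x) \<longlonglongrightarrow> (LINT (x::real)|lebesgue. 0)"
  proof (rule integral_dominated_convergence[where w = "\<lambda>x. 2 * \<bar>g x\<bar>"])
    show "AE x in lebesgue. (\<lambda>j. ?d j x) \<longlonglongrightarrow> 0"
    proof (rule AE_I2)
      fix x
      have "\<forall>\<^sub>F j in sequentially. (W j x < 0) = (w x < 0) \<or> w x = 0"
      proof (cases "w x" "0::real" rule: linorder_cases)
        case less
        then show ?thesis using order_tendstoD(2)[OF lim[of x], of 0] by (auto elim: eventually_mono)
      next
        case greater
        then show ?thesis using order_tendstoD(1)[OF lim[of x], of 0] by (auto elim: eventually_mono)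
      qed auto
      then have "\<forall>\<^sub>F j in sequentially. ?d j x = 0"
        by (rule eventually_mono) auto
      then show "(\<lambda>j. ?d j x) \<longlonglongrightarrow> 0" by (rule tendsto_eventually)
    qed
  qed (use int in auto)
  show ?thesis
  proof (rule L1_limit_squeeze[where b = ?d])
    show "integrable lebesgue (\<lambda>x. (if W j x < 0 then - K j x else K j x) - (if w x < 0 then - g x else g x))" for j
      by (rule primitive_integrable[OF primitive_diff[OF primitive_abs[OF W] primitive_abs[OF w]]])
    show "AE x in lebesgue. \<bar>(if W j x < 0 then - K j x else K j x) - (if w x < 0 then - g x else g x)\<bar> \<le> \<bar>K j x - g x\<bar> + ?d j x" for j
      using primitive_AE_0_on_zeros[OF w] by eventually_elim auto
  qed (use int dint d0 L1 in auto)
qed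

lemma primitive_max:
  assumes "primitive u p" "primitive v q"
  shows "primitive (\<lambda>x. max (u x) (v x))
    (\<lambda>x. (p x + q x + (if u x - v x < 0 then - (p x - q x) else p x - q x)) / 2)"
proof -
  have "primitive (\<lambda>x. (1/2) * ((u x + v x) + \<bar>u x - v x\<bar>))
    (\<lambda>x. (1/2) * ((p x + q x) + (if u x - v x < 0 then - (p x - q x) else p x - q x)))"
    by (intro primitive_cmult primitive_add assms primitive_abs primitive_diff)
  moreover have "(\<lambda>x. (1/2) * ((u x + v x) + \<bar>u x - v x\<bar>)) = (\<lambda>x. max (u x) (v x))"
    by (auto simp: fun_eq_iff max_def)
  ultimately show ?thesis by simp
qed

lemma max_L1_limit:
  assumes u: "primitive u p" "\<And>j. primitive (U j) (P j)" "\<And>x. (\<lambda>j. U j x) \<longlonglongrightarrow> u x"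
    and v: "primitive v q" "\<And>j. primitive (V j) (Q j)" "\<And>x. (\<lambda>j. V j x) \<longlonglongrightarrow> v x"
    and L1: "(\<lambda>j. LINT x|lebesgue. \<bar>P j x - p x\<bar>) \<longlonglongrightarrow> 0" "(\<lambda>j. LINT x|lebesgue. \<bar>Q j x - q x\<bar>) \<longlonglongrightarrow> 0"
  shows "(\<lambda>j. LINT x|lebesgue. \<bar>(P j x + Q j x + (if U j x - V j x < 0 then - (P j x - Q j x) else P j x - Q j x)) / 2
     - (p x + q x + (if u x - v x < 0 then - (p x - q x) else p x - q x)) / 2\<bar>) \<longlonglongrightarrow> 0"
proof -
  note int = primitive_integrable[OF u(1)] primitive_integrable[OF u(2)]
     primitive_integrable[OF v(1)] primitive_integrable[OF v(2)]
  have s: "(\<lambda>j. LINT x|lebesgue. \<bar>P j x - p x\<bar> + \<bar>Q j x - q x\<bar>) \<longlonglongrightarrow> 0"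
    using tendsto_add_zero[OF L1] int by simp
  have d: "(\<lambda>j. LINT x|lebesgue. \<bar>(P j x - Q j x) - (p x - q x)\<bar>) \<longlonglongrightarrow> 0"
    by (rule L1_limit_squeeze[OF _ _ _ _ L1]) (use int in auto)
  have a: "(\<lambda>j. LINT x|lebesgue. \<bar>(if U j x - V j x < 0 then - (P j x - Q j x) else P j x - Q j x) - (if u x - v x < 0 then - (p x - q x) else p x - q x)\<bar>) \<longlonglongrightarrow> 0"
    by (intro abs_L1_limit primitive_diff u v tendsto_diff d)
  have ia: "integrable lebesgue (\<lambda>x. (if U j x - V j x < 0 then - (P j x - Q j x) else P j x - Q j x) - (if u x - v x < 0 then - (p x - q x) else p x - q x))" for j
    by (rule primitive_integrable[OF primitive_diff[OF primitive_abs[OF primitive_diff[OF u(2) v(2)]] primitive_abs[OF primitive_diff[OF u(1) v(1)]]]])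
  show ?thesis
  proof (rule L1_limit_squeeze[OF _ _ _ _ s a])
    show "integrable lebesgue (\<lambda>x. (P j x + Q j x + (if U j x - V j x < 0 then - (P j x - Q j x) else P j x - Q j x)) / 2
     - (p x + q x + (if u x - v x < 0 then - (p x - q x) else p x - q x)) / 2)" for j
      by (rule primitive_integrable[OF primitive_diff[OF primitive_max[OF u(2) v(2)] primitive_max[OF u(1) v(1)]]])
    show "AE x in lebesgue. \<bar>(P j x + Q j x + (if U j x - V j x < 0 then - (P j x - Q j x) else P j x - Q j x)) / 2
     - (p x + q x + (if u x - v x < 0 then - (p x - q x) else p x - q x)) / 2\<bar> \<le>
      \<bar>P j x - p x\<bar> + \<bar>Q j x - q x\<bar> + \<bar>(if U j x - V j x < 0 then - (P j x - Q j x) else P j x - Q j x) - (if u x - v x < 0 then - (p x - q x) else p x - q x)\<bar>" for j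
      by (intro AE_I2) argo
  qed (use int ia in auto)
qed

section \<open>Uniform bounds and decay at infinity\<close>

lemma integral_Icc_le_set_integral:
  fixes g :: "real \<Rightarrow> real"
  assumes "integrable lebesgue g" "{a..b} \<subseteq> S" "S \<in> sets lebesgue"
  shows "\<bar>integral {a..b} g\<bar> \<le> (LINT x:S|lebesgue. \<bar>g x\<bar>)"
proof -
  have S: "set_integrable lebesgue S g"
    using set_integrable_subset[of lebesgue UNIV g S] assms by (auto simp: set_integrable_def)
  have ab: "set_integrable lebesgue {a..b} g"
    using integrable_lebesgue_Icc[OF assms(1)] by simp
  have "\<bar>integral {a..b} g\<bar> = \<bar>LINT x:{a..b}|lebesgue. g x\<bar>"
    using set_lebesgue_integral_eq_integral(2)[OF ab] by simp
  also have "\<dots> \<le> (LINT x:{a..b}|lebesgue. \<bar>g x\<bar>)"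
    using set_integral_norm_bound[OF ab] by simp
  also have "\<dots> \<le> (LINT x:S|lebesgue. \<bar>g x\<bar>)"
    unfolding set_lebesgue_integral_def
    using S[THEN set_integrable_abs] ab[THEN set_integrable_abs] assms(2)
    by (intro integral_mono) (auto simp: set_integrable_def indicator_def)
  finally show ?thesis .
qed

text \<open>If \<open>\<bar>f x\<bar>\<close> exceeded the variation of \<open>f\<close> to the
  right of \<open>x\<close> by \<delta>, then \<open>\<bar>f\<bar>\<close> would stay above \<delta>
  on the whole half-line and could not be integrable. Both the uniform bound by the
  \<open>L1\<close> norm of \<open>g\<close> and the decay at infinity follow.\<close>

lemma primitive_le_tail:
  assumes f: "primitive f g" and int: "integrable lebesgue f"
  shows "\<bar>f x\<bar> \<le> (LINT y:{x..}|lebesgue. \<bar>g y\<bar>)"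
proof (rule ccontr)
  define \<delta> where "\<delta> = \<bar>f x\<bar> - (LINT y:{x..}|lebesgue. \<bar>g y\<bar>)"
  assume "\<not> ?thesis"
  then have \<delta>: "\<delta> > 0" by (simp add: \<delta>_def)
  have fy: "\<delta> \<le> \<bar>f y\<bar>" if "x \<le> y" for y
  proof -
    have "\<bar>f y - f x\<bar> \<le> (LINT y:{x..}|lebesgue. \<bar>g y\<bar>)"
      using integral_Icc_le_set_integral[OF primitive_integrable[OF f], of x y "{x..}"]
        integral_unique[OF primitive_has_integral[OF f that]] by simp
    then show ?thesis by (simp add: \<delta>_def)
  qed
  have "real n * \<delta> \<le> (LINT y|lebesgue. \<bar>f y\<bar>)" for n
  proof -
    have "real n * \<delta> = (LINT y|lebesgue. indicator {x..x + real n} y * \<delta>)"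
      by simp
    also have "\<dots> \<le> (LINT y|lebesgue. \<bar>f y\<bar>)"
    proof (rule integral_mono)
      show "integrable lebesgue (\<lambda>y. indicator {x..x + real n} y * \<delta>)"
        by (intro integrable_mult_left integrable_real_indicator) auto
      show "integrable lebesgue (\<lambda>y. \<bar>f y\<bar>)" using int by simp
      show "indicator {x..x + real n} y * \<delta> \<le> \<bar>f y\<bar>" for y
        using fy[of y] \<delta> by (auto simp: indicator_def)
    qed
    finally show ?thesis .
  qed
  moreover obtain n where "(LINT y|lebesgue. \<bar>f y\<bar>) < real n * \<delta>"
    using reals_Archimedean3[OF \<delta>] by blast
  ultimately show False by (meson not_less)
qed

lemma primitive_le_L1:
  assumes f: "primitive f g" and int: "integrable lebesgue f"
  shows "\<bar>f x\<bar> \<le> (LINT y|lebesgue. \<bar>g y\<bar>)"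
proof -
  have "(LINT y:{x..}|lebesgue. \<bar>g y\<bar>) \<le> (LINT y|lebesgue. \<bar>g y\<bar>)"
    unfolding set_lebesgue_integral_def using primitive_integrable[OF f]
    by (intro integral_mono integrable_mult_indicator) (auto simp: indicator_def)
  then show ?thesis using primitive_le_tail[OF assms, of x] by linarith
qed

lemma primitive_tendsto_0_at_top:
  assumes f: "primitive f g" and int: "integrable lebesgue f"
  shows "(f \<longlongrightarrow> 0) at_top"
proof -
  have g: "integrable lebesgue (\<lambda>x. \<bar>g x\<bar>)" using primitive_integrable[OF f] by simp
  have "(\<lambda>n. LINT y|lebesgue. indicator {real n..} y *\<^sub>R \<bar>g y\<bar>) \<longlonglongrightarrow> (LINT (y::real)|lebesgue. 0)"
  proof (rule integral_dominated_convergence[where w = "\<lambda>x. \<bar>g x\<bar>"])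
    show "AE x in lebesgue. (\<lambda>n. indicator {real n..} x *\<^sub>R \<bar>g x\<bar>) \<longlonglongrightarrow> 0"
    proof (rule AE_I2)
      fix x
      have "\<forall>\<^sub>F n in sequentially. indicator {real n..} x *\<^sub>R \<bar>g x\<bar> = 0"
        using eventually_gt_at_top[of "nat \<lceil>x\<rceil>"] by eventually_elim (auto simp: indicator_def; linarith)
      then show "(\<lambda>n. indicator {real n..} x *\<^sub>R \<bar>g x\<bar>) \<longlonglongrightarrow> 0" by (rule tendsto_eventually)
    qed
    show "(\<lambda>y. indicator {real n..} y *\<^sub>R \<bar>g y\<bar>) \<in> borel_measurable lebesgue" for n
      using g by (intro borel_measurable_scaleR borel_measurable_indicator borel_measurable_integrable) auto
  qed (use g in \<open>auto simp: indicator_def\<close>)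
  then have lim: "(\<lambda>n. LINT y:{real n..}|lebesgue. \<bar>g y\<bar>) \<longlonglongrightarrow> 0"
    by (simp add: set_lebesgue_integral_def)
  show ?thesis
  proof (rule tendstoI)
    fix e :: real assume "e > 0"
    then obtain n where n: "(LINT y:{real n..}|lebesgue. \<bar>g y\<bar>) < e"
      using order_tendstoD(2)[OF lim] by (meson eventually_sequentially order_refl)
    have "\<bar>f x\<bar> < e" if "x \<ge> real n" for x
    proof -
      have "(LINT y:{x..}|lebesgue. \<bar>g y\<bar>) \<le> (LINT y:{real n..}|lebesgue. \<bar>g y\<bar>)"
        unfolding set_lebesgue_integral_def using that g
        by (intro integral_mono integrable_mult_indicator) (auto simp: indicator_def)
      then show ?thesis using primitive_le_tail[OF assms, of x] n by linarith
    qed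
    then show "\<forall>\<^sub>F x in at_top. dist (f x) 0 < e"
      by (auto simp: eventually_at_top_linorder)
  qed
qed

lemma integrable_lebesgue_reflect:
  fixes f :: "real \<Rightarrow> real"
  assumes "integrable lebesgue f"
  shows "integrable lebesgue (\<lambda>x. f (- x))"
  using lebesgue_integrable_real_affine[of f "-1" 0] assms by simp

lemma primitive_tendsto_0_at_bot:
  assumes f: "primitive f g" and int: "integrable lebesgue f"
  shows "(f \<longlongrightarrow> 0) at_bot"
  using primitive_tendsto_0_at_top[OF primitive_reflect[OF f] integrable_lebesgue_reflect[OF int]]
  by (simp add: filterlim_at_bot_mirror)

subsection \<open>The right maximal function\<close>

definition right_average :: "(real \<Rightarrow> real) \<Rightarrow> real \<Rightarrow> real \<Rightarrow> real" where
  "right_average f x t = integral {x..t} f / (t - x)"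

text \<open>A supremum of reals without absolute values: it is used for nonnegative \<open>f\<close>
  whose averages are bounded, see \<open>average_bdd\<close>.\<close>

definition right_maximal :: "(real \<Rightarrow> real) \<Rightarrow> real \<Rightarrow> real" where
  "right_maximal f x = (SUP t\<in>{x<..}. right_average f x t)"

locale nonneg_sobolev =
  fixes f g :: "real \<Rightarrow> real"
  assumes prim: "primitive f g" and int: "integrable lebesgue f" and nonneg: "\<And>x. 0 \<le> f x"
begin

abbreviation u where "u \<equiv> right_maximal f"
abbreviation E where "E \<equiv> {x. f x < u x}"

text \<open>With an antiderivative on the whole line, averages of \<open>f\<close> become slopes of
  chords of \<open>G\<close>. The line through \<open>(x, G x)\<close> with slope \<open>u x\<close>
  lies above the graph of \<open>G\<close> to the right of \<open>x\<close>, and optimal endpoints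
  are the points where it touches the graph again.\<close>

definition G :: "real \<Rightarrow> real" where
  "G = (SOME G. \<forall>x. (G has_real_derivative f x) (at x))"

lemma f_isCont [simp]: "isCont f x" by (rule primitive_isCont[OF prim])
lemma f_cont [simp]: "continuous_on S f" by (rule primitive_continuous_on[OF prim])

lemma G_deriv: "(G has_real_derivative f x) (at x)"
proof -
  have "\<exists>F. \<forall>x::real. (-\<infinity>::ereal) < x \<longrightarrow> x < (\<infinity>::ereal) \<longrightarrow> (F has_vector_derivative f x) (at x)"
    by (intro einterval_antiderivative) auto
  then have "\<exists>F. \<forall>x. (F has_real_derivative f x) (at x)"
    by (simp add: has_real_derivative_iff_has_vector_derivative)
  from someI_ex[OF this] show ?thesis unfolding G_def by blast
qed

lemma G_cont [simp]: "continuous_on S G"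
  using G_deriv DERIV_continuous_on has_field_derivative_at_within by blast

lemma G_integral:
  assumes "x \<le> t"
  shows "(f has_integral G t - G x) {x..t}"
  using assms G_deriv
  by (intro fundamental_theorem_of_calculus)
     (auto simp: has_real_derivative_iff_has_vector_derivative intro: has_vector_derivative_at_within)

lemma average_eq: "x \<le> t \<Longrightarrow> right_average f x t = (G t - G x) / (t - x)"
  using integral_unique[OF G_integral] by (simp add: right_average_def)

lemma average_mvt:
  assumes "x < t"
  obtains z where "x < z" "z < t" "right_average f x t = f z"
proof -
  obtain z where "x < z" "z < t" "G t - G x = (t - x) * f z"
    using MVT2[OF assms, of G f] G_deriv by blast
  then show ?thesis using that[of z] assms by (simp add: average_eq)
qed

lemma G_mono: "x \<le> t \<Longrightarrow> G x \<le> G t"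
  using has_integral_nonneg[OF G_integral] nonneg by fastforce

lemma G_diff_le: "x \<le> t \<Longrightarrow> G t - G x \<le> (LINT y|lebesgue. f y)"
proof -
  assume "x \<le> t"
  then have "G t - G x = integral {x..t} f" using integral_unique[OF G_integral] by simp
  also have "\<dots> \<le> (LINT y|lebesgue. f y)"
    using integral_Icc_le_set_integral[OF int, of x t UNIV] nonneg
    by (simp add: set_lebesgue_integral_def)
  finally show ?thesis .
qed

lemma f_le: "f x \<le> (LINT y|lebesgue. \<bar>g y\<bar>)"
  using primitive_le_L1[OF prim int, of x] by linarith

lemma average_bdd: "bdd_above (right_average f x ` {x<..})"
proof (rule bdd_aboveI2)
  fix t assume "t \<in> {x<..}"
  then show "right_average f x t \<le> (LINT y|lebesgue. \<bar>g y\<bar>)"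
    using average_mvt[of x t] f_le by (metis greaterThan_iff)
qed

lemma average_le_u: "x < t \<Longrightarrow> right_average f x t \<le> u x"
  unfolding right_maximal_def using average_bdd by (intro cSUP_upper) auto

lemma u_least: "(\<And>t. x < t \<Longrightarrow> right_average f x t \<le> c) \<Longrightarrow> u x \<le> c"
  unfolding right_maximal_def by (intro cSUP_least) auto

lemma average_tendsto: "(right_average f x \<longlongrightarrow> f x) (at_right x)"
proof -
  have "((\<lambda>t. (G t - G x) / (t - x)) \<longlongrightarrow> f x) (at_right x)"
    using G_deriv[of x] by (auto simp: has_field_derivative_iff intro: filterlim_at_split[THEN iffD1, THEN conjunct2])
  moreover have "\<forall>\<^sub>F t in at_right x. (G t - G x) / (t - x) = right_average f x t"
    using eventually_at_right_less[of x] by eventually_elim (simp add: average_eq)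
  ultimately show ?thesis by (rule Lim_transform_eventually)
qed

lemma f_le_u: "f x \<le> u x"
proof (rule tendsto_upperbound[OF average_tendsto])
  show "\<forall>\<^sub>F t in at_right x. right_average f x t \<le> u x"
    using eventually_at_right_less[of x] by eventually_elim (rule average_le_u)
qed simp

lemma u_nonneg: "0 \<le> u x" using f_le_u nonneg order_trans by blast

lemma u_le: "u x \<le> (LINT y|lebesgue. \<bar>g y\<bar>)"
  using average_mvt f_le by (intro u_least) metis

lemma f_tendsto_0: "(f \<longlongrightarrow> 0) at_top" "(f \<longlongrightarrow> 0) at_bot"
  using primitive_tendsto_0_at_top[OF prim int] primitive_tendsto_0_at_bot[OF prim int] .

lemma f_uniformly_continuous: "uniformly_continuous_on UNIV f"
  unfolding uniformly_continuous_on_def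
proof (intro allI impI)
  fix e :: real assume e: "e > 0"
  obtain R1 where R1: "\<And>x. x \<ge> R1 \<Longrightarrow> \<bar>f x\<bar> < e / 2"
    using tendstoD[OF f_tendsto_0(1), of "e/2"] e by (auto simp: eventually_at_top_linorder)
  obtain R2 where R2: "\<And>x. x \<le> R2 \<Longrightarrow> \<bar>f x\<bar> < e / 2"
    using tendstoD[OF f_tendsto_0(2), of "e/2"] e by (auto simp: eventually_at_bot_linorder)
  have "uniformly_continuous_on {R2-1..R1+1} f"
    by (intro compact_uniformly_continuous) auto
  then obtain d where d: "d > 0" "\<And>x x'. x \<in> {R2-1..R1+1} \<Longrightarrow> x' \<in> {R2-1..R1+1} \<Longrightarrow> dist x' x < d \<Longrightarrow> dist (f x') (f x) < e"
    using e unfolding uniformly_continuous_on_def by blast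
  have "dist (f x') (f x) < e" if "dist x' x < min d 1" for x x'
  proof (cases "x \<in> {R2-1..R1+1} \<and> x' \<in> {R2-1..R1+1}")
    case False
    then have "(x \<ge> R1 \<and> x' \<ge> R1) \<or> (x \<le> R2 \<and> x' \<le> R2)"
      using that by (auto simp: dist_real_def)
    then have "\<bar>f x\<bar> < e / 2" "\<bar>f x'\<bar> < e / 2" using R1 R2 by auto
    then show ?thesis by (simp add: dist_real_def)
  qed (use d that in auto)
  then show "\<exists>d>0. \<forall>x\<in>UNIV. \<forall>x'\<in>UNIV. dist x' x < d \<longrightarrow> dist (f x') (f x) < e"
    using d(1) by (intro exI[of _ "min d 1"]) auto
qed

text \<open>Averages of equal length from \<open>x\<close> and from \<open>y\<close> differ by a
  value of \<open>f (z + (x - y)) - f z\<close>, by the mean value theorem for \<open>h\<close>. So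
  \<open>u\<close> inherits the modulus of continuity of \<open>f\<close>.\<close>

lemma u_le_shift:
  assumes "\<And>z. \<bar>f (z + (x - y)) - f z\<bar> \<le> e"
  shows "u x \<le> u y + e"
proof (rule u_least)
  fix t assume t: "x < t"
  define h where "h s = G (y + s + (x - y)) - G (y + s)" for s
  have "\<exists>z. z > 0 \<and> z < t - x \<and> h (t - x) - h 0 = (t - x - 0) * (f (y + z + (x - y)) - f (y + z))"
    unfolding h_def using t
    by (intro MVT2) (auto intro!: derivative_eq_intros DERIV_chain2[OF G_deriv])
  then obtain z where z: "h (t - x) - h 0 = (t - x) * (f (y + z + (x - y)) - f (y + z))" by auto
  have "h (t - x) - h 0 \<le> (t - x) * e"
    unfolding z using assms[of "y + z"] t by (intro mult_left_mono) auto
  moreover have "h (t - x) - h 0 = (G t - G x) - (G (y + (t - x)) - G y)"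
    by (simp add: h_def)
  ultimately have "(G t - G x) / (t - x) \<le> (G (y + (t - x)) - G y) / (t - x) + e"
    using t
    by (smt (verit) add.commute diff_diff_eq2 diff_divide_distrib
      diff_gt_0_iff_gt group_cancel.sub1 le_diff_eq mult.commute pos_divide_le_eq)
  also have "(G (y + (t - x)) - G y) / (t - x) \<le> u y"
    using average_le_u[of y "y + (t - x)"] t by (simp add: average_eq)
  finally show "right_average f x t \<le> u y + e" using t by (simp add: average_eq)
qed

lemma u_isCont [simp]: "isCont u x"
  unfolding continuous_at_eps_delta
proof (intro allI impI)
  fix e :: real assume e: "e > 0"
  then obtain d where d: "d > 0" "\<And>a b. dist a b < d \<Longrightarrow> dist (f a) (f b) < e / 2"
    using f_uniformly_continuous unfolding uniformly_continuous_on_def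
    by (metis UNIV_I half_gt_zero)
  have *: "u a \<le> u b + e / 2" if "dist a b < d" for a b
  proof (rule u_le_shift)
    show "\<bar>f (z + (a - b)) - f z\<bar> \<le> e / 2" for z
      using d(2)[of "z + (a - b)" z] that by (auto simp: dist_real_def)
  qed
  have "dist (u x') (u x) < e" if "dist x' x < d" for x'
    using *[of x' x] *[of x x'] that e by (auto simp: dist_commute dist_real_def)
  then show "\<exists>d>0. \<forall>x'. dist x' x < d \<longrightarrow> dist (u x') (u x) < e"
    using d(1) by blast
qed

lemma u_cont [simp]: "continuous_on S u"
  by (simp add: continuous_at_imp_continuous_on)

lemma open_E: "open E" by (intro open_Collect_less) auto

lemma u_tendsto_0_at_top: "(u \<longlongrightarrow> 0) at_top"
proof (rule tendstoI)
  fix e :: real assume e: "e > 0"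
  then obtain R where R: "\<And>x. x \<ge> R \<Longrightarrow> \<bar>f x\<bar> < e / 2"
    using tendstoD[OF f_tendsto_0(1), of "e/2"] by (auto simp: eventually_at_top_linorder)
  have "u x \<le> e / 2" if "x \<ge> R" for x
  proof (rule u_least)
    fix t assume "x < t"
    then obtain z where "x < z" "right_average f x t = f z" by (rule average_mvt)
    then show "right_average f x t \<le> e / 2" using R[of z] that by auto
  qed
  then have "\<forall>x\<ge>R. dist (u x) 0 < e" using e u_nonneg by (force simp: dist_real_def)
  then show "\<forall>\<^sub>F x in at_top. dist (u x) 0 < e"
    by (auto simp: eventually_at_top_linorder)
qed

lemma average_le_far: "x < t \<Longrightarrow> right_average f x t \<le> (LINT y|lebesgue. f y) / (t - x)"
  using G_diff_le[of x t] by (auto simp: average_eq divide_right_mono)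

text \<open>The total integral of \<open>f\<close> divided by the length bounds the average wherever
  the interval lies, so one \<open>R\<close> serves all left ends. This confines the search for
  optimal endpoints to bounded intervals.\<close>

lemma average_tendsto_0: 
  assumes "e > 0" obtains R where "R > 0" "\<And>x t. t - x \<ge> R \<Longrightarrow> right_average f x t < e"
proof -
  define S where "S = (LINT y|lebesgue. f y)"
  have S: "S \<ge> 0" using nonneg unfolding S_def by simp
  have "right_average f x t < e" if "t - x \<ge> S / e + 1" for x t
  proof -
    have "0 \<le> S / e" using S assms by simp
    then have t: "t - x > 0" "S / e < t - x" using that by linarith+
    have "right_average f x t \<le> S / (t - x)" unfolding S_def using t(1) by (intro average_le_far) auto
    also have "\<dots> < e" using t assms by (simp add: field_simps)
    finally show ?thesis .
  qed
  moreover have "S / e + 1 > 0" using S assms by (simp add: add_nonneg_pos)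
  ultimately show ?thesis using that by blast
qed

lemma u_tendsto_0_at_bot: "(u \<longlongrightarrow> 0) at_bot"
proof (rule tendstoI)
  fix e :: real assume e: "e > 0"
  then obtain L where L: "\<And>x. x \<le> L \<Longrightarrow> \<bar>f x\<bar> < e / 2"
    using tendstoD[OF f_tendsto_0(2), of "e/2"] by (auto simp: eventually_at_bot_linorder)
  obtain R where R: "R > 0" "\<And>x t. t - x \<ge> R \<Longrightarrow> right_average f x t < e / 2"
    using average_tendsto_0[of "e/2"] e by auto
  \<comment> \<open>An interval shorter than \<open>R\<close> that starts to the left of
    \<open>L - R\<close> ends before \<open>L\<close>, where \<open>f\<close> is small; a longer one
    has a small average by the choice of \<open>R\<close>.\<close>
  have "u x \<le> e / 2" if "x \<le> L - R" for x
  proof (rule u_least)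
    fix t assume t: "x < t"
    show "right_average f x t \<le> e / 2"
    proof (cases "t - x \<ge> R")
      case True
      then show ?thesis using R(2) order_le_less by blast
    next
      case False
      obtain z where "z < t" "right_average f x t = f z" using average_mvt[OF t] by blast
      then show ?thesis using L[of z] that False by auto
    qed
  qed
  then have "\<forall>x\<le>L-R. dist (u x) 0 < e" using e u_nonneg by (force simp: dist_real_def)
  then show "\<forall>\<^sub>F x in at_bot. dist (u x) 0 < e"
    by (auto simp: eventually_at_bot_linorder)
qed

end

section \<open>Integrability on an open set from increments on its components\<close>

lemma nn_integral_component_le:
  fixes p :: "real \<Rightarrow> real"
  assumes C: "open C" "connected C" "C \<noteq> {}" and p: "\<And>x. x \<in> C \<Longrightarrow> 0 \<le> p x"
    and p_int: "\<And>a b. a \<le> b \<Longrightarrow> {a..b} \<subseteq> C \<Longrightarrow> (p has_integral I a b) {a..b}"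
    and I: "\<And>a b. a \<le> b \<Longrightarrow> {a..b} \<subseteq> C \<Longrightarrow> I a b \<le> B"
  shows "(\<lambda>x. ennreal (p x) * indicator C x) \<in> borel_measurable lebesgue"
    and "(\<integral>\<^sup>+x. ennreal (p x) * indicator C x \<partial>lebesgue) \<le> ennreal B"
proof -
  obtain x0 where x0: "x0 \<in> C" using C(3) by blast
  obtain K where K: "\<And>n. compact (K n)" "\<And>n. K n \<subseteq> C" "\<And>n. K n \<subseteq> interior (K (Suc n))" "\<Union>(range K) = C"
    by (rule open_Union_compact_subsets[OF C(1)]) blast
  \<comment> \<open>The point \<open>x0\<close> keeps the compact sets nonempty, so that their
    infima and suprema belong to them. The hulls \<open>J n\<close> stay inside \<open>C\<close>
    because \<open>C\<close> is connected.\<close>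
  define L where "L n = insert x0 (K n)" for n
  have L: "compact (L n)" "L n \<noteq> {}" "L n \<subseteq> C" for n
    using K(1,2) x0 by (auto simp: L_def)
  have Lmono: "L m \<subseteq> L n" if "m \<le> n" for m n
  proof -
    have "K n \<subseteq> K (Suc n)" for n using K(3)[of n] interior_subset by blast
    then show ?thesis using lift_Suc_mono_le[of K m n] that unfolding L_def by auto
  qed
  define J where "J n = {Inf (L n)..Sup (L n)}" for n
  have InfSup: "Inf (L n) \<in> L n" "Sup (L n) \<in> L n" for n
    using closed_contains_Inf[of "L n"] closed_contains_Sup[of "L n"] L(2)[of n] compact_imp_closed[OF L(1)]
      bounded_imp_bdd_above[OF compact_imp_bounded[OF L(1)]] bounded_imp_bdd_below[OF compact_imp_bounded[OF L(1)]]
    by auto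
  have LJ: "L n \<subseteq> J n" for n
    unfolding J_def using L(1)[of n, THEN compact_imp_bounded]
    by (auto intro!: cInf_lower cSup_upper bounded_imp_bdd_above bounded_imp_bdd_below)
  have JC: "J n \<subseteq> C" for n
    unfolding J_def using InfSup[of n] L(3)[of n] C(2) connected_contains_Icc by blast
  have Jle: "Inf (L n) \<le> Sup (L n)" for n
    using LJ[of n] x0 by (auto simp: J_def L_def)
  have Jmono: "J m \<subseteq> J n" if "m \<le> n" for m n
    using LJ[of n] Lmono[OF that] InfSup[of m] unfolding J_def by (auto simp: subset_iff)
  have UJ: "(\<Union>n. J n) = C"
    using JC LJ K(4) unfolding L_def by blast
  define F where "F n x = ennreal (p x) * indicator (J n) x" for n x
  have pJ: "(p has_integral I (Inf (L n)) (Sup (L n))) (J n)" for n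
    unfolding J_def using p_int[OF Jle] JC[of n] by (simp add: J_def)
  \<comment> \<open>Measurability of \<open>p\<close> is not assumed; it comes from the integral
    over each \<open>J n\<close> and passes to the supremum.\<close>
  have Fm: "F n \<in> borel_measurable lebesgue" for n
  proof -
    have "(\<lambda>x. indicator (J n) x *\<^sub>R p x) \<in> borel_measurable lebesgue"
      by (rule has_integral_implies_lebesgue_measurable[OF pJ])
    then have "(\<lambda>x. ennreal (indicator (J n) x *\<^sub>R p x)) \<in> borel_measurable lebesgue"
      by measurable
    moreover have "(\<lambda>x. ennreal (indicator (J n) x *\<^sub>R p x)) = F n"
      by (auto simp: F_def indicator_def fun_eq_iff)
    ultimately show ?thesis by simp
  qed
  have Fle: "integral\<^sup>N lebesgue (F n) \<le> ennreal B" for n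
  proof -
    have "integral\<^sup>N lebesgue (F n) = ennreal (I (Inf (L n)) (Sup (L n)))"
      unfolding F_def nn_integral_completion
      by (intro nn_integral_has_integral_lebesgue' pJ p) (use JC in auto)
    also have "\<dots> \<le> ennreal B"
      using I[OF Jle[of n]] JC[of n] by (intro ennreal_leI) (simp add: J_def)
    finally show ?thesis .
  qed
  have inc: "incseq F"
    using Jmono by (auto simp: incseq_def le_fun_def F_def indicator_def)
  have eq: "(\<lambda>x. ennreal (p x) * indicator C x) = (\<lambda>x. SUP n. F n x)"
  proof
    fix x show "ennreal (p x) * indicator C x = (SUP n. F n x)"
    proof (cases "x \<in> C")
      case True
      then obtain n where n: "x \<in> J n" using UJ by blast
      have "(SUP n. F n x) = ennreal (p x)"
      proof (rule antisym)
        show "(SUP n. F n x) \<le> ennreal (p x)" by (rule SUP_least) (auto simp: F_def indicator_def)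
        show "ennreal (p x) \<le> (SUP n. F n x)" using n by (intro SUP_upper2[of n]) (auto simp: F_def)
      qed
      then show ?thesis using True by simp
    next
      case False
      then have "F n x = 0" for n using UJ by (auto simp: F_def)
      then show ?thesis using False by simp
    qed
  qed
  show "(\<lambda>x. ennreal (p x) * indicator C x) \<in> borel_measurable lebesgue"
    unfolding eq using Fm by simp
  show "(\<integral>\<^sup>+x. ennreal (p x) * indicator C x \<partial>lebesgue) \<le> ennreal B"
    unfolding eq nn_integral_monotone_convergence_SUP[OF inc Fm] using Fle by (rule SUP_least)
qed

text \<open>Since \<open>p\<close> is nonnegative, monotone convergence turns bounded increments
  into a bound for its integral over a component. Comparing with the integral of \<open>k\<close>
  over the same component makes the bounds summable: the components are disjoint, so the total is at
  most the integral of \<open>k\<close>.\<close>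

lemma absolutely_integrable_on_open_by_components:
  fixes p k :: "real \<Rightarrow> real"
  assumes U: "open U" and p: "\<And>x. x \<in> U \<Longrightarrow> 0 \<le> p x"
    and p_int: "\<And>a b. a \<le> b \<Longrightarrow> {a..b} \<subseteq> U \<Longrightarrow> (p has_integral I a b) {a..b}"
    and I: "\<And>C a b. C \<in> components U \<Longrightarrow> a \<le> b \<Longrightarrow> {a..b} \<subseteq> C \<Longrightarrow> I a b \<le> (LINT x:C|lebesgue. k x)"
    and k: "integrable lebesgue k" "\<And>x. 0 \<le> k x"
  shows "p absolutely_integrable_on U"
proof -
  obtain A :: "nat \<Rightarrow> real set" where A: "disjoint_family A" "(\<Union>n. A n) = U"
    "\<And>n. A n = {} \<or> A n \<in> components U"
    using open_components_enum[OF U] by blast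
  have Ao: "open (A n)" for n
    using A(3)[of n] open_components[OF U] by auto
  have As: "A n \<in> sets lebesgue" for n using Ao by auto
  define P where "P n x = ennreal (p x) * indicator (A n) x" for n x
  have P: "P n \<in> borel_measurable lebesgue \<and> integral\<^sup>N lebesgue (P n) \<le> (\<integral>\<^sup>+x. ennreal (k x) * indicator (A n) x \<partial>lebesgue)" for n
  proof (cases "A n = {}")
    case False
    then have C: "A n \<in> components U" using A(3) by auto
    have k': "set_integrable lebesgue (A n) k"
      using k As unfolding set_integrable_def by (intro integrable_mult_indicator) auto
    have *: "(\<integral>\<^sup>+x. ennreal (k x) * indicator (A n) x \<partial>lebesgue) = ennreal (LINT x:A n|lebesgue. k x)"
      using k' k As[of n] by (intro nn_set_integral_eq_set_integral) auto
    show ?thesis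
      unfolding * P_def
      using nn_integral_component_le[of "A n" p I "LINT x:A n|lebesgue. k x"] Ao p p_int I[OF C] False
        in_components_connected[OF C] in_components_subset[OF C]
      by (auto simp: subset_iff)
  next
    case True
    then have "P n = (\<lambda>x. 0)" by (auto simp: P_def)
    then show ?thesis by simp
  qed
  have sum_ind: "(\<Sum>n. c * indicator (A n) x) = c * indicator U x" for c :: ennreal and x
  proof (cases "x \<in> U")
    case True
    then obtain i where "x \<in> A i" using A(2) by blast
    then show ?thesis using suminf_cmult_indicator[OF A(1), of x i "\<lambda>_. c"] True by simp
  next
    case False
    then have "x \<notin> A n" for n using A(2) by blast
    then show ?thesis using False by simp
  qed
  have eq: "(\<lambda>x. \<Sum>n. P n x) = (\<lambda>x. ennreal (p x) * indicator U x)"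
    unfolding P_def sum_ind ..
  have meas: "(\<lambda>x. ennreal (p x) * indicator U x) \<in> borel_measurable lebesgue"
    unfolding eq[symmetric] using P by (simp add: borel_measurable_suminf_order)
  have "(\<integral>\<^sup>+x. ennreal (p x) * indicator U x \<partial>lebesgue) = (\<Sum>n. integral\<^sup>N lebesgue (P n))"
    unfolding eq[symmetric] using P by (intro nn_integral_suminf) auto
  also have "\<dots> \<le> (\<Sum>n. \<integral>\<^sup>+x. ennreal (k x) * indicator (A n) x \<partial>lebesgue)"
    using P by (intro suminf_le) auto
  also have "\<dots> = (\<integral>\<^sup>+x. (\<Sum>n. ennreal (k x) * indicator (A n) x) \<partial>lebesgue)"
    using k As by (intro nn_integral_suminf[symmetric]) (auto intro!: borel_measurable_times_ennreal borel_measurable_integrable)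
  also have "\<dots> \<le> (\<integral>\<^sup>+x. ennreal (k x) \<partial>lebesgue)"
    unfolding sum_ind by (intro nn_integral_mono) (auto simp: indicator_def)
  also have "\<dots> < \<infinity>"
    using k by (simp add: nn_integral_eq_integral)
  finally have fin: "(\<integral>\<^sup>+x. ennreal (p x) * indicator U x \<partial>lebesgue) < \<infinity>" .
  have "integrable lebesgue (\<lambda>x. indicator U x *\<^sub>R p x)"
  proof (rule integrableI_bounded)
    have "(\<lambda>x. indicator U x *\<^sub>R p x) = (\<lambda>x. enn2real (ennreal (p x) * indicator U x))"
      using p by (auto simp: indicator_def fun_eq_iff)
    then show "(\<lambda>x. indicator U x *\<^sub>R p x) \<in> borel_measurable lebesgue" using meas by simp
    have "(\<integral>\<^sup>+x. ennreal (norm (indicator U x *\<^sub>R p x)) \<partial>lebesgue) = (\<integral>\<^sup>+x. ennreal (p x) * indicator U x \<partial>lebesgue)"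
      using p by (intro nn_integral_cong) (auto simp: indicator_def)
    then show "(\<integral>\<^sup>+x. ennreal (norm (indicator U x *\<^sub>R p x)) \<partial>lebesgue) < \<infinity>" using fin by simp
  qed
  then show ?thesis by (simp add: set_integrable_def)
qed

lemma primitive_integral_eq_0:
  assumes f: "primitive f g" and lim: "(f \<longlongrightarrow> 0) at_top" "(f \<longlongrightarrow> 0) at_bot"
  shows "(LINT x|lebesgue. g x) = 0"
proof -
  have g: "integrable lebesgue g" by (rule primitive_integrable[OF f])
  have 1: "(\<lambda>n. LINT x|lebesgue. indicator {- real n..real n} x *\<^sub>R g x) \<longlonglongrightarrow> (LINT x|lebesgue. g x)"
  proof (rule integral_dominated_convergence[where w = "\<lambda>x. \<bar>g x\<bar>"])
    show "AE x in lebesgue. (\<lambda>n. indicator {- real n..real n} x *\<^sub>R g x) \<longlonglongrightarrow> g x"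
    proof (rule AE_I2)
      fix x
      have "\<forall>\<^sub>F n in sequentially. indicator {- real n..real n} x *\<^sub>R g x = g x"
        using eventually_ge_at_top[of "nat \<lceil>\<bar>x\<bar>\<rceil>"] by eventually_elim (auto simp: indicator_def; linarith)
      then show "(\<lambda>n. indicator {- real n..real n} x *\<^sub>R g x) \<longlonglongrightarrow> g x" by (rule tendsto_eventually)
    qed
    show "(\<lambda>y. indicator {- real n..real n} y *\<^sub>R g y) \<in> borel_measurable lebesgue" for n
      using g by (intro borel_measurable_scaleR borel_measurable_indicator borel_measurable_integrable) auto
  qed (use g in \<open>auto simp: indicator_def\<close>)
  have 2: "(LINT x|lebesgue. indicator {- real n..real n} x *\<^sub>R g x) = f (real n) - f (- real n)" for n
    using set_lebesgue_integral_eq_integral(2)[OF integrable_lebesgue_Icc(1)[OF g], of "- real n" "real n"]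
      integral_unique[OF primitive_has_integral[OF f, of "- real n" "real n"]]
    by (simp add: set_lebesgue_integral_def)
  have "(\<lambda>n. f (real n) - f (- real n)) \<longlonglongrightarrow> 0 - 0"
  proof (rule tendsto_diff)
    show "(\<lambda>n. f (real n)) \<longlonglongrightarrow> 0"
      by (rule filterlim_compose[OF lim(1) filterlim_real_sequentially])
    show "(\<lambda>n. f (- real n)) \<longlonglongrightarrow> 0"
      by (rule filterlim_compose[OF lim(2)]) (use filterlim_real_sequentially in \<open>simp add: filterlim_uminus_at_bot\<close>)
  qed
  then show ?thesis using 1 unfolding 2 by (simp add: LIMSEQ_unique)
qed

section \<open>Optimal endpoints and the increments of \<open>u\<close> inside
  \<open>E\<close>\<close>

context nonneg_sobolev
begin

lemma G_le: "x \<le> t \<Longrightarrow> G t - G x \<le> u x * (t - x)"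
  using average_le_u[of x t] by (cases "x = t") (auto simp: average_eq divide_le_eq)

text \<open>Short intervals have averages near \<open>f x\<close>, which is below
  \<open>u x\<close>, and long ones have averages near 0. Hence the supremum is attained on a
  compact range of endpoints, and the maximizers form a compact set, which has a largest
  element.\<close>

lemma endpoint_exists:
  assumes x: "x \<in> E"
  shows "\<exists>t>x. right_average f x t = u x \<and> (\<forall>s>t. right_average f x s < u x)"
proof -
  have ux: "f x < u x" "u x > 0" using x nonneg[of x] by auto
  \<comment> \<open>One threshold below \<open>u x\<close> for both ends of the range: it exceeds
    \<open>f x\<close>, which excludes short intervals, and is at least \<open>u x / 2\<close>,
    which excludes long ones.\<close>
  define m where "m = max ((f x + u x) / 2) (u x / 2)"
  have m: "m < u x" "f x < m" "u x / 2 \<le> m" using ux by (auto simp: m_def less_max_iff_disj field_simps)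
  have "\<exists>b>x. \<forall>t>x. t < b \<longrightarrow> right_average f x t < m"
    using order_tendstoD(2)[OF average_tendsto m(2)] unfolding eventually_at_right_field .
  then obtain b where b0: "x < b \<and> (\<forall>t>x. t < b \<longrightarrow> right_average f x t < m)" ..
  have b: "b > x" "\<And>t. x < t \<Longrightarrow> t < b \<Longrightarrow> right_average f x t < m"
    using b0 by simp_all
  have "0 < u x / 2" using ux by simp
  from average_tendsto_0[OF this]
  obtain R where R: "R > 0" "\<And>z t. t - z \<ge> R \<Longrightarrow> right_average f z t < u x / 2"
    by metis
  define r where "r = max R (b - x)"
  have far: "right_average f x t < m" if "t \<ge> x + r" for t
    using R(2)[where z = x and t = t] m(3) that r_def by linarith
  have cont: "continuous_on {b..x + r} (right_average f x)"
  proof (rule continuous_on_eq)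
    show "continuous_on {b..x + r} (\<lambda>t. (G t - G x) / (t - x))"
      using b by (intro continuous_intros) auto
  qed (use b average_eq in auto)
  have "compact {b..x + r}" "{b..x + r} \<noteq> {}" by (auto simp: r_def)
  from continuous_attains_sup[OF this cont]
  obtain t0 where t0: "t0 \<in> {b..x+r}" "\<And>t. t \<in> {b..x+r} \<Longrightarrow> right_average f x t \<le> right_average f x t0"
    by blast
  have "u x \<le> max m (right_average f x t0)"
  proof (rule u_least)
    fix t assume "x < t"
    then show "right_average f x t \<le> max m (right_average f x t0)"
      using b(2)[of t] far[of t] t0(2)[of t] by (cases "t < b"; cases "t \<ge> x + r") auto
  qed
  moreover have "right_average f x t0 \<le> u x" using t0 b by (intro average_le_u) auto
  ultimately have t0u: "right_average f x t0 = u x" using m by auto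
  define T where "T = {t \<in> {b..x+r}. right_average f x t = u x}"
  have "compact T"
    unfolding T_def
    using continuous_closed_preimage_constant[OF cont, of "u x"] by (intro compact_eq_bounded_closed[THEN iffD2] conjI)
      (auto intro: bounded_subset[of "{b..x+r}"])
  moreover have "T \<noteq> {}" using t0 t0u by (auto simp: T_def)
  ultimately obtain t1 where t1: "t1 \<in> T" "\<And>t. t \<in> T \<Longrightarrow> t \<le> t1"
    using compact_attains_sup by metis
  have "right_average f x s < u x" if "s > t1" for s
  proof (cases "s \<le> x + r")
    case True
    then have "right_average f x s \<noteq> u x" using t1(2)[of s] that t1(1) by (auto simp: T_def)
    moreover have "right_average f x s \<le> u x" using that t1(1) b by (intro average_le_u) (auto simp: T_def)
    ultimately show ?thesis by simp
  next
    case False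
    then show ?thesis using far[of s] m by auto
  qed
  then show ?thesis using t1(1) b by (intro exI[of _ t1]) (auto simp: T_def)
qed

text \<open>The largest optimal right endpoint at a point of \<open>E\<close>; arbitrary elsewhere.\<close>

definition endpoint :: "real \<Rightarrow> real" where
  "endpoint x = (SOME t. t > x \<and> right_average f x t = u x \<and> (\<forall>s>t. right_average f x s < u x))"

lemma
  assumes "x \<in> E"
  shows endpoint_gt: "x < endpoint x" and endpoint_optimal: "right_average f x (endpoint x) = u x"
    and endpoint_last: "\<And>s. endpoint x < s \<Longrightarrow> right_average f x s < u x"
  using someI_ex[OF endpoint_exists[OF assms]] unfolding endpoint_def by auto

lemma endpoint_eq:
  assumes "x \<in> E"
  shows "G (endpoint x) - G x = u x * (endpoint x - x)"
  using endpoint_optimal[OF assms] endpoint_gt[OF assms] by (simp add: average_eq field_simps)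

lemma endpoint_less:
  assumes "x \<in> E" "endpoint x < s"
  shows "G s - G x < u x * (s - x)"
  using endpoint_last[OF assms] endpoint_gt[OF assms(1)] assms(2) by (simp add: average_eq divide_less_eq)

text \<open>The touching line of slope \<open>u x\<close> makes \<open>G t - u x * t\<close> maximal
  at the endpoint, so \<open>f\<close> equals \<open>u x\<close> there. No interval that starts at
  the endpoint has an average above \<open>u x\<close>, because the graph of \<open>G\<close> stays
  below that line. Thus \<open>u\<close> is at most \<open>f\<close> at the endpoint.\<close>

lemma endpoint_notin_E:
  assumes x: "x \<in> E"
  shows "endpoint x \<notin> E"
proof -
  let ?\<phi> = "\<lambda>t. G t - u x * t"
  have "f (endpoint x) - u x = 0"
  proof (rule DERIV_local_max)
    show "(?\<phi> has_real_derivative f (endpoint x) - u x) (at (endpoint x))"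
      by (auto intro!: derivative_eq_intros G_deriv)
    show "0 < endpoint x - x" using endpoint_gt[OF x] by simp
    show "\<forall>y. \<bar>endpoint x - y\<bar> < endpoint x - x \<longrightarrow> ?\<phi> y \<le> ?\<phi> (endpoint x)"
    proof (intro allI impI)
      fix y assume "\<bar>endpoint x - y\<bar> < endpoint x - x"
      then have "G y - G x \<le> u x * (y - x)" by (intro G_le) auto
      then show "?\<phi> y \<le> ?\<phi> (endpoint x)" using endpoint_eq[OF x] by (simp add: algebra_simps)
    qed
  qed
  moreover have "u (endpoint x) \<le> u x"
  proof (rule u_least)
    fix t assume t: "endpoint x < t"
    have "G t - G (endpoint x) \<le> u x * (t - endpoint x)"
      using endpoint_less[OF x t] endpoint_eq[OF x] by (simp add: algebra_simps)
    then show "right_average f (endpoint x) t \<le> u x" using t by (simp add: average_eq divide_le_eq)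
  qed
  ultimately show ?thesis by simp
qed

lemma endpoint_beyond:
  assumes "{a..b} \<subseteq> E" "x \<in> {a..b}"
  shows "b < endpoint x"
proof (rule ccontr)
  assume "\<not> b < endpoint x"
  then have "endpoint x \<in> {a..b}" using assms endpoint_gt[of x] by auto
  then show False using endpoint_notin_E[of x] assms by blast
qed

text \<open>The endpoint of \<open>x\<close> lies beyond \<open>y\<close>. Removing
  \<open>{x..y}\<close>, whose average is at most \<open>u x\<close>, from the optimal interval
  leaves an interval from \<open>y\<close> with average at least \<open>u x\<close>.\<close>

lemma u_mono_in_E:
  assumes "{x..y} \<subseteq> E" "x \<le> y"
  shows "u x \<le> u y"
proof -
  have x: "x \<in> E" using assms by auto
  have y: "y < endpoint x" by (rule endpoint_beyond[OF assms(1)]) (use assms in auto)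
  have "u x * (endpoint x - y) \<le> G (endpoint x) - G y"
    using endpoint_eq[OF x] G_le[OF assms(2)] by (simp add: algebra_simps)
  also have "\<dots> \<le> u y * (endpoint x - y)" using y by (intro G_le) auto
  finally show ?thesis using y by simp
qed

text \<open>If the endpoint of \<open>y\<close> were the larger one, the average between the two
  endpoints would be below \<open>u x\<close>, since the endpoint of \<open>x\<close> is the last
  optimal one, and at least \<open>u y\<close>, since that of \<open>y\<close> is optimal. This
  contradicts \<open>u_mono_in_E\<close>.\<close>

lemma endpoint_antimono:
  assumes "{x..y} \<subseteq> E" "x \<le> y"
  shows "endpoint y \<le> endpoint x"
proof (rule ccontr)
  assume "\<not> endpoint y \<le> endpoint x"
  then have less: "endpoint x < endpoint y" by simp
  have xy: "x \<in> E" "y \<in> E" using assms by auto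
  have y: "y < endpoint x" by (rule endpoint_beyond[OF assms(1)]) (use assms in auto)
  have "G (endpoint y) - G (endpoint x) < u x * (endpoint y - endpoint x)"
    using endpoint_less[OF xy(1) less] endpoint_eq[OF xy(1)] by (simp add: algebra_simps)
  moreover have "u y * (endpoint y - endpoint x) \<le> G (endpoint y) - G (endpoint x)"
    using endpoint_eq[OF xy(2)] G_le[of y "endpoint x"] y by (simp add: algebra_simps)
  moreover have "u x * (endpoint y - endpoint x) \<le> u y * (endpoint y - endpoint x)"
    using u_mono_in_E[OF assms] less by (intro mult_right_mono) auto
  ultimately show False by linarith
qed

text \<open>What results for the derivative of \<open>u\<close> when
  \<open>u x * (r - x) = G r - G x\<close> is differentiated in \<open>x\<close> with the optimal
  endpoint \<open>r\<close> held fixed.\<close>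

definition p :: "real \<Rightarrow> real" where "p x = (u x - f x) / (endpoint x - x)"

lemma p_nonneg: "x \<in> E \<Longrightarrow> 0 \<le> p x"
  using endpoint_gt[of x] by (auto simp: p_def)

text \<open>The endpoint of \<open>x\<close> is used as a competitor in the supremum for
  \<open>u y\<close>. As \<open>y\<close> tends to \<open>x\<close> from the left, the bound tends
  to \<open>p x\<close>.\<close>

lemma u_diff_le:
  assumes "x \<in> E" "y < x"
  shows "(u x - u y) / (x - y) \<le> (u x - (G x - G y) / (x - y)) / (endpoint x - y)"
proof -
  have endpoint: "x < endpoint x" by (rule endpoint_gt[OF assms(1)])
  have "G (endpoint x) - G y \<le> u y * (endpoint x - y)" using endpoint assms by (intro G_le) auto
  then have "(u x - u y) * (endpoint x - y) \<le> u x * (x - y) - (G x - G y)"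
    using endpoint_eq[OF assms(1)] by (simp add: algebra_simps)
  then have "(u x - u y) * (endpoint x - y) / (x - y) \<le> (u x * (x - y) - (G x - G y)) / (x - y)"
    using assms by (intro divide_right_mono) auto
  also have "\<dots> = u x - (G x - G y) / (x - y)" using assms by (simp add: diff_divide_distrib)
  finally show ?thesis using endpoint assms by (simp add: le_divide_eq)
qed

text \<open>The opposite comparison: the endpoint of \<open>y\<close> competes in the supremum for
  \<open>u x\<close>. This bound tends to \<open>p x\<close> only if the endpoints of
  \<open>y\<close> tend to that of \<open>x\<close>.\<close>

lemma u_diff_ge:
  assumes "y \<in> E" "y < x" "x < endpoint y"
  shows "(u y - (G x - G y) / (x - y)) / (endpoint y - x) \<le> (u x - u y) / (x - y)"
proof -
  have "G (endpoint y) - G x \<le> u x * (endpoint y - x)" using assms by (intro G_le) auto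
  then have "u y * (x - y) - (G x - G y) \<le> (u x - u y) * (endpoint y - x)"
    using endpoint_eq[OF assms(1)] by (simp add: algebra_simps)
  then have "(u y * (x - y) - (G x - G y)) / (x - y) \<le> (u x - u y) * (endpoint y - x) / (x - y)"
    using assms by (intro divide_right_mono) auto
  moreover have "(u y * (x - y) - (G x - G y)) / (x - y) = u y - (G x - G y) / (x - y)"
    using assms by (simp add: diff_divide_distrib)
  ultimately show ?thesis using assms by (simp add: divide_le_eq)
qed

text \<open>
  The largest optimal endpoint is left-continuous along \<open>E\<close> but may jump on the right, hence the
  difference quotients from the left.
\<close>

lemma left_derivative:
  assumes E: "{a - \<delta>..b} \<subseteq> E" and \<delta>: "\<delta> > 0" and x: "x \<in> {a..b}"
  shows "(\<lambda>n. (u x - u (x - \<delta> / Suc n)) / (\<delta> / Suc n)) \<longlonglongrightarrow> p x"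
proof -
  define y where "y n = x - \<delta> / Suc n" for n
  have xE: "x \<in> E" by (rule subsetD[OF E]) (use x \<delta> in auto)
  have yx: "y n < x" for n using \<delta> by (simp add: y_def)
  have "\<delta> / Suc n \<le> \<delta>" for n using \<delta> by (simp add: divide_le_eq)
  then have ya: "a - \<delta> \<le> y n" for n using x by (auto simp: y_def) (smt (verit, best))
  have yE: "y n \<in> E" for n by (rule subsetD[OF E]) (use ya[of n] yx[of n] x in auto)
  have yb: "b < endpoint (y n)" for n
    by (rule endpoint_beyond[OF E]) (use ya[of n] yx[of n] x in auto)
  have ylim: "y \<longlonglongrightarrow> x"
    unfolding y_def using tendsto_diff[OF tendsto_const LIMSEQ_Suc[OF lim_const_over_n[of \<delta>]], of x] by simp
  have ymono: "y m \<le> y n" if "m \<le> n" for m n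
    using that \<delta> unfolding y_def by (intro diff_left_mono divide_left_mono) auto
  have dec: "decseq (\<lambda>n. endpoint (y n))"
  proof (unfold decseq_def, intro allI impI)
    fix m n :: nat assume "m \<le> n"
    then show "endpoint (y n) \<le> endpoint (y m)"
      using E ya[of m] yx[of n] x ymono by (intro endpoint_antimono order_trans[OF _ E]) auto
  qed
  have ge: "endpoint x \<le> endpoint (y n)" for n
    using E ya[of n] yx[of n] x by (intro endpoint_antimono order_trans[OF _ E]) auto
  obtain L where L: "(\<lambda>n. endpoint (y n)) \<longlonglongrightarrow> L" "\<And>n. L \<le> endpoint (y n)"
    using decseq_convergent[OF dec, of "endpoint x"] ge by blast
  have Lx: "endpoint x \<le> L" using L(1) ge by (intro LIMSEQ_le_const) auto
  have gL: "isCont G L" "isCont G x" using G_deriv DERIV_isCont by blast+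
  have "(\<lambda>n. G (endpoint (y n)) - G (y n)) \<longlonglongrightarrow> G L - G x"
    by (intro tendsto_diff isCont_tendsto_compose[OF gL(1) L(1)] isCont_tendsto_compose[OF gL(2) ylim])
  moreover have uy: "(\<lambda>n. u (y n)) \<longlonglongrightarrow> u x"
    by (intro isCont_tendsto_compose[OF u_isCont ylim])
  then have "(\<lambda>n. u (y n) * (endpoint (y n) - y n)) \<longlonglongrightarrow> u x * (L - x)"
    by (intro tendsto_intros L ylim)
  ultimately have GL: "G L - G x = u x * (L - x)"
    using endpoint_eq[OF yE] by (simp add: LIMSEQ_unique)
  \<comment> \<open>By continuity the limit \<open>L\<close> is again optimal for \<open>x\<close>.
    It is not smaller than the endpoint of \<open>x\<close>, which is the largest optimal one, so
    the two agree.\<close>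
  have "L = endpoint x"
    using endpoint_less[OF xE, of L] GL Lx by force
  then have elim: "(\<lambda>n. endpoint (y n)) \<longlonglongrightarrow> endpoint x" using L by simp
  have ex: "x < endpoint x" by (rule endpoint_gt[OF xE])
  have Glim: "(\<lambda>n. (G x - G (y n)) / (x - y n)) \<longlonglongrightarrow> f x"
  proof -
    have "((\<lambda>t. (G t - G x) / (t - x)) \<longlongrightarrow> f x) (at x)"
      using G_deriv[of x] by (simp add: has_field_derivative_iff)
    moreover have "filterlim y (at x) sequentially"
      using ylim yx by (auto simp: filterlim_at less_le)
    ultimately have "(\<lambda>n. (G (y n) - G x) / (y n - x)) \<longlonglongrightarrow> f x"
      by (rule filterlim_compose)
    then show ?thesis by (metis (no_types, lifting) ext minus_diff_eq minus_divide_divide)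
  qed
  have "(\<lambda>n. (u x - u (y n)) / (x - y n)) \<longlonglongrightarrow> p x"
  proof (rule tendsto_sandwich)
    show "\<forall>\<^sub>F n in sequentially. (u (y n) - (G x - G (y n)) / (x - y n)) / (endpoint (y n) - x) \<le> (u x - u (y n)) / (x - y n)"
      using u_diff_ge[OF yE yx] yb x by (intro always_eventually allI) (meson atLeastAtMost_iff le_less_trans)
    show "\<forall>\<^sub>F n in sequentially. (u x - u (y n)) / (x - y n) \<le> (u x - (G x - G (y n)) / (x - y n)) / (endpoint x - y n)"
      using u_diff_le[OF xE yx] by (intro always_eventually allI)
    show "(\<lambda>n. (u (y n) - (G x - G (y n)) / (x - y n)) / (endpoint (y n) - x)) \<longlonglongrightarrow> p x"
      unfolding p_def using ex by (intro tendsto_intros uy elim Glim) auto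
    show "(\<lambda>n. (u x - (G x - G (y n)) / (x - y n)) / (endpoint x - y n)) \<longlonglongrightarrow> p x"
      unfolding p_def using ex by (intro tendsto_intros ylim Glim) auto
  qed
  then show ?thesis by (simp add: y_def)
qed

text \<open>The left difference quotients of \<open>u\<close> have explicit integrals in terms of an
  antiderivative \<open>U\<close>, and these tend to \<open>u b - u a\<close>. Inside the integral
  the quotients tend to \<open>p\<close> and are bounded by a constant, so dominated convergence
  applies; one-sided derivatives are enough for this argument.\<close>

lemma p_has_integral:
  assumes ab: "a \<le> b" and E: "{a..b} \<subseteq> E"
  shows "(p has_integral u b - u a) {a..b}"
proof -
  \<comment> \<open>The margin on the left keeps the points \<open>x - h n\<close> in
    \<open>E\<close>. The margin on the right pushes all endpoints beyond
    \<open>b + \<delta>\<close>, since endpoints avoid \<open>E\<close>; this bounds the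
    denominators from below by \<delta>.\<close>
  obtain \<delta> where \<delta>: "\<delta> > 0" "{a - \<delta>..b + \<delta>} \<subseteq> E"
  proof -
    obtain d1 where d1: "d1 > 0" "cball a d1 \<subseteq> E"
      using open_E E ab by (metis atLeastAtMost_iff open_contains_cball order_refl subsetD)
    obtain d2 where d2: "d2 > 0" "cball b d2 \<subseteq> E"
      using open_E E ab by (metis atLeastAtMost_iff open_contains_cball order_refl subsetD)
    have *: "x \<in> E" if "x \<in> {a - min d1 d2..b + min d1 d2}" for x
    proof -
      have "x \<in> {a..b} \<or> x \<in> cball a d1 \<or> x \<in> cball b d2" using that by (auto simp: dist_real_def)
      then show ?thesis using E d1 d2 by blast
    qed
    show ?thesis
    proof (rule that)
      show "0 < min d1 d2" using d1 d2 by simp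
      show "{a - min d1 d2..b + min d1 d2} \<subseteq> E" using * by blast
    qed
  qed
  have E': "{a - \<delta>..b} \<subseteq> E" by (rule order_trans[OF _ \<delta>(2)]) (use \<delta>(1) in auto)
  define h where "h n = \<delta> / Suc n" for n
  have h: "0 < h n" "h n \<le> \<delta>" for n using \<delta> by (auto simp: h_def divide_le_eq)
  have hlim: "h \<longlonglongrightarrow> 0"
    unfolding h_def using LIMSEQ_Suc[OF lim_const_over_n[of \<delta>]] by simp
  have "\<exists>U. \<forall>x::real. (-\<infinity>::ereal) < x \<longrightarrow> x < (\<infinity>::ereal) \<longrightarrow> (U has_vector_derivative u x) (at x)"
    by (intro einterval_antiderivative) auto
  then obtain U where U: "\<And>x. (U has_real_derivative u x) (at x)"
    by (auto simp: has_real_derivative_iff_has_vector_derivative)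
  define B where "B = (LINT y|lebesgue. \<bar>g y\<bar>)"
  have quot: "((\<lambda>x. (u x - u (x - h n)) / h n) has_integral
      (U b - U (b - h n)) / h n - (U a - U (a - h n)) / h n) {a..b}" for n
  proof (rule fundamental_theorem_of_calculus[OF ab])
    fix x assume "x \<in> {a..b}"
    have "((\<lambda>x. x - h n) has_real_derivative 1) (at x)" by (auto intro!: derivative_eq_intros)
    from DERIV_chain2[OF U this] have "((\<lambda>x. U (x - h n)) has_real_derivative u (x - h n)) (at x)" by simp
    then have "((\<lambda>x. (U x - U (x - h n)) / h n) has_real_derivative (u x - u (x - h n)) / h n) (at x)"
      by (intro DERIV_cdivide DERIV_diff U)
    then show "((\<lambda>x. (U x - U (x - h n)) / h n) has_vector_derivative (u x - u (x - h n)) / h n) (at x within {a..b})"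
      by (simp add: has_real_derivative_iff_has_vector_derivative has_vector_derivative_at_within)
  qed
  have Ulim: "(\<lambda>n. (U x - U (x - h n)) / h n) \<longlonglongrightarrow> u x" for x
  proof -
    have "((\<lambda>t. (U t - U x) / (t - x)) \<longlongrightarrow> u x) (at x)"
      using U[of x] by (simp add: has_field_derivative_iff)
    moreover have "filterlim (\<lambda>n. x - h n) (at x) sequentially"
      unfolding filterlim_at using tendsto_diff[OF tendsto_const hlim, of x] h(1)
      by (auto simp: less_le)
    ultimately have "(\<lambda>n. (U (x - h n) - U x) / ((x - h n) - x)) \<longlonglongrightarrow> u x"
      by (rule filterlim_compose)
    moreover have "(U (x - h n) - U x) / ((x - h n) - x) = (U x - U (x - h n)) / h n" for n
      using h(1)[of n] by (simp add: field_simps)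
    ultimately show ?thesis by simp
  qed
  show ?thesis
  proof (rule has_integral_dominated_convergence[OF quot])
    show "(\<lambda>n. (U b - U (b - h n)) / h n - (U a - U (a - h n)) / h n) \<longlonglongrightarrow> u b - u a"
      by (intro tendsto_diff Ulim)
    show "(\<lambda>x. B / \<delta>) integrable_on {a..b}" by (intro integrable_continuous_real continuous_intros)
    show "\<forall>x\<in>{a..b}. (\<lambda>n. (u x - u (x - h n)) / h n) \<longlonglongrightarrow> p x"
      unfolding h_def using left_derivative[OF E' \<delta>(1)] by blast
    show "\<forall>x\<in>{a..b}. norm ((u x - u (x - h n)) / h n) \<le> B / \<delta>" for n
    proof
      fix x assume x: "x \<in> {a..b}"
      have xE: "x \<in> E" by (rule subsetD[OF E x])
      have y: "x - h n \<in> {a - \<delta>..b}" using x h[of n] by auto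
      have sub: "{x - h n..x} \<subseteq> E" using y x by (intro order_trans[OF _ E']) auto
      have "b + \<delta> < endpoint x" by (rule endpoint_beyond[OF \<delta>(2)]) (use x \<delta> in auto)
      then have ex: "\<delta> \<le> endpoint x - (x - h n)" using x h[of n] by auto
      have Gn: "0 \<le> (G x - G (x - h n)) / h n" using G_mono[of "x - h n" x] h[of n] by simp
      have nn: "0 \<le> (u x - u (x - h n)) / h n" using u_mono_in_E[OF sub] h[of n] by simp
      have "(u x - u (x - h n)) / h n \<le> (u x - (G x - G (x - h n)) / h n) / (endpoint x - (x - h n))"
        using u_diff_le[OF xE, of "x - h n"] h[of n] by simp
      also have "\<dots> \<le> u x / (endpoint x - (x - h n))"
        using Gn ex \<delta>(1) by (intro divide_right_mono) auto
      also have "\<dots> \<le> B / \<delta>"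
        unfolding B_def using ex \<delta>(1) u_nonneg[of x] u_le[of x] by (intro frac_le) auto
      finally show "norm ((u x - u (x - h n)) / h n) \<le> B / \<delta>"
        unfolding real_norm_def abs_of_nonneg[OF nn] .
    qed
  qed
qed

text \<open>As \<open>u\<close> increases up to the right end of the component, where it equals
  \<open>f\<close>, and \<open>u c\<close> is at least \<open>f c\<close>, the increment of
  \<open>u\<close> is at most an increment of \<open>f\<close> within the closure of
  \<open>C\<close>. The latter is bounded by the variation of \<open>f\<close> over
  \<open>C\<close>.\<close>

lemma u_increment_le:
  assumes C: "C \<in> components E" and cd: "c \<le> d" "{c..d} \<subseteq> C"
  shows "u d - u c \<le> (LINT x:C|lebesgue. \<bar>g x\<bar>)"
proof -
  let ?K = "LINT x:C|lebesgue. \<bar>g x\<bar>"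
  have CE: "C \<subseteq> E" and oC: "open C" using in_components_subset[OF C] open_components[OF open_E C] by auto
  \<comment> \<open>\<open>\<beta>\<close> is the first point after \<open>d\<close> outside \<open>E\<close>; there \<open>u = f\<close>.\<close>
  have dE: "d \<in> E" by (rule subsetD[OF CE], rule subsetD[OF cd(2)]) (use cd in auto)
  have "compact ({d..endpoint d} \<inter> (- E))"
    using open_E by (intro compact_Int_closed) (auto simp: closed_def)
  moreover have "endpoint d \<in> {d..endpoint d} \<inter> (- E)" using endpoint_notin_E[OF dE] endpoint_gt[OF dE] by auto
  then have "{d..endpoint d} \<inter> (- E) \<noteq> {}" by blast
  ultimately obtain \<beta> where \<beta>: "\<beta> \<in> {d..endpoint d} \<inter> (- E)" "\<And>z. z \<in> {d..endpoint d} \<inter> (- E) \<Longrightarrow> \<beta> \<le> z"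
    using compact_attains_inf by meson
  have d\<beta>: "d < \<beta>" using \<beta>(1) dE by (cases "d = \<beta>") auto
  have inE: "z \<in> E" if "d \<le> z" "z < \<beta>" for z
    using \<beta>(2)[of z] \<beta>(1) that by force
  have sub: "{d..z} \<subseteq> E" if "z < \<beta>" for z using inE that by auto
  have subC: "{c..z} \<subseteq> C" if "d \<le> z" "z < \<beta>" for z
  proof (rule components_maximal[OF C])
    have "{c..z} \<subseteq> {c..d} \<union> {d..z}" by auto
    then show "{c..z} \<subseteq> E" using cd CE sub[OF that(2)] by blast
    have "c \<in> C \<inter> {c..z}" using cd that by auto
    then show "C \<inter> {c..z} \<noteq> {}" by blast
  qed simp
  have ev: "\<forall>\<^sub>F z in at_left \<beta>. z \<in> {d<..<\<beta>}"
    by (rule eventually_at_leftI[OF _ d\<beta>])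
  have "u d \<le> u \<beta>"
  proof (rule tendsto_lowerbound)
    show "(u \<longlongrightarrow> u \<beta>) (at_left \<beta>)"
      using u_isCont[of \<beta>] by (simp add: isCont_def filterlim_at_split)
    show "\<forall>\<^sub>F z in at_left \<beta>. u d \<le> u z"
      using ev by eventually_elim (use sub u_mono_in_E in \<open>meson greaterThanLessThan_iff less_imp_le\<close>)
  qed simp
  also have "u \<beta> = f \<beta>" using \<beta>(1) f_le_u[of \<beta>] by auto
  also have "f \<beta> \<le> u c + ?K"
  proof (rule tendsto_upperbound)
    show "(f \<longlongrightarrow> f \<beta>) (at_left \<beta>)"
      using f_isCont[of \<beta>] by (simp add: isCont_def filterlim_at_split)
    show "\<forall>\<^sub>F z in at_left \<beta>. f z \<le> u c + ?K"
      using ev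
    proof eventually_elim
      case (elim z)
      then have "\<bar>integral {c..z} g\<bar> \<le> ?K"
        using oC by (intro integral_Icc_le_set_integral primitive_integrable[OF prim] subC) auto
      moreover have "integral {c..z} g = f z - f c"
        using cd elim by (intro integral_unique primitive_has_integral[OF prim]) auto
      ultimately show "f z \<le> u c + ?K" using f_le_u[of c] by linarith
    qed
  qed simp
  finally show ?thesis by simp
qed

lemma p_integrable: "p absolutely_integrable_on E"
proof (rule absolutely_integrable_on_open_by_components[OF open_E p_nonneg])
  show "(p has_integral u b - u a) {a..b}" if "a \<le> b" "{a..b} \<subseteq> E" for a b
    by (rule p_has_integral[OF that])
  show "u b - u a \<le> (LINT x:C|lebesgue. \<bar>g x\<bar>)" if "C \<in> components E" "a \<le> b" "{a..b} \<subseteq> C" for C a b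
    by (rule u_increment_le[OF that])
qed (use primitive_integrable[OF prim] in auto)

section \<open>The derivative of \<open>u\<close> on the whole line\<close>

definition u' :: "real \<Rightarrow> real" where "u' x = (if x \<in> E then p x else g x)"

text \<open>The nonzero set of \<open>u - f\<close> is exactly \<open>E\<close>, so gluing needs the
  increments of \<open>u\<close> only inside \<open>E\<close>; adding \<open>f\<close> back gives
  \<open>g\<close> as derivative elsewhere.\<close>

lemma primitive_u: "primitive u u'"
proof -
  have E: "{x. u x - f x \<noteq> 0} = E" using f_le_u by (auto simp: less_le)
  have "open E" by (rule open_E)
  then have gE: "g absolutely_integrable_on E"
    using set_integrable_subset[of lebesgue UNIV g E] primitive_integrable[OF prim]
    by (auto simp: integrable_lebesgue_abs_int)
  have "primitive (\<lambda>x. u x - f x) (\<lambda>x. if u x - f x \<noteq> 0 then p x - g x else 0)"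
  proof (rule primitive_glue)
    show "isCont (\<lambda>x. u x - f x) x" for x by (intro continuous_intros) auto
    show "(\<lambda>x. p x - g x) absolutely_integrable_on {x. u x - f x \<noteq> 0}"
      unfolding E by (intro set_integral_diff p_integrable gE)
    fix a b :: real assume "a \<le> b" "{a..b} \<subseteq> {x. u x - f x \<noteq> 0}"
    then have "((\<lambda>x. p x - g x) has_integral (u b - u a) - (f b - f a)) {a..b}"
      unfolding E by (intro has_integral_diff p_has_integral primitive_has_integral[OF prim])
    then show "((\<lambda>x. p x - g x) has_integral (u b - f b) - (u a - f a)) {a..b}"
      by (simp add: algebra_simps)
  qed
  from primitive_add[OF this prim]
  have "primitive u (\<lambda>x. (if u x - f x \<noteq> 0 then p x - g x else 0) + g x)" by simp
  moreover have "(\<lambda>x. (if u x - f x \<noteq> 0 then p x - g x else 0) + g x) = u'"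
  proof
    fix x show "(if u x - f x \<noteq> 0 then p x - g x else 0) + g x = u' x"
      using f_le_u[of x] by (auto simp: u'_def)
  qed
  ultimately show ?thesis by simp
qed

lemma integral_u'_eq_0: "(LINT x|lebesgue. u' x) = 0"
  by (rule primitive_integral_eq_0[OF primitive_u u_tendsto_0_at_top u_tendsto_0_at_bot])

text \<open>If \<open>x\<close> is a point of right differentiability with \<open>g x > 0\<close>,
  then \<open>f\<close> exceeds \<open>f x\<close> just to the right of \<open>x\<close>. Short
  averages from \<open>x\<close> then exceed \<open>f x\<close>, which puts \<open>x\<close> into
  \<open>E\<close>.\<close>

lemma g_nonpos_outside_E: "AE x in lebesgue. x \<notin> E \<longrightarrow> g x \<le> 0"
proof -
  have "AE x in lebesgue. \<forall>\<epsilon>>0. \<exists>d>0. \<forall>h. 0 < h \<and> h < d \<longrightarrow> \<bar>integral {x..x+h} g / h - g x\<bar> < \<epsilon>"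
    by (intro right_derivative_AE integrable_lebesgue_Icc primitive_integrable[OF prim])
  then show ?thesis
  proof eventually_elim
    case (elim x)
    show ?case
    proof (intro impI, rule ccontr)
      assume x: "x \<notin> E" "\<not> g x \<le> 0"
      then obtain d where d: "d > 0" "\<And>h. 0 < h \<Longrightarrow> h < d \<Longrightarrow> \<bar>integral {x..x+h} g / h - g x\<bar> < g x"
        using elim by (meson not_le)
      have less: "f x < f z" if "x < z" "z < x + d" for z
      proof -
        have "0 < integral {x..z} g / (z - x)"
          using d(2)[of "z - x"] that by (simp; linarith)
        moreover have "integral {x..z} g = f z - f x"
          using that by (intro integral_unique primitive_has_integral[OF prim]) auto
        ultimately show ?thesis using that by (simp add: zero_less_divide_iff)
      qed
      obtain z where "x < z" "z < x + d / 2" "right_average f x (x + d / 2) = f z"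
        using average_mvt[of x "x + d / 2"] d by auto
      then have "f x < u x"
        using less[of z] average_le_u[of x "x + d / 2"] d(1) by auto
      then show False using x by simp
    qed
  qed
qed

end

subsection \<open>Continuity of the right maximal function\<close>

text \<open>Strict inequality beyond the largest optimal endpoint becomes a uniform gap, by
  compactness for bounded lengths and by decay for long ones. A uniform gap survives small uniform
  perturbations of the averages, so the endpoints of nearby functions cannot exceed this one by
  \<epsilon>.\<close>

lemma (in nonneg_sobolev) average_gap_beyond_endpoint:
  assumes x: "x \<in> E" and \<epsilon>: "0 < \<epsilon>"
  obtains \<eta> where "0 < \<eta>" "\<And>t. endpoint x + \<epsilon> \<le> t \<Longrightarrow> right_average f x t \<le> u x - \<eta>"
proof -
  have ux: "u x > 0" using x nonneg[of x] by auto
  have ex: "x < endpoint x" by (rule endpoint_gt[OF x])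
  have "0 < u x / 2" using ux by simp
  from average_tendsto_0[OF this]
  obtain R where R: "R > 0" "\<And>z t. t - z \<ge> R \<Longrightarrow> right_average f z t < u x / 2"
    by metis
  define r where "r = max R (endpoint x + \<epsilon> - x)"
  have far: "right_average f x t \<le> u x / 2" if "t \<ge> x + r" for t
    using R(2)[where z = x and t = t] that r_def by linarith
  have cont: "continuous_on {endpoint x + \<epsilon>..x + r} (right_average f x)"
  proof (rule continuous_on_eq)
    show "continuous_on {endpoint x + \<epsilon>..x + r} (\<lambda>t. (G t - G x) / (t - x))"
      using ex \<epsilon> by (intro continuous_intros) auto
  qed (use ex \<epsilon> average_eq in auto)
  have "compact {endpoint x + \<epsilon>..x + r}" "{endpoint x + \<epsilon>..x + r} \<noteq> {}" by (auto simp: r_def)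
  from continuous_attains_sup[OF this cont]
  obtain t0 where t0: "t0 \<in> {endpoint x + \<epsilon>..x+r}"
      "\<forall>t\<in>{endpoint x + \<epsilon>..x+r}. right_average f x t \<le> right_average f x t0" ..
  have less: "right_average f x t0 < u x" using t0(1) \<epsilon> by (intro endpoint_last[OF x]) auto
  show ?thesis
  proof (rule that[of "min (u x - right_average f x t0) (u x / 2)"])
    show "0 < min (u x - right_average f x t0) (u x / 2)" using less ux by simp
    fix t assume "endpoint x + \<epsilon> \<le> t"
    then show "right_average f x t \<le> u x - min (u x - right_average f x t0) (u x / 2)"
      using t0(2)[rule_format, of t] far[of t] by (cases "t \<le> x + r") (auto simp: min_def)
  qed
qed

theorem right_maximal_L1_limit:
  assumes f: "nonneg_sobolev f g" and F: "\<And>j. nonneg_sobolev (F j) (K j)"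
    and L1: "(\<lambda>j. LINT x|lebesgue. \<bar>K j x - g x\<bar>) \<longlonglongrightarrow> 0"
  shows "(\<lambda>j. LINT x|lebesgue. \<bar>nonneg_sobolev.u' (F j) (K j) x - nonneg_sobolev.u' f g x\<bar>) \<longlonglongrightarrow> 0"
    and "(\<lambda>j. right_maximal (F j) x) \<longlonglongrightarrow> right_maximal f x"
proof -
  interpret A: nonneg_sobolev f g by (rule f)
  interpret B: nonneg_sobolev "F j" "K j" for j by (rule F)
  \<comment> \<open>This single quantity will bound the distances of the functions, of their
    averages and of their maximal functions, uniformly in the point.\<close>
  define \<eta> where "\<eta> j = (LINT x|lebesgue. \<bar>K j x - g x\<bar>)" for j
  have \<eta>: "\<eta> \<longlonglongrightarrow> 0" using L1 by (simp add: \<eta>_def[abs_def])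
  have Ff: "\<bar>F j x - f x\<bar> \<le> \<eta> j" for j x
    unfolding \<eta>_def using A.int B.int
    by (intro primitive_le_L1[OF primitive_diff[OF B.prim A.prim]]) simp
  have avg: "\<bar>right_average (F j) x t - right_average f x t\<bar> \<le> \<eta> j" if t: "x < t" for j x t
  proof -
    have "((\<lambda>y. F j y - f y) has_integral (B.G j t - B.G j x) - (A.G t - A.G x)) {x..t}"
      using t by (intro has_integral_diff A.G_integral B.G_integral) auto
    then have "\<bar>(B.G j t - B.G j x) - (A.G t - A.G x)\<bar> \<le> \<eta> j * (t - x)"
      using has_integral_bound_real[of "\<eta> j" "{}" "\<lambda>y. F j y - f y" _ x t] Ff t abs_ge_zero order_trans[OF abs_ge_zero Ff]
      by auto
    then have "\<bar>(B.G j t - B.G j x) - (A.G t - A.G x)\<bar> / (t - x) \<le> \<eta> j"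
      using t by (simp add: divide_le_eq)
    moreover have "right_average (F j) x t - right_average f x t = ((B.G j t - B.G j x) - (A.G t - A.G x)) / (t - x)"
      using t by (simp add: A.average_eq B.average_eq diff_divide_distrib)
    ultimately show ?thesis using t by (simp add: abs_divide)
  qed
  have uu: "\<bar>B.u j x - A.u x\<bar> \<le> \<eta> j" for j x
  proof -
    have "B.u j x \<le> A.u x + \<eta> j"
      by (rule B.u_least) (use avg A.average_le_u in \<open>smt (verit, best)\<close>)
    moreover have "A.u x \<le> B.u j x + \<eta> j"
      by (rule A.u_least) (use avg B.average_le_u in \<open>smt (verit, best)\<close>)
    ultimately show ?thesis by linarith
  qed
  have ulim: "(\<lambda>j. B.u j x) \<longlonglongrightarrow> A.u x" for x
    by (rule LIM_zero_cancel[OF Lim_null_comparison[OF _ \<eta>]]) (use uu in simp)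
  have Flim: "(\<lambda>j. F j x) \<longlonglongrightarrow> f x" for x
    by (rule LIM_zero_cancel[OF Lim_null_comparison[OF _ \<eta>]]) (use Ff in simp)
  show "(\<lambda>j. right_maximal (F j) x) \<longlonglongrightarrow> right_maximal f x" by (rule ulim)
  have liminf: "\<forall>\<^sub>F j in sequentially. x \<in> B.E j \<and> c < B.p j x" if x: "x \<in> A.E" and c: "c < A.p x" for x c
  proof -
    define r where "r = A.endpoint x - x"
    have r: "r > 0" using A.endpoint_gt[OF x] by (simp add: r_def)
    have "((\<lambda>\<epsilon>. (A.u x - f x) / (r + \<epsilon>)) \<longlongrightarrow> (A.u x - f x) / (r + 0)) (at_right 0)"
      using r by (intro tendsto_intros) auto
    then have "\<forall>\<^sub>F \<epsilon> in at_right 0. c < (A.u x - f x) / (r + \<epsilon>)"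
      using c by (intro order_tendstoD(1)) (auto simp: A.p_def r_def)
    then have "\<forall>\<^sub>F \<epsilon> in at_right 0. 0 < \<epsilon> \<and> c < (A.u x - f x) / (r + \<epsilon>)"
      using eventually_at_right_less[of 0] by (rule eventually_conj[rotated])
    \<comment> \<open>The quotient stays above \<open>c\<close> when the optimal length grows
      slightly; \<epsilon> is the amount by which the endpoints for \<open>F j\<close> may exceed
      the one for \<open>f\<close>.\<close>
    then obtain \<epsilon> where \<epsilon>: "0 < \<epsilon>" "c < (A.u x - f x) / (r + \<epsilon>)"
      using eventually_happens' trivial_limit_at_right_real by blast
    obtain \<eta>0 where \<eta>0: "0 < \<eta>0" "\<And>t. A.endpoint x + \<epsilon> \<le> t \<Longrightarrow> right_average f x t \<le> A.u x - \<eta>0"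
      using A.average_gap_beyond_endpoint[OF x \<epsilon>(1)] by blast
    have "(\<lambda>j. (B.u j x - F j x)) \<longlonglongrightarrow> A.u x - f x" by (intro tendsto_diff ulim Flim)
    then have 1: "\<forall>\<^sub>F j in sequentially. 0 < B.u j x - F j x"
      using x by (intro order_tendstoD(1)) auto
    have "(\<lambda>j. (B.u j x - F j x) / (r + \<epsilon>)) \<longlonglongrightarrow> (A.u x - f x) / (r + \<epsilon>)"
      using r \<epsilon> by (intro tendsto_intros ulim Flim) auto
    then have 2: "\<forall>\<^sub>F j in sequentially. c < (B.u j x - F j x) / (r + \<epsilon>)"
      using \<epsilon>(2) by (rule order_tendstoD(1))
    \<comment> \<open>The factor 2 accounts for two errors of size at most \<open>\<eta> j\<close>,
      one in the average and one in the maximal function; together they stay below the gap.\<close>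
    have 3: "\<forall>\<^sub>F j in sequentially. \<eta> j < \<eta>0 / 2"
      using \<eta> \<eta>0(1) by (intro order_tendstoD(2)) auto
    from 1 2 3 show ?thesis
    proof eventually_elim
      case (elim j)
      then have xj: "x \<in> B.E j" by simp
      have ej: "x < B.endpoint j x" by (rule B.endpoint_gt[OF xj])
      have "B.endpoint j x < A.endpoint x + \<epsilon>"
      proof (rule ccontr)
        assume "\<not> ?thesis"
        then have "right_average f x (B.endpoint j x) \<le> A.u x - \<eta>0" by (intro \<eta>0(2)) auto
        then show False
          using avg[OF ej, of j] uu[of j x] B.endpoint_optimal[OF xj] elim by linarith
      qed
      then have "(B.u j x - F j x) / (r + \<epsilon>) \<le> B.p j x"
        unfolding B.p_def using ej elim by (intro divide_left_mono) (auto simp: r_def)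
      then show ?case using elim xj by linarith
    qed
  qed
  note int = primitive_integrable[OF A.prim] primitive_integrable[OF B.prim]
    primitive_integrable[OF A.primitive_u] primitive_integrable[OF B.primitive_u]
  note meas = int[THEN borel_measurable_integrable]
  have sets: "A.E \<in> sets lebesgue" "B.E j \<in> sets lebesgue" for j
    using A.open_E B.open_E by auto
  \<comment> \<open>The error on \<open>E\<close> beyond \<open>\<bar>K j x - g x\<bar>\<close>.
    Outside \<open>B.E j\<close> the derivative of the perturbed maximal function is
    \<open>K j x\<close>, whose difference from \<open>g x\<close> is already counted, and
    \<open>\<bar>A.u' x\<bar> + \<bar>g x\<bar>\<close> covers the rest. Inside \<open>B.E j\<close>
    nonnegativity of \<open>B.p\<close> gives the same majorant, which does not depend on
    \<open>j\<close>.\<close>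
  define k where "k j x = (if x \<in> A.E then if x \<in> B.E j then max 0 (A.u' x - B.u' j x)
    else \<bar>A.u' x\<bar> + \<bar>g x\<bar> else 0)" for j x
  have kmeas: "k j \<in> borel_measurable lebesgue" for j
  proof -
    have "k j = (\<lambda>x. indicator A.E x * (indicator (B.E j) x * max 0 (A.u' x - B.u' j x)
        + (1 - indicator (B.E j) x) * (\<bar>A.u' x\<bar> + \<bar>g x\<bar>)))"
      by (auto simp: k_def fun_eq_iff indicator_def)
    also have "\<dots> \<in> borel_measurable lebesgue"
      by (intro borel_measurable_times borel_measurable_add borel_measurable_diff borel_measurable_indicator
        borel_measurable_max borel_measurable_abs borel_measurable_const meas sets)
    finally show ?thesis .
  qed
  have kle: "\<bar>k j x\<bar> \<le> \<bar>A.u' x\<bar> + \<bar>g x\<bar>" for j x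
    using B.p_nonneg[of x j] by (auto simp: k_def B.u'_def)
  have kint: "integrable lebesgue (k j)" for j
  proof (rule Bochner_Integration.integrable_bound)
    show "integrable lebesgue (\<lambda>x. \<bar>A.u' x\<bar> + \<bar>g x\<bar>)"
      by (intro Bochner_Integration.integrable_add integrable_abs int)
    show "k j \<in> borel_measurable lebesgue" by (rule kmeas)
    show "AE x in lebesgue. norm (k j x) \<le> norm (\<bar>A.u' x\<bar> + \<bar>g x\<bar>)"
      unfolding real_norm_def by (intro AE_I2 order_trans[OF kle abs_ge_self])
  qed
  have k0: "(\<lambda>j. k j x) \<longlonglongrightarrow> 0" for x
  proof (cases "x \<in> A.E")
    case True
    show ?thesis
    proof (rule tendstoI)
      fix \<epsilon> :: real assume \<epsilon>: "0 < \<epsilon>"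
      then have "\<forall>\<^sub>F j in sequentially. x \<in> B.E j \<and> A.p x - \<epsilon> < B.p j x"
        by (intro liminf True) simp
      then show "\<forall>\<^sub>F j in sequentially. dist (k j x) 0 < \<epsilon>"
        by eventually_elim (use True \<epsilon> in \<open>auto simp: k_def A.u'_def B.u'_def\<close>)
    qed
  qed (auto simp: k_def)
  have klim: "(\<lambda>j. LINT x|lebesgue. k j x) \<longlonglongrightarrow> 0"
  proof -
    have "(\<lambda>j. LINT x|lebesgue. k j x) \<longlonglongrightarrow> (LINT (x::real)|lebesgue. 0)"
      using int kmeas kle k0
      by (intro integral_dominated_convergence[where w = "\<lambda>x. \<bar>A.u' x\<bar> + \<bar>g x\<bar>"]) auto
    then show ?thesis by simp
  qed
  have "(\<lambda>j. LINT x|lebesgue. \<bar>max 0 (A.u' x - B.u' j x)\<bar>) \<longlonglongrightarrow> 0"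
  proof (rule L1_limit_squeeze[OF _ _ _ _ L1 klim])
    show "AE x in lebesgue. \<bar>max 0 (A.u' x - B.u' j x)\<bar> \<le> \<bar>K j x - g x\<bar> + k j x" for j
      using A.g_nonpos_outside_E
    proof eventually_elim
      case (elim x)
      then show ?case
        using B.p_nonneg[of x j] by (cases "x \<in> A.E"; cases "x \<in> B.E j") (auto simp: k_def A.u'_def B.u'_def)
    qed
  qed (use int kint in auto)
  then have "(\<lambda>j. 2 * (LINT x|lebesgue. max 0 (A.u' x - B.u' j x))) \<longlonglongrightarrow> 2 * 0"
    by (intro tendsto_mult tendsto_const) simp
  moreover have "(LINT x|lebesgue. \<bar>B.u' j x - A.u' x\<bar>) = 2 * (LINT x|lebesgue. max 0 (A.u' x - B.u' j x))" for j
  proof -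
    have "(LINT x|lebesgue. \<bar>B.u' j x - A.u' x\<bar>) = (LINT x|lebesgue. (B.u' j x - A.u' x) + 2 * max 0 (A.u' x - B.u' j x))"
      by (intro Bochner_Integration.integral_cong refl) (auto simp: max_def)
    also have "\<dots> = (LINT x|lebesgue. B.u' j x) - (LINT x|lebesgue. A.u' x) + 2 * (LINT x|lebesgue. max 0 (A.u' x - B.u' j x))"
      using int by simp
    finally show ?thesis by (simp add: A.integral_u'_eq_0 B.integral_u'_eq_0)
  qed
  ultimately show "(\<lambda>j. LINT x|lebesgue. \<bar>B.u' j x - A.u' x\<bar>) \<longlonglongrightarrow> 0" by simp
qed

subsection \<open>Test functions\<close>

text \<open>A class of functions invariant under \<open>deriv\<close> replaces explicit formulas for
  higher derivatives.\<close>

lemma smooth_coinduct: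
  assumes "S \<phi>" and "\<And>\<psi> x. S \<psi> \<Longrightarrow> \<psi> differentiable (at x)" and "\<And>\<psi>. S \<psi> \<Longrightarrow> S (deriv \<psi>)"
  shows "\<forall>n x. (deriv ^^ n) \<phi> differentiable (at x)"
proof -
  have "S ((deriv ^^ n) \<phi>)" for n by (induction n) (auto intro: assms)
  then show ?thesis using assms(2) by blast
qed

lemma compact_closure_support:
  fixes \<phi> :: "real \<Rightarrow> real"
  assumes "\<And>x. x \<notin> {a..b} \<Longrightarrow> \<phi> x = 0"
  shows "compact (closure {x. \<phi> x \<noteq> 0})"
proof -
  have "{x. \<phi> x \<noteq> 0} \<subseteq> {a..b}" using assms by blast
  then show ?thesis by (metis bounded_closed_interval bounded_subset compact_closure)
qed

lemma test_function_support:
  assumes "test_function \<phi>"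
  obtains R where "R > 0" "\<And>x. \<bar>x\<bar> \<ge> R \<Longrightarrow> \<phi> x = 0" "\<And>x. \<bar>x\<bar> \<ge> R \<Longrightarrow> deriv \<phi> x = 0"
proof -
  have "bounded {x. \<phi> x \<noteq> 0}"
    using assms unfolding test_function_def by (meson bounded_subset closure_subset compact_imp_bounded)
  then obtain R where R: "R > 0" "\<And>x. \<phi> x \<noteq> 0 \<Longrightarrow> \<bar>x\<bar> \<le> R"
    unfolding bounded_pos by auto
  have z: "\<phi> x = 0" if "\<bar>x\<bar> > R" for x using R(2)[of x] that by auto
  have "deriv \<phi> x = 0" if "\<bar>x\<bar> > R" for x
  proof -
    have "open {y. \<bar>y\<bar> > R}" by (intro open_Collect_less continuous_intros)
    then have "(\<phi> has_real_derivative 0) (at x)"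
      using has_field_derivative_transform_within_open[OF DERIV_const[of 0], of "{y. \<bar>y\<bar> > R}" x \<phi>] z that by auto
    then show ?thesis by (rule DERIV_imp_deriv)
  qed
  \<comment> \<open>Vanishing is known for \<open>\<bar>x\<bar> > R\<close>; the shift to
    \<open>R + 1\<close> gives it under the weak inequality.\<close>
  then show ?thesis using that[of "R + 1"] R(1) z by auto
qed

lemma test_function_deriv:
  assumes "test_function \<phi>"
  shows "(\<phi> has_real_derivative deriv \<phi> x) (at x)" "continuous_on S \<phi>" "continuous_on S (deriv \<phi>)"
proof -
  have d: "((deriv ^^ n) \<phi>) differentiable (at x)" for n x using assms by (auto simp: test_function_def)
  show "(\<phi> has_real_derivative deriv \<phi> x) (at x)"
    using d[of 0 x] by (simp add: DERIV_deriv_iff_real_differentiable)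
  show "continuous_on S \<phi>" "continuous_on S (deriv \<phi>)"
    using d[of 0] d[of 1] by (auto intro!: continuous_at_imp_continuous_on differentiable_imp_continuous_within)
qed

lemma smooth_linear_combination:
  fixes f g :: "real \<Rightarrow> real"
  assumes "\<forall>n x. (deriv ^^ n) f differentiable (at x)" "\<forall>n x. (deriv ^^ n) g differentiable (at x)"
  shows "\<forall>n x. (deriv ^^ n) (\<lambda>x. f x - c * g x) differentiable (at x)"
proof -
  let ?s = "\<lambda>f :: real \<Rightarrow> real. \<forall>n x. (deriv ^^ n) f differentiable (at x)"
  have d0: "f differentiable (at x)" if "?s f" for f x using that[rule_format, of 0 x] by simp
  have s': "?s (deriv f)" if "?s f" for f
  proof (intro allI)
    fix n x show "(deriv ^^ n) (deriv f) differentiable (at x)"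
      using that[rule_format, of "Suc n" x] by (simp add: funpow_swap1)
  qed
  show ?thesis
  proof (rule smooth_coinduct[where S = "\<lambda>\<psi>. \<exists>f g. ?s f \<and> ?s g \<and> \<psi> = (\<lambda>x. f x - c * g x)"])
    show "\<exists>f' g'. ?s f' \<and> ?s g' \<and> (\<lambda>x. f x - c * g x) = (\<lambda>x. f' x - c * g' x)"
      using assms by blast
  next
    fix \<psi> :: "real \<Rightarrow> real" and x
    assume "\<exists>f g. ?s f \<and> ?s g \<and> \<psi> = (\<lambda>x. f x - c * g x)"
    then show "\<psi> differentiable (at x)" using d0 by (auto intro!: derivative_intros)
  next
    fix \<psi> :: "real \<Rightarrow> real"
    assume "\<exists>f g. ?s f \<and> ?s g \<and> \<psi> = (\<lambda>x. f x - c * g x)"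
    then obtain f g where fg: "?s f" "?s g" "\<psi> = (\<lambda>x. f x - c * g x)" by blast
    have "deriv \<psi> = (\<lambda>x. deriv f x - c * deriv g x)"
    proof
      fix x
      have "(f has_real_derivative deriv f x) (at x)" "(g has_real_derivative deriv g x) (at x)"
        using d0 fg by (auto simp: DERIV_deriv_iff_real_differentiable)
      then have "(\<psi> has_real_derivative deriv f x - c * deriv g x) (at x)"
        unfolding fg(3) by (auto intro!: derivative_eq_intros)
      then show "deriv \<psi> x = deriv f x - c * deriv g x" by (rule DERIV_imp_deriv)
    qed
    then show "\<exists>f g. ?s f \<and> ?s g \<and> deriv \<psi> = (\<lambda>x. f x - c * g x)"
      using s' fg by blast
  qed
qed

text \<open>This family is closed under differentiation, so its members are smooth.\<close>

definition bump_term :: "real \<Rightarrow> real \<Rightarrow> real \<Rightarrow> real poly \<Rightarrow> nat \<Rightarrow> real \<Rightarrow> real" where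
  "bump_term a b c r k x = (if a < x \<and> x < b
     then poly r x / ((x - a) * (b - x)) ^ k * exp (- c / ((x - a) * (b - x))) else 0)"

text \<open>Serves at the two ends of the support of a bump, where the derivative is found from
  flatness instead of a formula.\<close>

lemma DERIV_0_quadratic:
  fixes f :: "real \<Rightarrow> real"
  assumes "\<And>y. \<bar>y - x\<bar> \<le> 1 \<Longrightarrow> \<bar>f y\<bar> \<le> K * (y - x)\<^sup>2"
  shows "(f has_real_derivative 0) (at x)"
proof -
  have fx: "f x = 0" using assms[of x] by simp
  have "((\<lambda>y. (f y - f x) / (y - x)) \<longlongrightarrow> 0) (at x)"
  proof (rule Lim_null_comparison)
    have "\<forall>\<^sub>F y in at x. \<bar>y - x\<bar> \<le> 1 \<and> y \<noteq> x"
      unfolding eventually_at by (intro exI[of _ 1]) (auto simp: dist_real_def)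
    then show "\<forall>\<^sub>F y in at x. norm ((f y - f x) / (y - x)) \<le> K * \<bar>y - x\<bar>"
    proof eventually_elim
      case (elim y)
      then have "\<bar>f y\<bar> \<le> K * \<bar>y - x\<bar> * \<bar>y - x\<bar>"
        using assms[of y] by (simp add: power2_eq_square mult.assoc abs_mult[symmetric])
      then show ?case using elim fx by (simp add: abs_divide divide_le_eq)
    qed
    show "((\<lambda>y. K * \<bar>y - x\<bar>) \<longlongrightarrow> 0) (at x)"
      by (rule tendsto_eq_intros refl | simp)+
  qed
  then show ?thesis by (simp add: has_field_derivative_iff)
qed

text \<open>The exponent \<open>k + 2\<close> is a common denominator: the exponential contributes
  \<open>c * q' / q\<^sup>2\<close>, the power contributes \<open>1 / q ^ (k + 1)\<close>, and the
  derivative of \<open>P\<close> leaves \<open>1 / q ^ k\<close>.\<close>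

lemma DERIV_div_power_exp:
  fixes P q :: "real \<Rightarrow> real"
  assumes P: "(P has_real_derivative P') (at x)" and q: "(q has_real_derivative q') (at x)" and q0: "q x \<noteq> 0"
  shows "((\<lambda>y. P y / q y ^ k * exp (- c / q y)) has_real_derivative
    (P' * q x ^ 2 - real k * (P x * q' * q x) + c * (P x * q')) / q x ^ (k + 2) * exp (- c / q x)) (at x)"
proof -
  have 1: "((\<lambda>y. - c / q y) has_real_derivative c * q' / q x ^ 2) (at x)"
    using q0 by (auto intro!: derivative_eq_intros q simp: power2_eq_square)
  have 2: "((\<lambda>y. inverse (q y) ^ k) has_real_derivative - real k * q' * q x / q x ^ (k + 2)) (at x)"
  proof (cases k)
    case (Suc m)
    from DERIV_power_Suc[OF DERIV_inverse'[OF q q0], of m]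
    show ?thesis unfolding Suc
      by (rule DERIV_cong) (use q0 in \<open>simp add: field_simps power_inverse\<close>)
  qed simp
  have "((\<lambda>y. P y * inverse (q y) ^ k * exp (- c / q y)) has_real_derivative
     (P' * inverse (q x) ^ k + (- real k * q' * q x / q x ^ (k + 2)) * P x) * exp (- c / q x)
      + (exp (- c / q x) * (c * q' / q x ^ 2)) * (P x * inverse (q x) ^ k)) (at x)"
    by (intro DERIV_mult P 2 DERIV_chain2[OF DERIV_exp 1])
  moreover have "(P' * inverse (q x) ^ k + (- real k * q' * q x / q x ^ (k + 2)) * P x) * exp (- c / q x)
      + (exp (- c / q x) * (c * q' / q x ^ 2)) * (P x * inverse (q x) ^ k) =
     (P' * q x ^ 2 - real k * (P x * q' * q x) + c * (P x * q')) / q x ^ (k + 2) * exp (- c / q x)"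
    using q0 by (simp add: power_inverse power_add divide_simps) (simp add: algebra_simps power2_eq_square power4_eq_xxxx)
  ultimately show ?thesis by (simp add: power_inverse divide_inverse)
qed

lemma quadratic_at_endpoint:
  fixes a b K y :: real
  assumes "a < b" "\<bar>y - x\<bar> \<le> 1" "x = a \<or> x = b"
  shows "K * ((y - a) * (b - y))\<^sup>2 \<le> (\<bar>K\<bar> * (b - a + 1)\<^sup>2) * (y - x)\<^sup>2"
proof -
  have "\<bar>(y - a) * (b - y)\<bar> \<le> (b - a + 1) * \<bar>y - x\<bar>"
    using assms(3)
  proof
    assume "x = a"
    moreover have "\<bar>b - y\<bar> * \<bar>y - a\<bar> \<le> (b - a + 1) * \<bar>y - a\<bar>"
      using assms \<open>x = a\<close> by (intro mult_right_mono) auto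
    ultimately show ?thesis by (simp add: abs_mult mult.commute)
  next
    assume "x = b"
    moreover have "\<bar>y - a\<bar> * \<bar>y - b\<bar> \<le> (b - a + 1) * \<bar>y - b\<bar>"
      using assms \<open>x = b\<close> by (intro mult_right_mono) auto
    ultimately show ?thesis by (simp add: abs_mult abs_minus_commute)
  qed
  then have "\<bar>(y - a) * (b - y)\<bar>\<^sup>2 \<le> ((b - a + 1) * \<bar>y - x\<bar>)\<^sup>2"
    by (intro power_mono) auto
  then have "((y - a) * (b - y))\<^sup>2 \<le> (b - a + 1)\<^sup>2 * (y - x)\<^sup>2"
    by (simp add: power_mult_distrib)
  then have "\<bar>K\<bar> * ((y - a) * (b - y))\<^sup>2 \<le> \<bar>K\<bar> * ((b - a + 1)\<^sup>2 * (y - x)\<^sup>2)"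
    by (intro mult_left_mono) auto
  moreover have "K * ((y - a) * (b - y))\<^sup>2 \<le> \<bar>K\<bar> * ((y - a) * (b - y))\<^sup>2"
    by (intro mult_right_mono) auto
  ultimately show ?thesis by (simp add: mult.assoc)
qed

context
  fixes a b c :: real
  assumes ab: "a < b" and c: "0 < c"
begin

text \<open>With \<open>m = k + 2\<close> and \<open>z = c * t / m\<close>, the bound
  \<open>z ^ m \<le> (1 + z) ^ m \<le> exp (c * t)\<close> makes
  \<open>t ^ m * exp (- c * t)\<close> bounded. The two surplus powers of \<open>t\<close> give the
  factor \<open>1 / t\<^sup>2\<close>, which becomes quadratic flatness when \<open>t\<close> is the
  reciprocal of \<open>(x - a) * (b - x)\<close>.\<close>

lemma power_exp_le:
  assumes t: "0 < t"
  shows "t ^ k * exp (- c * t) \<le> (real (k + 2) / c) ^ (k + 2) / t\<^sup>2"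
proof -
  define m where "m = k + 2"
  define z where "z = c * t / real m"
  have m: "m > 0" by (simp add: m_def)
  have z: "0 < z" "t = (real m / c) * z" using c t m by (auto simp: z_def)
  have "z ^ m \<le> (1 + z) ^ m" using z by (intro power_mono) auto
  also have "\<dots> \<le> exp (c * t)"
    unfolding z_def using c t m by (intro exp_ge_one_plus_x_over_n_power_n) (auto intro: order_trans[of _ 0])
  finally have "z ^ m \<le> exp (c * t)" .
  then have "z ^ m * exp (- c * t) \<le> exp (c * t) * exp (- c * t)"
    by (intro mult_right_mono) auto
  then have le: "z ^ m * exp (- c * t) \<le> 1" by (simp add: exp_add[symmetric])
  have "t ^ k * exp (- c * t) * t\<^sup>2 = t ^ m * exp (- c * t)" by (simp add: m_def power_add power2_eq_square)
  also have "t ^ m = (real m / c) ^ m * z ^ m" by (subst z(2)) (rule power_mult_distrib)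
  also have "(real m / c) ^ m * z ^ m * exp (- c * t) = (real m / c) ^ m * (z ^ m * exp (- c * t))"
    by (rule mult.assoc)
  also have "\<dots> \<le> (real m / c) ^ m * 1"
    using c le by (intro mult_left_mono zero_le_power divide_nonneg_pos) auto
  finally show ?thesis
    using t unfolding m_def by (subst pos_le_divide_eq) auto
qed

lemma bump_term_bound: "\<exists>K. \<forall>x. \<bar>bump_term a b c r k x\<bar> \<le> K * ((x - a) * (b - x))\<^sup>2"
proof -
  have "bounded (poly r ` {a..b})"
    by (intro compact_imp_bounded compact_continuous_image continuous_intros) auto
  then obtain M where M: "M > 0" "\<And>x. x \<in> {a..b} \<Longrightarrow> \<bar>poly r x\<bar> \<le> M"
    unfolding bounded_pos by auto
  let ?N = "(real (k + 2) / c) ^ (k + 2)"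
  have N: "?N \<ge> 0" using c by simp
  have "\<bar>bump_term a b c r k x\<bar> \<le> (M * ?N) * ((x - a) * (b - x))\<^sup>2" for x
  proof (cases "a < x \<and> x < b")
    case True
    define q where "q = (x - a) * (b - x)"
    have q: "q > 0" using True by (simp add: q_def)
    have "\<bar>bump_term a b c r k x\<bar> = \<bar>poly r x\<bar> * ((1 / q) ^ k * exp (- c * (1 / q)))"
      using True q by (simp add: bump_term_def q_def[symmetric] abs_mult abs_divide power_one_over)
    also have "\<dots> \<le> M * (?N / (1 / q)\<^sup>2)"
      using M True q power_exp_le[of "1 / q" k] by (intro mult_mono) auto
    also have "\<dots> = (M * ?N) * q\<^sup>2" by (simp add: power_one_over)
    finally show ?thesis by (simp add: q_def)
  next
    case False
    then have "bump_term a b c r k x = 0" by (auto simp: bump_term_def)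
    moreover have "0 \<le> (M * ?N) * ((x - a) * (b - x))\<^sup>2"
      using M N by (intro mult_nonneg_nonneg zero_le_power2) auto
    ultimately show ?thesis by simp
  qed
  then show ?thesis by blast
qed

text \<open>Here \<open>Q\<close> is \<open>(x - a) * (b - x)\<close> as a polynomial, and
  \<open>r'\<close> is the numerator produced by \<open>DERIV_div_power_exp\<close>. At
  \<open>a\<close> and \<open>b\<close> both sides are 0 by the quadratic bound.\<close>

lemma bump_term_deriv:
  fixes r :: "real poly" and k :: nat
  defines "Q \<equiv> [:- a * b, a + b, -1:]"
  defines "r' \<equiv> pderiv r * Q ^ 2 - smult (real k) (r * pderiv Q * Q) + smult c (r * pderiv Q)"
  shows "(bump_term a b c r k has_real_derivative bump_term a b c r' (k + 2) x) (at x)"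
proof -
  have Q: "poly Q y = (y - a) * (b - y)" for y by (simp add: Q_def algebra_simps)
  obtain K where K: "\<And>x. \<bar>bump_term a b c r k x\<bar> \<le> K * ((x - a) * (b - x))\<^sup>2"
    using bump_term_bound by blast
  consider "a < x \<and> x < b" | "x < a \<or> x > b" | "x = a" | "x = b" by linarith
  then show ?thesis
  proof cases
    case 1
    define q where "q = (x - a) * (b - x)"
    have q: "q > 0" using 1 by (simp add: q_def)
    have dQ: "(poly Q has_real_derivative poly (pderiv Q) x) (at x)" by (rule poly_DERIV)
    have dr: "(poly r has_real_derivative poly (pderiv r) x) (at x)" by (rule poly_DERIV)
    have Qq: "poly Q x = q" by (simp add: Q q_def)
    have "((\<lambda>y. poly r y / poly Q y ^ k * exp (- c / poly Q y)) has_real_derivative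
        poly r' x / q ^ (k + 2) * exp (- c / q)) (at x)"
      using DERIV_div_power_exp[OF dr dQ, of k c] q unfolding Qq r'_def by (simp add: Qq mult.assoc)
    then have "((\<lambda>y. poly r y / poly Q y ^ k * exp (- c / poly Q y)) has_real_derivative
        bump_term a b c r' (k + 2) x) (at x)"
      using 1 by (simp add: bump_term_def q_def)
    then show ?thesis
      by (rule has_field_derivative_transform_within_open[where S = "{a<..<b}"])
         (use 1 in \<open>auto simp: bump_term_def Q\<close>)
  next
    case 2
    have "open ({..<a} \<union> {b<..})" by auto
    then have "(bump_term a b c r k has_real_derivative 0) (at x)"
      using 2 by (intro has_field_derivative_transform_within_open[OF DERIV_const[of 0], of "{..<a} \<union> {b<..}"])
        (auto simp: bump_term_def)
    moreover have "bump_term a b c r' (k + 2) x = 0" using 2 by (auto simp: bump_term_def)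
    ultimately show ?thesis by simp
  next
    case 3
    have "(bump_term a b c r k has_real_derivative 0) (at x)"
    proof (rule DERIV_0_quadratic)
      fix y assume y: "\<bar>y - x\<bar> \<le> 1"
      have "K * ((y - a) * (b - y))\<^sup>2 \<le> (\<bar>K\<bar> * (b - a + 1)\<^sup>2) * (y - x)\<^sup>2"
        using quadratic_at_endpoint[OF ab y] 3 by simp
      then show "\<bar>bump_term a b c r k y\<bar> \<le> (\<bar>K\<bar> * (b - a + 1)\<^sup>2) * (y - x)\<^sup>2" using K[of y] by linarith
    qed
    then show ?thesis using 3 by (simp add: bump_term_def)
  next
    case 4
    have "(bump_term a b c r k has_real_derivative 0) (at x)"
    proof (rule DERIV_0_quadratic)
      fix y assume y: "\<bar>y - x\<bar> \<le> 1"
      have "K * ((y - a) * (b - y))\<^sup>2 \<le> (\<bar>K\<bar> * (b - a + 1)\<^sup>2) * (y - x)\<^sup>2"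
        using quadratic_at_endpoint[OF ab y] 4 by simp
      then show "\<bar>bump_term a b c r k y\<bar> \<le> (\<bar>K\<bar> * (b - a + 1)\<^sup>2) * (y - x)\<^sup>2" using K[of y] by linarith
    qed
    then show ?thesis using 4 by (simp add: bump_term_def)
  qed
qed

lemma test_function_bump_term: "test_function (bump_term a b c r k)"
  unfolding test_function_def
proof (intro conjI)
  show "\<forall>n x. (deriv ^^ n) (bump_term a b c r k) differentiable (at x)"
  proof (rule smooth_coinduct[where S = "\<lambda>\<psi>. \<exists>r k. \<psi> = bump_term a b c r k"])
    fix \<psi> :: "real \<Rightarrow> real" and x
    assume "\<exists>r k. \<psi> = bump_term a b c r k"
    then show "\<psi> differentiable (at x)"
      using bump_term_deriv real_differentiable_def by blast
  next
    fix \<psi> :: "real \<Rightarrow> real"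
    assume "\<exists>r k. \<psi> = bump_term a b c r k"
    then show "\<exists>r k. deriv \<psi> = bump_term a b c r k"
      using bump_term_deriv DERIV_imp_deriv by (metis ext)
  qed blast
  show "compact (closure {x. bump_term a b c r k x \<noteq> 0})"
    by (rule compact_closure_support[of a b]) (auto simp: bump_term_def)
qed

end

text \<open>The parameter \<open>c\<close> controls steepness: as it tends to 0, the bump tends to
  the indicator of the open interval.\<close>

definition bump :: "real \<Rightarrow> real \<Rightarrow> real \<Rightarrow> real \<Rightarrow> real" where
  "bump a b c x = (if a < x \<and> x < b then exp (- c / ((x - a) * (b - x))) else 0)"

lemma test_function_bump:
  assumes "a < b" "0 < c"
  shows "test_function (bump a b c)"
proof -
  have "bump a b c = bump_term a b c 1 0"
    by (auto simp: fun_eq_iff bump_def bump_term_def)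
  then show ?thesis using test_function_bump_term[OF assms] by simp
qed

lemma bump_bounds: "0 < c \<Longrightarrow> 0 \<le> bump a b c x" "0 < c \<Longrightarrow> bump a b c x \<le> indicator {a<..<b} x"
  by (auto simp: bump_def indicator_def)

lemma bump_tendsto_indicator:
  "(\<lambda>n. bump a b (1 / real (Suc n)) x) \<longlonglongrightarrow> indicator {a<..<b} x"
proof (cases "a < x \<and> x < b")
  case True
  have "(\<lambda>n. exp (- (1 / real (Suc n)) / ((x - a) * (b - x)))) \<longlonglongrightarrow> exp (- 0 / ((x - a) * (b - x)))"
    using True LIMSEQ_Suc[OF lim_const_over_n[of "1::real"]] by (intro tendsto_intros) auto
  then show ?thesis using True by (simp add: bump_def indicator_def)
qed (auto simp: bump_def indicator_def)

subsection \<open>Weak derivatives\<close>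

lemma locally_integrable_Icc:
  assumes "locally_integrable h"
  shows "h absolutely_integrable_on {a..b}"
  using assms unfolding locally_integrable_def by blast

lemma integrable_imp_locally_integrable:
  "integrable lebesgue h \<Longrightarrow> locally_integrable h"
  unfolding locally_integrable_def integrable_lebesgue_abs_int
  by (auto intro!: set_integrable_subset[of lebesgue UNIV h] lmeasurable_compact fmeasurableD)

lemma continuous_imp_locally_integrable:
  fixes h :: "real \<Rightarrow> real"
  assumes "continuous_on UNIV h"
  shows "locally_integrable h"
  unfolding locally_integrable_def
proof (intro allI impI)
  fix K :: "real set" assume K: "compact K"
  then obtain a b where ab: "K \<subseteq> {a..b}"
    using bounded_subset_cbox_symmetric[of K] compact_imp_bounded[OF K] by (metis box_real(2))
  have "h absolutely_integrable_on {a..b}"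
    using assms continuous_on_subset by (intro absolutely_integrable_continuous_real) blast
  then show "h absolutely_integrable_on K"
    using K ab by (intro set_integrable_subset[of lebesgue "{a..b}" h K]) (auto intro: lmeasurable_compact fmeasurableD)
qed

lemma locally_integrable_mult_integrable:
  assumes h: "locally_integrable h" and \<phi>: "continuous_on UNIV \<phi>" "\<And>x. \<bar>x\<bar> \<ge> R \<Longrightarrow> \<phi> x = 0"
  shows "integrable lebesgue (\<lambda>x. h x * \<phi> x)"
    and "((\<lambda>x. h x * \<phi> x) has_integral (LINT x|lebesgue. h x * \<phi> x)) {-R..R}"
proof -
  have "bounded (\<phi> ` {-R..R})"
    using \<phi>(1) continuous_on_subset by (intro compact_imp_bounded compact_continuous_image) auto
  moreover have "\<phi> \<in> borel_measurable (lebesgue_on {-R..R})"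
    using \<phi>(1) continuous_on_subset by (intro continuous_imp_measurable_on_sets_lebesgue) auto
  ultimately have *: "(\<lambda>x. \<phi> x * h x) absolutely_integrable_on {-R..R}"
    using locally_integrable_Icc[OF h]
    by (intro absolutely_integrable_bounded_measurable_product_real) auto
  moreover have eq: "(\<lambda>x. indicator {-R..R} x *\<^sub>R (\<phi> x * h x)) = (\<lambda>x. h x * \<phi> x)"
  proof
    fix x show "indicator {-R..R} x *\<^sub>R (\<phi> x * h x) = h x * \<phi> x"
      using \<phi>(2)[of x] by (cases "\<bar>x\<bar> \<ge> R") (auto simp: indicator_def)
  qed
  ultimately show "integrable lebesgue (\<lambda>x. h x * \<phi> x)" by (simp add: set_integrable_def)
  have "((\<lambda>x. \<phi> x * h x) has_integral (LINT x:{-R..R}|lebesgue. \<phi> x * h x)) {-R..R}"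
    by (rule has_integral_set_lebesgue[OF *])
  then have "((\<lambda>x. \<phi> x * h x) has_integral (LINT x|lebesgue. h x * \<phi> x)) {-R..R}"
    unfolding set_lebesgue_integral_def eq .
  then show "((\<lambda>x. h x * \<phi> x) has_integral (LINT x|lebesgue. h x * \<phi> x)) {-R..R}"
    by (simp add: mult.commute)
qed

lemma test_function_mult_integrable:
  assumes h: "locally_integrable h" and \<phi>: "test_function \<phi>"
  shows "integrable lebesgue (\<lambda>x. h x * \<phi> x)" "integrable lebesgue (\<lambda>x. h x * deriv \<phi> x)"
proof -
  obtain R where "\<And>x. \<bar>x\<bar> \<ge> R \<Longrightarrow> \<phi> x = 0" "\<And>x. \<bar>x\<bar> \<ge> R \<Longrightarrow> deriv \<phi> x = 0"
    using test_function_support[OF \<phi>] by metis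
  then show "integrable lebesgue (\<lambda>x. h x * \<phi> x)" "integrable lebesgue (\<lambda>x. h x * deriv \<phi> x)"
    using locally_integrable_mult_integrable(1)[OF h test_function_deriv(2)[OF \<phi>]]
      locally_integrable_mult_integrable(1)[OF h test_function_deriv(3)[OF \<phi>]] by blast+
qed

text \<open>Bumps on a fixed interval tend to its indicator and stay below it, so dominated
  convergence gives \<open>h\<close> integral 0 over every interval. No mollification
  enters.\<close>

lemma fundamental_lemma_bump:
  assumes h: "locally_integrable h"
    and 0: "\<And>a b c. a < b \<Longrightarrow> 0 < c \<Longrightarrow> (LINT x|lebesgue. h x * bump a b c x) = 0"
  shows "AE x in lebesgue. h x = 0"
proof (rule integral_0_imp_AE_0)
  fix a b :: real assume "a \<le> b"
  show "(h has_integral 0) {a..b}"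
  proof (cases "a = b")
    case False
    with \<open>a \<le> b\<close> have ab: "a < b" by simp
    have hi: "h absolutely_integrable_on {a<..<b}"
      using locally_integrable_Icc[OF h, of a b] by (simp add: absolutely_integrable_on_Icc_iff_Ioo)
    have hi': "integrable lebesgue (\<lambda>x. indicator {a<..<b} x *\<^sub>R h x)"
      using hi by (simp add: set_integrable_def)
    have "(\<lambda>n. LINT x|lebesgue. h x * bump a b (1 / real (Suc n)) x) \<longlonglongrightarrow> (LINT x|lebesgue. indicator {a<..<b} x *\<^sub>R h x)"
    proof (rule integral_dominated_convergence[where w = "\<lambda>x. norm (indicator {a<..<b} x *\<^sub>R h x)"])
      show "integrable lebesgue (\<lambda>x. norm (indicator {a<..<b} x *\<^sub>R h x))"
        using hi' by (rule integrable_norm)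
      show "(\<lambda>x. indicator {a<..<b} x *\<^sub>R h x) \<in> borel_measurable lebesgue"
        using hi' by (rule borel_measurable_integrable)
      show "(\<lambda>x. h x * bump a b (1 / real (Suc n)) x) \<in> borel_measurable lebesgue" for n
        by (intro borel_measurable_integrable test_function_mult_integrable h test_function_bump ab) simp
      show "AE x in lebesgue. (\<lambda>n. h x * bump a b (1 / real (Suc n)) x) \<longlonglongrightarrow> indicator {a<..<b} x *\<^sub>R h x"
      proof (rule AE_I2)
        fix x
        have "(\<lambda>n. h x * bump a b (1 / real (Suc n)) x) \<longlonglongrightarrow> h x * indicator {a<..<b} x"
          by (intro tendsto_mult tendsto_const bump_tendsto_indicator)
        then show "(\<lambda>n. h x * bump a b (1 / real (Suc n)) x) \<longlonglongrightarrow> indicator {a<..<b} x *\<^sub>R h x"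
          by (simp add: mult.commute)
      qed
      show "AE x in lebesgue. norm (h x * bump a b (1 / real (Suc n)) x) \<le> norm (indicator {a<..<b} x *\<^sub>R h x)" for n
      proof (rule AE_I2)
        fix x
        have "\<bar>h x\<bar> * bump a b (1 / real (Suc n)) x \<le> \<bar>h x\<bar> * indicator {a<..<b} x"
          by (intro mult_left_mono bump_bounds) auto
        then show "norm (h x * bump a b (1 / real (Suc n)) x) \<le> norm (indicator {a<..<b} x *\<^sub>R h x)"
          using bump_bounds(1)[of "1 / real (Suc n)" a b x] by (simp add: abs_mult mult.commute)
      qed
    qed
    then have "(LINT x|lebesgue. indicator {a<..<b} x *\<^sub>R h x) = 0"
      using 0[OF ab] by (simp add: LIMSEQ_const_iff)
    then have "(h has_integral 0) {a<..<b}"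
      using has_integral_set_lebesgue[OF hi] by (simp add: set_lebesgue_integral_def)
    then show ?thesis by (simp add: has_integral_Icc_iff_Ioo)
  qed (use has_integral_refl in auto)
qed

lemma has_weak_derivative_unique:
  assumes "has_weak_derivative f g1" "has_weak_derivative f g2"
  shows "AE x in lebesgue. g1 x = g2 x"
proof -
  have g: "locally_integrable g1" "locally_integrable g2"
    using assms by (auto simp: has_weak_derivative_def)
  have "locally_integrable (\<lambda>x. g1 x - g2 x)"
    using g unfolding locally_integrable_def by (auto intro: set_integral_diff)
  moreover have "(LINT x|lebesgue. (g1 x - g2 x) * bump a b c x) = 0" if "a < b" "0 < c" for a b c
  proof -
    note t = test_function_bump[OF that]
    have "(LINT x|lebesgue. g1 x * bump a b c x) = (LINT x|lebesgue. g2 x * bump a b c x)"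
      using assms t by (auto simp: has_weak_derivative_def)
    then show ?thesis
      using test_function_mult_integrable(1)[OF g(1) t] test_function_mult_integrable(1)[OF g(2) t]
      by (simp add: left_diff_distrib)
  qed
  ultimately have "AE x in lebesgue. g1 x - g2 x = 0"
    by (rule fundamental_lemma_bump)
  then show ?thesis by simp
qed

text \<open>The antiderivative that vanishes to the left of the support of \<zeta> is constant to
  the right of it, and mean zero makes this constant 0.\<close>

lemma test_function_antiderivative:
  assumes \<zeta>: "test_function \<zeta>" and 0: "(LINT x|lebesgue. \<zeta> x) = 0"
  obtains \<phi> where "test_function \<phi>" "deriv \<phi> = \<zeta>"
proof -
  obtain R where R: "R > 0" "\<And>x. \<bar>x\<bar> \<ge> R \<Longrightarrow> \<zeta> x = 0"
    using test_function_support[OF \<zeta>] by metis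
  have cont: "isCont \<zeta> x" for x
    using test_function_deriv(2)[OF \<zeta>, of UNIV] continuous_on_eq_continuous_at[OF open_UNIV] by blast
  have "\<exists>F. \<forall>x::real. (-\<infinity>::ereal) < x \<longrightarrow> x < (\<infinity>::ereal) \<longrightarrow> (F has_vector_derivative \<zeta> x) (at x)"
    by (intro einterval_antiderivative) (auto simp: cont)
  then obtain F where F: "\<And>x. (F has_real_derivative \<zeta> x) (at x)"
    by (auto simp: has_real_derivative_iff_has_vector_derivative)
  define \<phi> where "\<phi> x = F x - F (- R)" for x
  have d: "(\<phi> has_real_derivative \<zeta> x) (at x)" for x
    unfolding \<phi>_def using F[of x] by (auto intro!: derivative_eq_intros)
  have dphi: "deriv \<phi> = \<zeta>" using d DERIV_imp_deriv by blast
  have ftc: "(\<zeta> has_integral F y - F x) {x..y}" if "x \<le> y" for x y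
    using that F by (intro fundamental_theorem_of_calculus)
      (auto simp: has_real_derivative_iff_has_vector_derivative intro: has_vector_derivative_at_within)
  have zero: "(\<zeta> has_integral 0) {x..y}" if "\<And>z. z \<in> {x..y} \<Longrightarrow> \<bar>z\<bar> \<ge> R" for x y
    using that R(2) by (intro has_integral_is_0) auto
  have left: "\<phi> x = 0" if "x \<le> - R" for x
    using has_integral_unique[OF ftc[OF that] zero] that by (force simp: \<phi>_def)
  have "locally_integrable (\<lambda>x. 1)" by (rule continuous_imp_locally_integrable) auto
  from locally_integrable_mult_integrable(2)[OF this test_function_deriv(2)[OF \<zeta>] R(2)]
  have "(\<zeta> has_integral 0) {-R..R}" using 0 by simp
  with ftc[of "-R" R] R(1) have "F R = F (-R)" by (auto dest: has_integral_unique)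
  moreover have "F x = F R" if "R \<le> x" for x
    using has_integral_unique[OF ftc[OF that] zero] that R(1) by force
  ultimately have right: "\<phi> x = 0" if "R \<le> x" for x using that by (metis \<phi>_def diff_self)
  have "test_function \<phi>"
    unfolding test_function_def
  proof (intro conjI allI)
    fix n x show "(deriv ^^ n) \<phi> differentiable (at x)"
    proof (cases n)
      case 0
      then show ?thesis using d real_differentiable_def by auto
    next
      case (Suc m)
      then show ?thesis using \<zeta> dphi by (simp add: funpow_swap1 test_function_def)
    qed
    show "compact (closure {x. \<phi> x \<noteq> 0})"
      by (rule compact_closure_support[of "-R" R]) (use left right in force)
  qed
  then show ?thesis using that dphi by blast
qed

text \<open>The argument of du Bois-Reymond: subtracting a multiple of one fixed bump from another
  gives mean zero, hence the derivative of a test function. So the integral of \<open>h\<close>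
  against any bump is \<open>C\<close> times the integral of that bump, where \<open>C\<close> is
  the weighted mean of \<open>h\<close> against the fixed one.\<close>

lemma AE_const_if_weak_derivative_0:
  assumes h: "locally_integrable h"
    and 0: "\<And>\<phi>. test_function \<phi> \<Longrightarrow> (LINT x|lebesgue. h x * deriv \<phi> x) = 0"
  obtains C where "AE x in lebesgue. h x = C"
proof -
  let ?\<eta> = "bump 0 1 1"
  have t0: "test_function ?\<eta>" by (rule test_function_bump) auto
  have one: "locally_integrable (\<lambda>x. 1)" by (rule continuous_imp_locally_integrable) auto
  have int1: "integrable lebesgue \<phi>" if "test_function \<phi>" for \<phi>
    using test_function_mult_integrable(1)[OF one that] by simp
  define I where "I = (LINT x|lebesgue. ?\<eta> x)"
  have "I \<noteq> 0"
  proof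
    assume "I = 0"
    then have "AE x in lebesgue. ?\<eta> x = 0"
      using integral_nonneg_eq_0_iff_AE[OF int1[OF t0]] bump_bounds(1)[of 1] by (simp add: I_def)
    then have "AE x in lebesgue. x \<notin> {0<..<1::real}"
      by eventually_elim (auto simp: bump_def)
    then have "{0<..<1::real} \<in> null_sets lebesgue"
      by (subst (asm) AE_iff_null_sets[symmetric]) auto
    then show False
      using negligible_iff_null_sets[of "{0<..<1::real}"] open_not_negligible[of "{0<..<1::real}"] by auto
  qed
  define C where "C = (LINT x|lebesgue. h x * ?\<eta> x) / I"
  have loc: "locally_integrable (\<lambda>x. h x - C)"
    using h continuous_imp_locally_integrable[of "\<lambda>_. C"] unfolding locally_integrable_def
    by (auto intro!: set_integral_diff)
  have "(LINT x|lebesgue. (h x - C) * bump a b c x) = 0" if "a < b" "0 < c" for a b c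
  proof -
    let ?\<psi> = "bump a b c"
    have t: "test_function ?\<psi>" by (rule test_function_bump[OF that])
    define k where "k = (LINT x|lebesgue. ?\<psi> x) / I"
    define \<zeta> where "\<zeta> = (\<lambda>x. ?\<psi> x - k * ?\<eta> x)"
    have "test_function \<zeta>"
      unfolding test_function_def
    proof (intro conjI)
      show "\<forall>n x. (deriv ^^ n) \<zeta> differentiable at x"
        unfolding \<zeta>_def using t t0 by (intro smooth_linear_combination) (auto simp: test_function_def)
      show "compact (closure {x. \<zeta> x \<noteq> 0})"
        by (rule compact_closure_support[of "min a 0" "max b 1"]) (auto simp: \<zeta>_def bump_def)
    qed
    moreover have "(LINT x|lebesgue. \<zeta> x) = 0"
      unfolding \<zeta>_def using int1[OF t] int1[OF t0] \<open>I \<noteq> 0\<close> by (simp add: I_def[symmetric] k_def)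
    ultimately obtain \<phi> where \<phi>: "test_function \<phi>" "deriv \<phi> = \<zeta>"
      by (rule test_function_antiderivative)
    have i: "integrable lebesgue (\<lambda>x. h x * ?\<psi> x)" "integrable lebesgue (\<lambda>x. h x * ?\<eta> x)"
      by (intro test_function_mult_integrable h t t0)+
    have "(LINT x|lebesgue. h x * \<zeta> x) = (LINT x|lebesgue. h x * ?\<psi> x - k * (h x * ?\<eta> x))"
      by (intro Bochner_Integration.integral_cong) (auto simp: \<zeta>_def algebra_simps)
    also have "\<dots> = (LINT x|lebesgue. h x * ?\<psi> x) - k * (LINT x|lebesgue. h x * ?\<eta> x)"
      using i by simp
    finally have "(LINT x|lebesgue. h x * ?\<psi> x) = k * (LINT x|lebesgue. h x * ?\<eta> x)"
      using 0[OF \<phi>(1)] \<phi>(2) by simp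
    moreover have "(LINT x|lebesgue. (h x - C) * ?\<psi> x) = (LINT x|lebesgue. h x * ?\<psi> x) - C * (LINT x|lebesgue. ?\<psi> x)"
      using i int1[OF t] by (simp add: left_diff_distrib)
    ultimately show ?thesis using \<open>I \<noteq> 0\<close> by (simp add: C_def k_def)
  qed
  from fundamental_lemma_bump[OF loc this] have "AE x in lebesgue. h x = C" by simp
  then show ?thesis by (rule that)
qed

text \<open>The product rule holds only almost everywhere for \<open>f * \<phi>\<close>, which is
  not enough to integrate it. Instead \<open>D\<close>, the error in the integrated product rule, is
  shown to have derivative 0 at every interior point, by a bound of first order in the length times
  the variation of \<open>f\<close>.\<close>

lemma primitive_by_parts:
  assumes f: "primitive f g" and \<phi>: "test_function \<phi>"
  shows "(LINT x|lebesgue. f x * deriv \<phi> x) = - (LINT x|lebesgue. g x * \<phi> x)"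
proof -
  note d\<phi> = test_function_deriv(1)[OF \<phi>]
  note fc = primitive_continuous_on[OF f]
  have g: "integrable lebesgue g" by (rule primitive_integrable[OF f])
  obtain R where R: "R > 0" "\<And>x. \<bar>x\<bar> \<ge> R \<Longrightarrow> \<phi> x = 0" "\<And>x. \<bar>x\<bar> \<ge> R \<Longrightarrow> deriv \<phi> x = 0"
    using test_function_support[OF \<phi>] by metis
  have "bounded (deriv \<phi> ` {-R..R})"
    by (intro compact_imp_bounded compact_continuous_image test_function_deriv(3)[OF \<phi>]) auto
  then obtain B where B: "B > 0" "\<And>x. x \<in> {-R..R} \<Longrightarrow> \<bar>deriv \<phi> x\<bar> \<le> B"
    unfolding bounded_pos by auto
  define k where "k t = g t * \<phi> t + f t * deriv \<phi> t" for t
  have k: "(k has_integral (LINT x|lebesgue. g x * \<phi> x) + (LINT x|lebesgue. f x * deriv \<phi> x)) {-R..R}"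
    unfolding k_def
    by (intro has_integral_add locally_integrable_mult_integrable(2) test_function_deriv[OF \<phi>] R
      integrable_imp_locally_integrable g continuous_imp_locally_integrable fc)
  then have ki: "k integrable_on {-R..R}" by blast
  define D where "D y = f y * \<phi> y - integral {-R..y} k" for y
  define P where "P y = integral {-R..y} (\<lambda>t. \<bar>g t\<bar>)" for y
  have gi: "(\<lambda>t. \<bar>g t\<bar>) integrable_on {a..b}" for a b
    using integrable_lebesgue_Icc(2)[of "\<lambda>t. \<bar>g t\<bar>"] g by simp
  have Pc: "continuous_on {-R..R} P"
    unfolding P_def by (rule indefinite_integral_continuous_1[OF gi])
  have Pd: "integral {x..y} (\<lambda>t. \<bar>g t\<bar>) = P y - P x" if "-R \<le> x" "x \<le> y" for x y
    using Henstock_Kurzweil_Integration.integral_combine[of "-R" x y "\<lambda>t. \<bar>g t\<bar>"] gi that by (simp add: P_def)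
  have fP: "\<bar>f t - f x\<bar> \<le> P y - P x" if "-R \<le> x" "x \<le> t" "t \<le> y" for x t y
  proof -
    have "\<bar>integral {x..t} g\<bar> \<le> integral {x..t} (\<lambda>t. \<bar>g t\<bar>)"
      using integral_norm_bound_integral[of g "{x..t}" "\<lambda>t. \<bar>g t\<bar>"] integrable_lebesgue_Icc(2)[OF g] gi by simp
    also have "\<dots> \<le> integral {x..y} (\<lambda>t. \<bar>g t\<bar>)"
      using that gi by (intro integral_subset_le) auto
    finally show ?thesis
      using that Pd integral_unique[OF primitive_has_integral[OF f, of x t]] by simp
  qed
  \<comment> \<open>Since \<open>P\<close> is continuous, this bound makes the derivative of \<open>D\<close> vanish.\<close>
  have Dd: "\<bar>D y - D x\<bar> \<le> 2 * B * (y - x) * (P y - P x)" if xy: "-R \<le> x" "x \<le> y" "y \<le> R" for x y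
  proof -
    have ftc: "(deriv \<phi> has_integral \<phi> y - \<phi> x) {x..y}"
      using xy d\<phi> by (intro fundamental_theorem_of_calculus)
        (auto simp: has_real_derivative_iff_has_vector_derivative intro: has_vector_derivative_at_within)
    have kxy: "k integrable_on {x..y}"
      by (rule integrable_on_subinterval[OF ki]) (use xy in auto)
    have kD: "integral {x..y} k = integral {-R..y} k - integral {-R..x} k"
      using Henstock_Kurzweil_Integration.integral_combine[of "-R" x y k] integrable_on_subinterval[OF ki, of "-R" y] xy by auto
    \<comment> \<open>Splitting the increment of \<open>f * \<phi>\<close> as
      \<open>(f y - f x) * \<phi> y + f x * (\<phi> y - \<phi> x)\<close> leaves, after subtraction
      of \<open>k\<close>, only differences of \<phi> and of \<open>f\<close> over
      \<open>{x..y}\<close>. Each of the two contributes one \<open>B\<close> to the constant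
      \<open>2 * B\<close>.\<close>
    let ?F = "\<lambda>t. (g t * \<phi> y + f x * deriv \<phi> t) - k t"
    have F: "(?F has_integral ((f y - f x) * \<phi> y + f x * (\<phi> y - \<phi> x)) - integral {x..y} k) {x..y}"
      using kxy xy
      by (intro has_integral_diff has_integral_add has_integral_mult_left has_integral_mult_right
        primitive_has_integral[OF f] ftc integrable_integral)
    have gP: "((\<lambda>t. \<bar>g t\<bar>) has_integral P y - P x) {x..y}"
      using integrable_integral[OF gi[of x y]] Pd[of x y] xy by simp
    have "((\<lambda>t. (P y - P x) * B) has_integral (P y - P x) * B * (y - x)) {x..y}"
      using xy has_integral_const_real[of "(P y - P x) * B" x y] by (simp add: mult.commute)
    from has_integral_add[OF has_integral_mult_left[OF gP] this]
    have H: "((\<lambda>t. \<bar>g t\<bar> * (B * (y - x)) + (P y - P x) * B) has_integral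
       (P y - P x) * (B * (y - x)) + (P y - P x) * B * (y - x)) {x..y}"
      .
    have "norm (integral {x..y} ?F) \<le> integral {x..y} (\<lambda>t. \<bar>g t\<bar> * (B * (y - x)) + (P y - P x) * B)"
    proof (rule integral_norm_bound_integral)
      show "?F integrable_on {x..y}" using F by blast
      show "(\<lambda>t. \<bar>g t\<bar> * (B * (y - x)) + (P y - P x) * B) integrable_on {x..y}" using H by blast
      fix t assume t: "t \<in> {x..y}"
      have "\<bar>\<phi> y - \<phi> t\<bar> \<le> B * (y - x)"
      proof (cases "t < y")
        case True
        then obtain z where z: "t < z" "z < y" "\<phi> y - \<phi> t = (y - t) * deriv \<phi> z"
          using MVT2[of t y \<phi> "deriv \<phi>"] d\<phi> by blast
        have "\<bar>\<phi> y - \<phi> t\<bar> = (y - t) * \<bar>deriv \<phi> z\<bar>" using z True by (simp add: abs_mult)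
        also have "\<dots> \<le> (y - x) * B"
          using z t xy by (intro mult_mono B(2)) auto
        finally show ?thesis by (simp add: mult.commute)
      qed (use t B in auto)
      then have "\<bar>g t * (\<phi> y - \<phi> t)\<bar> \<le> \<bar>g t\<bar> * (B * (y - x))"
        by (simp add: abs_mult mult_left_mono)
      moreover have "\<bar>(f x - f t) * deriv \<phi> t\<bar> \<le> (P y - P x) * B"
        unfolding abs_mult using fP[of x t y] t xy B(2)[of t] abs_ge_zero[of "f t - f x"]
        by (intro mult_mono) (auto simp: abs_minus_commute)
      moreover have "?F t = g t * (\<phi> y - \<phi> t) + (f x - f t) * deriv \<phi> t"
        by (simp add: k_def algebra_simps)
      ultimately show "norm (?F t) \<le> \<bar>g t\<bar> * (B * (y - x)) + (P y - P x) * B" by simp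
    qed
    also have "integral {x..y} ?F = D y - D x"
      using integral_unique[OF F] kD by (simp add: D_def algebra_simps)
    finally show ?thesis using integral_unique[OF H] by (simp add: algebra_simps)
  qed
  have "D R = D (-R)"
  proof (rule DERIV_isconst_end[of "-R" R D])
    show "-R < R" using R by simp
    show "continuous_on {-R..R} D"
      unfolding D_def by (intro continuous_intros fc test_function_deriv[OF \<phi>] indefinite_integral_continuous_1 ki)
    fix z assume z: "-R < z" "z < R"
    have "((\<lambda>y. (D y - D z) / (y - z)) \<longlongrightarrow> 0) (at z)"
    proof (rule Lim_null_comparison)
      have "\<forall>\<^sub>F y in at z. y \<in> {-R<..<R} \<and> y \<noteq> z"
        using z eventually_at_in_open'[of "{-R<..<R}" z] by (auto simp: eventually_conj_iff eventually_neq_at_within)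
      then show "\<forall>\<^sub>F y in at z. norm ((D y - D z) / (y - z)) \<le> 2 * B * \<bar>P y - P z\<bar>"
      proof eventually_elim
        case (elim y)
        have "\<bar>D y - D z\<bar> \<le> 2 * B * \<bar>P y - P z\<bar> * \<bar>y - z\<bar>"
        proof (cases "z \<le> y")
          case True
          then have "\<bar>D y - D z\<bar> \<le> 2 * B * (y - z) * (P y - P z)" using elim z by (intro Dd) auto
          also have "\<dots> \<le> 2 * B * (y - z) * \<bar>P y - P z\<bar>" using True B by (intro mult_left_mono) auto
          also have "\<dots> = 2 * B * \<bar>P y - P z\<bar> * \<bar>y - z\<bar>" using True by (simp add: algebra_simps)
          finally show ?thesis .
        next
          case False
          then have "\<bar>D z - D y\<bar> \<le> 2 * B * (z - y) * (P z - P y)" using elim z by (intro Dd) auto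
          also have "\<dots> \<le> 2 * B * (z - y) * \<bar>P y - P z\<bar>" using False B by (intro mult_left_mono) auto
          also have "\<dots> = 2 * B * \<bar>P y - P z\<bar> * \<bar>y - z\<bar>" using False by (simp add: algebra_simps)
          finally show ?thesis by (simp only: abs_minus_commute)
        qed
        then show ?case using elim by (simp add: abs_divide divide_le_eq)
      qed
      have "isCont P z" using continuous_on_interior[OF Pc] z by auto
      then have "(P \<longlongrightarrow> P z) (at z)" by (simp add: isCont_def)
      then have "((\<lambda>y. 2 * B * \<bar>P y - P z\<bar>) \<longlongrightarrow> 2 * B * \<bar>P z - P z\<bar>) (at z)"
        by (intro tendsto_intros)
      then show "((\<lambda>y. 2 * B * \<bar>P y - P z\<bar>) \<longlongrightarrow> 0) (at z)" by simp
    qed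
    then show "(D has_real_derivative 0) (at z)" by (simp add: has_field_derivative_iff)
  qed
  moreover have "D (-R) = 0" "D R = - integral {-R..R} k" using R by (auto simp: D_def)
  ultimately have "integral {-R..R} k = 0" by simp
  then show ?thesis using integral_unique[OF k] by simp
qed

lemma primitive_has_weak_derivative:
  assumes "primitive f g"
  shows "has_weak_derivative f g"
  unfolding has_weak_derivative_def
  using assms by (intro conjI allI impI primitive_by_parts integrable_imp_locally_integrable
    continuous_imp_locally_integrable primitive_continuous_on primitive_integrable)

lemma has_weak_derivative_cong_AE:
  assumes w: "has_weak_derivative f' g" and ae: "AE x in lebesgue. f x = f' x"
  shows "has_weak_derivative f g"
proof -
  have f': "locally_integrable f'" and g: "locally_integrable g" using w by (auto simp: has_weak_derivative_def)
  have neg: "negligible {x. f x \<noteq> f' x}"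
    using ae by (auto simp: negligible_iff_null_sets AE_iff_null_sets completion.AE_iff_null_sets)
  have f: "locally_integrable f"
    unfolding locally_integrable_def
  proof (intro allI impI)
    fix K :: "real set" assume "compact K"
    then have "f' absolutely_integrable_on K" using f' by (simp add: locally_integrable_def)
    then show "f absolutely_integrable_on K"
      by (rule absolutely_integrable_spike[OF _ neg]) auto
  qed
  have "(LINT x|lebesgue. f x * deriv \<phi> x) = (LINT x|lebesgue. f' x * deriv \<phi> x)" if "test_function \<phi>" for \<phi>
    using ae f f' that
    by (intro integral_cong_AE borel_measurable_integrable test_function_mult_integrable) auto
  then show ?thesis using w f g by (simp add: has_weak_derivative_def)
qed

lemma weak_derivative_AE_eq:
  assumes "has_weak_derivative f g"
  shows "AE x in lebesgue. weak_derivative f x = g x"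
  using has_weak_derivative_unique[OF _ assms, of "weak_derivative f"] assms
  unfolding weak_derivative_def by (metis someI)

lemma primitive_exists:
  assumes g: "integrable lebesgue g"
  obtains w where "primitive w g"
proof -
  note gi = integrable_lebesgue_Icc(2)[OF g]
  define w where "w x = (if 0 \<le> x then integral {0..x} g else - integral {x..0} g)" for x
  have "integral {a..b} g = w b - w a" if "a \<le> b" for a b
    using Henstock_Kurzweil_Integration.integral_combine[of 0 a b g] Henstock_Kurzweil_Integration.integral_combine[of a 0 b g]
      Henstock_Kurzweil_Integration.integral_combine[of a b 0 g] gi that
    by (cases "0 \<le> a"; cases "0 \<le> b") (auto simp: w_def)
  then have "primitive w g"
    unfolding primitive_def using g gi by (metis integrable_integral)
  then show ?thesis by (rule that)
qed

text \<open>A primitive \<open>w\<close> of the weak derivative \<open>g\<close> differs from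
  \<open>f\<close> by a function with weak derivative 0, hence by a constant almost everywhere. The
  name \<open>f'\<close> denotes the absolutely continuous representative; the derivative is
  \<open>g\<close>.\<close>

lemma W11_primitive:
  assumes "f \<in> W11"
  obtains f' g where "primitive f' g" "integrable lebesgue f'" "AE x in lebesgue. f x = f' x"
proof -
  obtain g where fi: "integrable lebesgue f" and g: "has_weak_derivative f g" "integrable lebesgue g"
    using assms by (auto simp: W11_def)
  obtain w where w: "primitive w g" using primitive_exists[OF g(2)] by blast
  note ww = primitive_has_weak_derivative[OF w]
  have l: "locally_integrable f" "locally_integrable w" using g ww by (auto simp: has_weak_derivative_def)
  have "locally_integrable (\<lambda>x. f x - w x)"
    using l unfolding locally_integrable_def by (auto intro: set_integral_diff)
  moreover have "(LINT x|lebesgue. (f x - w x) * deriv \<phi> x) = 0" if "test_function \<phi>" for \<phi>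
    using test_function_mult_integrable(2)[OF l(1) that] test_function_mult_integrable(2)[OF l(2) that] g ww that
    by (simp add: left_diff_distrib has_weak_derivative_def)
  ultimately obtain C where C: "AE x in lebesgue. f x - w x = C"
    by (rule AE_const_if_weak_derivative_0)
  define f' where "f' x = w x + C" for x
  have f': "primitive f' g" using w by (simp add: primitive_def f'_def)
  have ae: "AE x in lebesgue. f x = f' x" using C by eventually_elim (auto simp: f'_def)
  have "integrable lebesgue f'"
    using fi ae primitive_measurable[OF f'] by (rule_tac integrable_cong_AE_imp) auto
  then show ?thesis using that f' ae by blast
qed

lemma L1_norm_AE_eq:
  assumes "AE x in lebesgue. h x = h' x" "integrable lebesgue h'"
  shows "L1_norm h = ennreal (LINT x|lebesgue. \<bar>h' x\<bar>)"
proof -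
  have "L1_norm h = (\<integral>\<^sup>+x. ennreal \<bar>h' x\<bar> \<partial>lebesgue)"
    unfolding L1_norm_def using assms(1) by (intro nn_integral_cong_AE) auto
  also have "\<dots> = ennreal (LINT x|lebesgue. \<bar>h' x\<bar>)"
    using assms(2) by (intro nn_integral_eq_integral) auto
  finally show ?thesis .
qed

section \<open>Reduction of the uncentered maximal function to one-sided ones\<close>

lemma uncentered_maximal_cong_AE:
  assumes "AE x in lebesgue. \<bar>f x\<bar> = \<bar>f' x\<bar>"
  shows "uncentered_maximal f = uncentered_maximal f'"
proof -
  have "(\<integral>\<^sup>+y\<in>{a<..<b}. ennreal \<bar>f y\<bar> \<partial>lebesgue) = (\<integral>\<^sup>+y\<in>{a<..<b}. ennreal \<bar>f' y\<bar> \<partial>lebesgue)" for a b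
    using assms by (intro nn_integral_cong_AE) auto
  then show ?thesis by (simp add: uncentered_maximal_def fun_eq_iff)
qed

lemma (in nonneg_sobolev) nonneg_sobolev_reflect: "nonneg_sobolev (\<lambda>x. f (- x)) (\<lambda>x. - g (- x))"
  by unfold_locales (auto intro: primitive_reflect[OF prim] integrable_lebesgue_reflect[OF int] nonneg)

text \<open>An average over an interval around \<open>x\<close> is a convex combination of the
  averages on its two sides, so it is at most the larger one-sided supremum. Conversely, a one-sided
  average is a limit of averages over slightly enlarged intervals. The left maximal function is the
  right one of the reflected function at \<open>- x\<close>.\<close>

lemma (in nonneg_sobolev) uncentered_maximal_eq:
  "uncentered_maximal f x = max (right_maximal f x) (right_maximal (\<lambda>y. f (- y)) (- x))"
proof -
  interpret R: nonneg_sobolev "\<lambda>y. f (- y)" "\<lambda>y. - g (- y)" by (rule nonneg_sobolev_reflect)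
  let ?S = "SUP (a, b)\<in>{(a, b). a < x \<and> x < b}. (\<integral>\<^sup>+ y \<in> {a<..<b}. ennreal \<bar>f y\<bar> \<partial>lebesgue) / ennreal (b - a)"
  define m where "m = max (u x) (R.u (- x))"
  have m: "0 \<le> m" using u_nonneg[of x] by (simp add: m_def)
  have avg: "(\<integral>\<^sup>+ y \<in> {a<..<b}. ennreal \<bar>f y\<bar> \<partial>lebesgue) / ennreal (b - a) = ennreal ((G b - G a) / (b - a))" if "a < b" for a b
  proof -
    have "(f has_integral G b - G a) {a<..<b}"
      using G_integral[of a b] that by (simp add: has_integral_Icc_iff_Ioo)
    then have "(\<integral>\<^sup>+ y \<in> {a<..<b}. ennreal (f y) \<partial>lebesgue) = ennreal (G b - G a)"
      unfolding nn_integral_completion using nonneg by (intro nn_integral_has_integral_lebesgue') auto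
    then show ?thesis using nonneg that G_mono[of a b] by (simp add: divide_ennreal)
  qed
  have left: "G x - G a \<le> R.u (- x) * (x - a)" if "a < x" for a
  proof -
    have "((\<lambda>y. f (- y)) has_integral G x - G a) {-x..-a}"
      using G_integral[of a x] that by simp
    then have "right_average (\<lambda>y. f (- y)) (- x) (- a) = (G x - G a) / (x - a)"
      by (simp add: right_average_def integral_unique)
    then show ?thesis using R.average_le_u[of "-x" "-a"] that by (simp add: divide_le_eq)
  qed
  have up: "(G b - G a) / (b - a) \<le> m" if "a < x" "x < b" for a b
  proof -
    have "G b - G a \<le> u x * (b - x) + R.u (- x) * (x - a)"
      using G_le[of x b] left[of a] that by simp
    also have "\<dots> \<le> m * (b - x) + m * (x - a)"
      using that by (intro add_mono mult_right_mono) (auto simp: m_def)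
    finally show ?thesis using that by (simp add: divide_le_eq algebra_simps)
  qed
  have S_le: "?S \<le> ennreal m"
    using up by (intro SUP_least) (auto simp: avg intro!: ennreal_leI)
  define r where "r = enn2real ?S"
  have Sr: "?S = ennreal r"
    unfolding r_def by (rule ennreal_enn2real[symmetric]) (rule le_less_trans[OF S_le ennreal_less_top])
  have r: "0 \<le> r" by (simp add: r_def)
  have le_r: "(G b - G a) / (b - a) \<le> r" if "a < x" "x < b" for a b
  proof -
    have "ennreal ((G b - G a) / (b - a)) \<le> ?S"
      using that by (intro SUP_upper2[of "(a, b)"]) (auto simp: avg)
    then show ?thesis unfolding Sr using r by (simp add: ennreal_le_iff)
  qed
  have h: "(\<lambda>n. 1 / real (Suc n)) \<longlonglongrightarrow> 0" using LIMSEQ_Suc[OF lim_const_over_n[of "1::real"]] by simp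
  have cG: "isCont G z" for z using G_deriv DERIV_isCont by blast
  have "u x \<le> r"
  proof (rule u_least)
    fix t assume t: "x < t"
    \<comment> \<open>The intervals in the supremum are open and contain \<open>x\<close>, so the
      interval from \<open>x\<close> to \<open>t\<close> is first extended to the left.\<close>
    have a: "(\<lambda>n. x - 1 / real (Suc n)) \<longlonglongrightarrow> x" using tendsto_diff[OF tendsto_const h, of x] by simp
    have "(\<lambda>n. (G t - G (x - 1 / real (Suc n))) / (t - (x - 1 / real (Suc n)))) \<longlonglongrightarrow> (G t - G x) / (t - x)"
      using t by (intro tendsto_intros isCont_tendsto_compose[OF cG] a) auto
    then have "(G t - G x) / (t - x) \<le> r"
      by (rule LIMSEQ_le_const2) (use le_r t in auto)
    then show "right_average f x t \<le> r" using t by (simp add: average_eq)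
  qed
  moreover have "R.u (- x) \<le> r"
  proof (rule R.u_least)
    fix t assume t: "- x < t"
    have a: "(\<lambda>n. x + 1 / real (Suc n)) \<longlonglongrightarrow> x" using tendsto_add[OF tendsto_const h, of x] by simp
    have "(\<lambda>n. (G (x + 1 / real (Suc n)) - G (- t)) / ((x + 1 / real (Suc n)) - - t)) \<longlonglongrightarrow> (G x - G (- t)) / (x - - t)"
      using t by (intro tendsto_intros isCont_tendsto_compose[OF cG] a) auto
    then have "(G x - G (- t)) / (x - - t) \<le> r"
      by (rule LIMSEQ_le_const2) (use le_r[of "-t"] t in auto)
    moreover have "((\<lambda>y. f (- y)) has_integral G x - G (- t)) {-x..t}"
      using G_integral[of "-t" x] t has_integral_reflect_real[of f "G x - G (- t)" x "-t"] by simp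
    ultimately show "right_average (\<lambda>y. f (- y)) (- x) t \<le> r"
      by (simp add: right_average_def integral_unique add.commute)
  qed
  ultimately have "m \<le> r" by (simp add: m_def)
  moreover have "r \<le> m" using S_le m unfolding Sr by (simp add: ennreal_le_iff)
  ultimately show ?thesis unfolding uncentered_maximal_def r_def[symmetric] m_def[symmetric] by simp
qed

subsection \<open>The uncentered maximal function\<close>

lemma LINT_reflect_tendsto:
  fixes K :: "nat \<Rightarrow> real \<Rightarrow> real"
  assumes "(\<lambda>j. LINT x|lebesgue. \<bar>K j x - g x\<bar>) \<longlonglongrightarrow> 0"
  shows "(\<lambda>j. LINT x|lebesgue. \<bar>- K j (- x) - - g (- x)\<bar>) \<longlonglongrightarrow> 0"
proof -
  have "(LINT x|lebesgue. \<bar>- K j (- x) - - g (- x)\<bar>) = (LINT x|lebesgue. \<bar>K j x - g x\<bar>)" for j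
    using lebesgue_integral_real_affine[of "-1" "\<lambda>x. \<bar>K j x - g x\<bar>" 0]
    by (simp add: abs_minus_commute)
  then show ?thesis using assms by simp
qed

theorem theorem1:
  fixes f :: "real \<Rightarrow> real" and F :: "nat \<Rightarrow> real \<Rightarrow> real"
  assumes "f \<in> W11"
    and "\<And>j. F j \<in> W11"
    and "(\<lambda>j. W11_norm (\<lambda>x. F j x - f x)) \<longlonglongrightarrow> 0"
  shows "(\<lambda>j. L1_norm (\<lambda>x. weak_derivative (uncentered_maximal (F j)) x
                          - weak_derivative (uncentered_maximal f) x)) \<longlonglongrightarrow> 0"
proof -
  obtain f' g where f': "primitive f' g" "integrable lebesgue f'" "AE x in lebesgue. f x = f' x"
    using W11_primitive[OF assms(1)] by blast
  have "\<exists>F' K. primitive F' K \<and> integrable lebesgue F' \<and> (AE x in lebesgue. F j x = F' x)" for j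
    using W11_primitive[OF assms(2)[of j]] by metis
  then obtain F' K where F': "\<And>j. primitive (F' j) (K j)" "\<And>j. integrable lebesgue (F' j)"
      "\<And>j. AE x in lebesgue. F j x = F' j x"
    by metis
  have KgI: "integrable lebesgue (\<lambda>x. K j x - g x)" for j
    by (intro Bochner_Integration.integrable_diff primitive_integrable[OF F'(1)] primitive_integrable[OF f'(1)])
  have L1: "(\<lambda>j. LINT x|lebesgue. \<bar>K j x - g x\<bar>) \<longlonglongrightarrow> 0"
  proof -
    have "L1_norm (weak_derivative (\<lambda>x. F j x - f x)) = ennreal (LINT x|lebesgue. \<bar>K j x - g x\<bar>)" for j
    proof (rule L1_norm_AE_eq[OF weak_derivative_AE_eq KgI])
      have "AE x in lebesgue. F j x - f x = F' j x - f' x"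
        using F'(3)[of j] f'(3) by eventually_elim simp
      then show "has_weak_derivative (\<lambda>x. F j x - f x) (\<lambda>x. K j x - g x)"
        by (rule has_weak_derivative_cong_AE[OF primitive_has_weak_derivative[OF primitive_diff[OF F'(1) f'(1)]]])
    qed
    then have le: "ennreal (LINT x|lebesgue. \<bar>K j x - g x\<bar>) \<le> W11_norm (\<lambda>x. F j x - f x)" for j
      by (simp add: W11_norm_def)
    have "(\<lambda>j. ennreal (LINT x|lebesgue. \<bar>K j x - g x\<bar>)) \<longlonglongrightarrow> 0"
      by (rule tendsto_sandwich[OF _ _ tendsto_const assms(3)]) (auto simp: le)
    then show ?thesis
      by (subst (asm) ennreal_0[symmetric], subst (asm) tendsto_ennreal_iff) auto
  qed
  have lim: "(\<lambda>j. F' j x) \<longlonglongrightarrow> f' x" for x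
  proof (rule LIM_zero_cancel[OF Lim_null_comparison[OF _ L1]])
    show "\<forall>\<^sub>F j in sequentially. norm (F' j x - f' x) \<le> (LINT x|lebesgue. \<bar>K j x - g x\<bar>)"
      unfolding real_norm_def using F' f'
      by (intro always_eventually allI primitive_le_L1 primitive_diff Bochner_Integration.integrable_diff)
  qed
  define a where "a x = \<bar>f' x\<bar>" for x
  define A where "A j x = \<bar>F' j x\<bar>" for j x
  define a' where "a' x = (if f' x < 0 then - g x else g x)" for x
  define A' where "A' j x = (if F' j x < 0 then - K j x else K j x)" for j x
  have na: "nonneg_sobolev a a'"
    unfolding a_def a'_def by unfold_locales (use f' primitive_abs in auto)
  have nA: "nonneg_sobolev (A j) (A' j)" for j
    unfolding A_def A'_def by unfold_locales (use F' primitive_abs in auto)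
  have aL1: "(\<lambda>j. LINT x|lebesgue. \<bar>A' j x - a' x\<bar>) \<longlonglongrightarrow> 0"
    unfolding a'_def A'_def by (rule abs_L1_limit[OF f'(1) F'(1) lim L1])
  interpret a: nonneg_sobolev a a' by (rule na)
  interpret A: nonneg_sobolev "A j" "A' j" for j by (rule nA)
  interpret ra: nonneg_sobolev "\<lambda>x. a (- x)" "\<lambda>x. - a' (- x)" by (rule a.nonneg_sobolev_reflect)
  interpret rA: nonneg_sobolev "\<lambda>x. A j (- x)" "\<lambda>x. - A' j (- x)" for j by (rule A.nonneg_sobolev_reflect)
  note right = right_maximal_L1_limit[OF na nA aL1]
  note left = right_maximal_L1_limit[OF ra.nonneg_sobolev_axioms rA.nonneg_sobolev_axioms LINT_reflect_tendsto[OF aL1]]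
  \<comment> \<open>The left maximal functions, as reflections of right ones; the chain rule puts
    the minus sign into the derivatives.\<close>
  let ?v = "\<lambda>x. ra.u (- x)" and ?q = "\<lambda>x. - ra.u' (- x)"
  let ?V = "\<lambda>j x. rA.u j (- x)" and ?Q = "\<lambda>j x. - rA.u' j (- x)"
  have v: "primitive ?v ?q" by (rule primitive_reflect[OF ra.primitive_u])
  have V: "primitive (?V j) (?Q j)" for j by (rule primitive_reflect[OF rA.primitive_u])
  define D where "D x = (a.u' x + ?q x + (if a.u x - ?v x < 0 then - (a.u' x - ?q x) else a.u' x - ?q x)) / 2" for x
  define DD where "DD j x = (A.u' j x + ?Q j x + (if A.u j x - ?V j x < 0 then - (A.u' j x - ?Q j x) else A.u' j x - ?Q j x)) / 2" for j x
  have M: "uncentered_maximal f = (\<lambda>x. max (a.u x) (?v x))"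
  proof -
    have "uncentered_maximal f = uncentered_maximal a"
      using f'(3) by (intro uncentered_maximal_cong_AE) (auto simp: a_def)
    then show ?thesis by (simp add: fun_eq_iff a.uncentered_maximal_eq)
  qed
  have MM: "uncentered_maximal (F j) = (\<lambda>x. max (A.u j x) (?V j x))" for j
  proof -
    have "uncentered_maximal (F j) = uncentered_maximal (A j)"
      using F'(3)[of j] by (intro uncentered_maximal_cong_AE) (auto simp: A_def)
    then show ?thesis by (simp add: fun_eq_iff A.uncentered_maximal_eq)
  qed
  have pD: "primitive (uncentered_maximal f) D"
    unfolding M D_def by (rule primitive_max[OF a.primitive_u v])
  have pDD: "primitive (uncentered_maximal (F j)) (DD j)" for j
    unfolding MM DD_def by (rule primitive_max[OF A.primitive_u V])
  have DL1: "(\<lambda>j. LINT x|lebesgue. \<bar>DD j x - D x\<bar>) \<longlonglongrightarrow> 0"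
    unfolding D_def DD_def
    by (rule max_L1_limit[OF a.primitive_u A.primitive_u right(2) v V left(2) right(1) LINT_reflect_tendsto[OF left(1)]])
  have "L1_norm (\<lambda>x. weak_derivative (uncentered_maximal (F j)) x - weak_derivative (uncentered_maximal f) x)
      = ennreal (LINT x|lebesgue. \<bar>DD j x - D x\<bar>)" for j
  proof (rule L1_norm_AE_eq)
    show "AE x in lebesgue. weak_derivative (uncentered_maximal (F j)) x - weak_derivative (uncentered_maximal f) x = DD j x - D x"
      using weak_derivative_AE_eq[OF primitive_has_weak_derivative[OF pD]]
        weak_derivative_AE_eq[OF primitive_has_weak_derivative[OF pDD[of j]]]
      by eventually_elim simp
    show "integrable lebesgue (\<lambda>x. DD j x - D x)"
      by (intro Bochner_Integration.integrable_diff primitive_integrable[OF pDD] primitive_integrable[OF pD])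
  qed
  then show ?thesis using tendsto_ennrealI[OF DL1] by simp
qed

end
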